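(* Let $E$ and $F$ be Banach spaces and $n\ge1$. If $\mathcal P_w(^nE,F)$ is an $M$-ideal in $\mathcal P(^nE,F)$, then every $P\in R\big(B_{\mathcal P_w(^nE,F)}\big)$ has the property that its Aron-Berner extension $\overline P\in\mathcal P(^nE^{**},F^{**})$ attains its norm on $B_{E^{**}}$.
   Context: $\mathcal P(^nE,F)$ is the Banach space of continuous $n$-homogeneous polynomials $P:E\to F$ with norm $\|P\|=\sup_{\|x\|\le1}\|P(x)\|$. $\mathcal P_w(^nE,F)$ is the subspace of polynomials that are weakly continuous on bounded sets: $\|P(x_\alpha)-P(x)\|\to0$ for every bounded net $(x_\alpha)$ converging weakly to $x\in E$. The Aron-Berner extension $\overline P$ of $P$ is its canonical extension to the bidual, obtained by weak-star density. A closed subspace $J$ of a Banach space $X$ is an $M$-ideal if there is a linear projection $\pi$ on $X^*$ with kernel $J^\perp$ such that $\|x^*\|=\|\pi(x^* )\|+\|x^*-\pi(x^* )\|$ for all $x^*\in X^*$. For a subspace $J$ of a Banach space $X$ and $x\in X$, $\rho(x,B_J)=\sup\{\|x-y\|:y\in B_J\}$, and $R(B_J)=\{x\in X:\exists\,y\in B_J,\ \|x-y\|=\rho(x,B_J)\}$; here $X=\mathcal P(^nE,F)$ and $J=\mathcal P_w(^nE,F)$. *)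

theory Defs
  imports "HOL-Analysis.Analysis" "HOL-Library.Function_Algebras" "HOL-Library.Multiset"
begin

section \<open>Scalars\<close>

text \<open>Everything is stated over a scalar field that is either \<^typ>\<open>real\<close> or \<^typ>\<open>complex\<close>,
  up to an isometric isomorphism of real algebras.\<close>

class real_or_complex = real_normed_field +
  assumes real_or_complex:
    "(\<exists>f :: 'a \<Rightarrow> real. bij f \<and> (\<forall>x y. f (x + y) = f x + f y) \<and> (\<forall>r x. f (r *\<^sub>R x) = r *\<^sub>R f x) \<and>
       (\<forall>x y. f (x * y) = f x * f y) \<and> (\<forall>x. norm (f x) = norm x))
   \<or> (\<exists>f :: 'a \<Rightarrow> complex. bij f \<and> (\<forall>x y. f (x + y) = f x + f y) \<and> (\<forall>r x. f (r *\<^sub>R x) = r *\<^sub>R f x) \<and>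
       (\<forall>x y. f (x * y) = f x * f y) \<and> (\<forall>x. norm (f x) = norm x))"

instance real :: real_or_complex
proof
  show "(\<exists>f :: real \<Rightarrow> real. bij f \<and> (\<forall>x y. f (x + y) = f x + f y) \<and> (\<forall>r x. f (r *\<^sub>R x) = r *\<^sub>R f x) \<and>
       (\<forall>x y. f (x * y) = f x * f y) \<and> (\<forall>x. norm (f x) = norm x))
   \<or> (\<exists>f :: real \<Rightarrow> complex. bij f \<and> (\<forall>x y. f (x + y) = f x + f y) \<and> (\<forall>r x. f (r *\<^sub>R x) = r *\<^sub>R f x) \<and>
       (\<forall>x y. f (x * y) = f x * f y) \<and> (\<forall>x. norm (f x) = norm x))"
    by (intro disjI1 exI[of _ "\<lambda>x. x"]) (simp add: bij_def inj_on_def surj_def algebra_simps)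
qed

instance complex :: real_or_complex
proof
  show "(\<exists>f :: complex \<Rightarrow> real. bij f \<and> (\<forall>x y. f (x + y) = f x + f y) \<and> (\<forall>r x. f (r *\<^sub>R x) = r *\<^sub>R f x) \<and>
       (\<forall>x y. f (x * y) = f x * f y) \<and> (\<forall>x. norm (f x) = norm x))
   \<or> (\<exists>f :: complex \<Rightarrow> complex. bij f \<and> (\<forall>x y. f (x + y) = f x + f y) \<and> (\<forall>r x. f (r *\<^sub>R x) = r *\<^sub>R f x) \<and>
       (\<forall>x y. f (x * y) = f x * f y) \<and> (\<forall>x. norm (f x) = norm x))"
    by (intro disjI2 exI[of _ "\<lambda>x. x"]) (simp add: bij_def inj_on_def surj_def algebra_simps)
qed

section \<open>Banach spaces\<close>

text \<open>
  Duals and spaces of polynomials depend on terms (the scalar multiplications and the degree), so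
  they cannot be types.  A normed space is therefore a linear subspace \<open>vecs\<close> of an ambient vector
  space, with a norm that is only meaningful on \<open>vecs\<close>.  Function spaces live in the ambient space
  of all functions; their members are required to vanish off the domain, so that equality of members
  is equality of functions.
\<close>

record ('k, 'v) nspace =
  vecs :: "'v set"
  smul :: "'k \<Rightarrow> 'v \<Rightarrow> 'v"
  vnorm :: "'v \<Rightarrow> real"

text \<open>The value off \<open>vecs\<close> is set to 0 because the locale \<^locale>\<open>Metric_space\<close> wants a nonnegative
  symmetric function on the whole type.\<close>

definition vdist :: "('k, 'v::ab_group_add) nspace \<Rightarrow> 'v \<Rightarrow> 'v \<Rightarrow> real" where
  "vdist E x y = (if x \<in> vecs E \<and> y \<in> vecs E then vnorm E (x - y) else 0)"

definition norm_topology :: "('k, 'v::ab_group_add) nspace \<Rightarrow> 'v topology" where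
  "norm_topology E = Metric_space.mtopology (vecs E) (vdist E)"

definition is_normed_space :: "('k::real_or_complex, 'v::ab_group_add) nspace \<Rightarrow> bool" where
  "is_normed_space E \<longleftrightarrow>
     vector_space (smul E) \<and> module.subspace (smul E) (vecs E) \<and>
     (\<forall>x\<in>vecs E. 0 \<le> vnorm E x \<and> (vnorm E x = 0 \<longleftrightarrow> x = 0)) \<and>
     (\<forall>x\<in>vecs E. \<forall>c. vnorm E (smul E c x) = norm c * vnorm E x) \<and>
     (\<forall>x\<in>vecs E. \<forall>y\<in>vecs E. vnorm E (x + y) \<le> vnorm E x + vnorm E y)"

definition is_banach_space :: "('k::real_or_complex, 'v::ab_group_add) nspace \<Rightarrow> bool" where
  "is_banach_space E \<longleftrightarrow> is_normed_space E \<and> Metric_space.mcomplete (vecs E) (vdist E)"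

definition unit_ball :: "('k, 'v) nspace \<Rightarrow> 'v set" where
  "unit_ball E = {x \<in> vecs E. vnorm E x \<le> 1}"

lemma Metric_space_vdist:
  assumes "is_normed_space (E :: ('k::real_or_complex, 'v::ab_group_add) nspace)"
  shows "Metric_space (vecs E) (vdist E)"
proof -
  interpret vector_space "smul E"
    using assms by (simp add: is_normed_space_def)
  have sub: "subspace (vecs E)"
    and pos: "\<And>x. x \<in> vecs E \<Longrightarrow> 0 \<le> vnorm E x \<and> (vnorm E x = 0 \<longleftrightarrow> x = 0)"
    and hom: "\<And>x c. x \<in> vecs E \<Longrightarrow> vnorm E (smul E c x) = norm c * vnorm E x"
    and tri: "\<And>x y. x \<in> vecs E \<Longrightarrow> y \<in> vecs E \<Longrightarrow> vnorm E (x + y) \<le> vnorm E x + vnorm E y"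
    using assms by (auto simp: is_normed_space_def)
  have com: "vnorm E (x - y) = vnorm E (y - x)" if "x \<in> vecs E" "y \<in> vecs E" for x y
    using hom[of "x - y" "- 1"] subspace_diff[OF sub that] by simp
  show ?thesis
  proof
    fix x y z assume "x \<in> vecs E" "y \<in> vecs E" "z \<in> vecs E"
    then show "vdist E x z \<le> vdist E x y + vdist E y z"
      using tri[of "x - y" "y - z"] by (simp add: vdist_def subspace_diff[OF sub])
  qed (auto simp: vdist_def com pos subspace_diff[OF sub])
qed

text \<open>Types of class \<^class>\<open>banach\<close>, with any compatible scalar multiplication, are covered.\<close>

lemma is_banach_space_UNIV:
  fixes s :: "'k::real_or_complex \<Rightarrow> 'v::banach \<Rightarrow> 'v"
  assumes "vector_space s" and "\<And>c x. norm (s c x) = norm c * norm x"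
  shows "is_banach_space \<lparr>vecs = UNIV, smul = s, vnorm = norm\<rparr>"
proof -
  let ?E = "\<lparr>vecs = UNIV, smul = s, vnorm = norm\<rparr>"
  interpret vector_space s by fact
  have "vdist ?E = dist"
    by (simp add: fun_eq_iff vdist_def dist_norm)
  moreover have "is_normed_space ?E"
    using assms by (simp add: is_normed_space_def norm_triangle_ineq)
  moreover have "Metric_space.mcomplete (UNIV :: 'v set) dist"
    using complete_UNIV by simp
  ultimately show ?thesis
    by (simp add: is_banach_space_def)
qed

section \<open>Duals and M-ideals\<close>

definition dual_space ::
    "('k::real_or_complex, 'v::ab_group_add) nspace \<Rightarrow> ('k, 'v \<Rightarrow> 'k) nspace" where
  "dual_space E =
     \<lparr>vecs = {\<phi>. (\<forall>x. x \<notin> vecs E \<longrightarrow> \<phi> x = 0) \<and>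
                  (\<forall>x\<in>vecs E. \<forall>y\<in>vecs E. \<phi> (x + y) = \<phi> x + \<phi> y) \<and>
                  (\<forall>c. \<forall>x\<in>vecs E. \<phi> (smul E c x) = c * \<phi> x) \<and>
                  (\<exists>C. \<forall>x\<in>vecs E. norm (\<phi> x) \<le> C * vnorm E x)},
      smul = (\<lambda>c \<phi> x. c * \<phi> x),
      vnorm = (\<lambda>\<phi>. SUP x\<in>unit_ball E. norm (\<phi> x))\<rparr>"

abbreviation bidual_space ::
    "('k::real_or_complex, 'v::ab_group_add) nspace \<Rightarrow> ('k, ('v \<Rightarrow> 'k) \<Rightarrow> 'k) nspace" where
  "bidual_space E \<equiv> dual_space (dual_space E)"

definition annihilator ::
    "('k::real_or_complex, 'v::ab_group_add) nspace \<Rightarrow> 'v set \<Rightarrow> ('v \<Rightarrow> 'k) set" where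
  "annihilator X J = {\<phi> \<in> vecs (dual_space X). \<forall>y\<in>J. \<phi> y = 0}"

definition is_M_ideal :: "'v set \<Rightarrow> ('k::real_or_complex, 'v::ab_group_add) nspace \<Rightarrow> bool" where
  "is_M_ideal J X \<longleftrightarrow>
     J \<subseteq> vecs X \<and> module.subspace (smul X) J \<and> closedin (norm_topology X) J \<and>
     (\<exists>\<pi>. (\<forall>\<phi>\<in>vecs (dual_space X). \<pi> \<phi> \<in> vecs (dual_space X) \<and> \<pi> (\<pi> \<phi>) = \<pi> \<phi>) \<and>
          (\<forall>\<phi>\<in>vecs (dual_space X). \<forall>\<psi>\<in>vecs (dual_space X). \<pi> (\<phi> + \<psi>) = \<pi> \<phi> + \<pi> \<psi>) \<and>
          (\<forall>c. \<forall>\<phi>\<in>vecs (dual_space X).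
             \<pi> (smul (dual_space X) c \<phi>) = smul (dual_space X) c (\<pi> \<phi>)) \<and>
          {\<phi> \<in> vecs (dual_space X). \<pi> \<phi> = 0} = annihilator X J \<and>
          (\<forall>\<phi>\<in>vecs (dual_space X).
             vnorm (dual_space X) \<phi> =
               vnorm (dual_space X) (\<pi> \<phi>) + vnorm (dual_space X) (\<phi> - \<pi> \<phi>)))"

section \<open>Farthest points\<close>

definition rho :: "('k, 'v::ab_group_add) nspace \<Rightarrow> 'v \<Rightarrow> 'v set \<Rightarrow> real" where
  "rho X x B = (SUP y\<in>B. vnorm X (x - y))"

definition remotal_points :: "('k, 'v::ab_group_add) nspace \<Rightarrow> 'v set \<Rightarrow> 'v set" where
  "remotal_points X B = {x \<in> vecs X. \<exists>y\<in>B. vnorm X (x - y) = rho X x B}"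

section \<open>Homogeneous polynomials\<close>

text \<open>An \<open>n\<close>-linear map takes its arguments as a list of length \<open>n\<close>; its values on other lists are
  irrelevant.\<close>

definition multilinear_map ::
    "nat \<Rightarrow> ('k, 'e::ab_group_add) nspace \<Rightarrow> ('k, 'f::ab_group_add) nspace \<Rightarrow> ('e list \<Rightarrow> 'f) \<Rightarrow> bool" where
  "multilinear_map n E F A \<longleftrightarrow>
     (\<forall>xs. length xs = n \<and> set xs \<subseteq> vecs E \<longrightarrow>
        A xs \<in> vecs F \<and>
        (\<forall>i<n. \<forall>x\<in>vecs E. \<forall>y\<in>vecs E. A (xs[i := x + y]) = A (xs[i := x]) + A (xs[i := y])) \<and>
        (\<forall>i<n. \<forall>c. \<forall>x\<in>vecs E. A (xs[i := smul E c x]) = smul F c (A (xs[i := x]))))"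

definition symmetric_map :: "nat \<Rightarrow> ('k, 'e) nspace \<Rightarrow> ('e list \<Rightarrow> 'f) \<Rightarrow> bool" where
  "symmetric_map n E A \<longleftrightarrow>
     (\<forall>xs ys. length xs = n \<and> set xs \<subseteq> vecs E \<and> mset xs = mset ys \<longrightarrow> A xs = A ys)"

definition poly_space ::
    "nat \<Rightarrow> ('k, 'e::ab_group_add) nspace \<Rightarrow> ('k, 'f::ab_group_add) nspace \<Rightarrow> ('k, 'e \<Rightarrow> 'f) nspace" where
  "poly_space n E F =
     \<lparr>vecs = {P. (\<forall>x. x \<notin> vecs E \<longrightarrow> P x = 0) \<and>
                  (\<exists>A. multilinear_map n E F A \<and> (\<forall>x\<in>vecs E. P x = A (replicate n x))) \<and>
                  continuous_map (norm_topology E) (norm_topology F) P},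
      smul = (\<lambda>c P x. smul F c (P x)),
      vnorm = (\<lambda>P. SUP x\<in>unit_ball E. vnorm F (P x))\<rparr>"

text \<open>Nets are rendered by filters: a net gives the image of its tail filter, and every filter on
  \<open>E\<close> arises in this way.\<close>

definition weakly_continuous_polys ::
    "nat \<Rightarrow> ('k::real_or_complex, 'e::ab_group_add) nspace \<Rightarrow> ('k, 'f::ab_group_add) nspace \<Rightarrow>
     ('e \<Rightarrow> 'f) set" where
  "weakly_continuous_polys n E F =
     {P \<in> vecs (poly_space n E F).
        \<forall>x\<in>vecs E. \<forall>\<F> r.
          (\<forall>\<^sub>F y in \<F>. y \<in> vecs E \<and> vnorm E y \<le> r) \<and>
          (\<forall>\<phi>\<in>vecs (dual_space E). (\<phi> \<longlongrightarrow> \<phi> x) \<F>) \<longrightarrow>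
          ((\<lambda>y. vnorm F (P y - P x)) \<longlongrightarrow> 0) \<F>}"

section \<open>The Aron-Berner extension\<close>

text \<open>The filter of those \<open>x \<in> E\<close> that tend to \<open>z \<in> E\<^sup>*\<^sup>*\<close> in the weak-star topology.  By weak-star
  density of \<open>E\<close> in its bidual it is a proper filter.\<close>

definition weak_star_to ::
    "('k::real_or_complex, 'e::ab_group_add) nspace \<Rightarrow> (('e \<Rightarrow> 'k) \<Rightarrow> 'k) \<Rightarrow> 'e filter" where
  "weak_star_to E z =
     inf (principal (vecs E)) (INF \<phi>\<in>vecs (dual_space E). filtercomap \<phi> (nhds (z \<phi>)))"

text \<open>The iterated limit of \<open>g [x\<^sub>1, \<dots>, x\<^sub>n]\<close> as \<open>x\<^sub>n \<rightarrow> z\<^sub>n\<close>, \<dots>, \<open>x\<^sub>1 \<rightarrow> z\<^sub>1\<close>, the limit in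
  \<open>x\<^sub>n\<close> being taken first.\<close>

fun iterated_limit ::
    "('k::real_or_complex, 'e::ab_group_add) nspace \<Rightarrow> ('e list \<Rightarrow> 'k) \<Rightarrow> (('e \<Rightarrow> 'k) \<Rightarrow> 'k) list \<Rightarrow> 'k" where
  "iterated_limit E g [] = g []"
| "iterated_limit E g (z # zs) =
     Lim (weak_star_to E z) (\<lambda>x. iterated_limit E (\<lambda>xs. g (x # xs)) zs)"

text \<open>Determined by \<open>P\<close> on the lists of length \<open>n\<close> in \<open>E\<close>, by polarization.\<close>

definition symmetric_form ::
    "nat \<Rightarrow> ('k, 'e::ab_group_add) nspace \<Rightarrow> ('k, 'f::ab_group_add) nspace \<Rightarrow> ('e \<Rightarrow> 'f) \<Rightarrow> 'e list \<Rightarrow> 'f" where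
  "symmetric_form n E F P =
     (SOME A. multilinear_map n E F A \<and> symmetric_map n E A \<and> (\<forall>x\<in>vecs E. P x = A (replicate n x)))"

text \<open>The limits of the symmetric form are taken in the weak-star topology of the bidual of \<open>F\<close>,
  that is, after applying each functional of the dual of \<open>F\<close>.\<close>

definition aron_berner ::
    "nat \<Rightarrow> ('k::real_or_complex, 'e::ab_group_add) nspace \<Rightarrow> ('k, 'f::ab_group_add) nspace \<Rightarrow>
     ('e \<Rightarrow> 'f) \<Rightarrow> (('e \<Rightarrow> 'k) \<Rightarrow> 'k) \<Rightarrow> ('f \<Rightarrow> 'k) \<Rightarrow> 'k" where
  "aron_berner n E F P z \<psi> =
     (if z \<in> vecs (bidual_space E) \<and> \<psi> \<in> vecs (dual_space F)
      then iterated_limit E (\<lambda>xs. \<psi> (symmetric_form n E F P xs)) (replicate n z)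
      else 0)"

end

theory Submission
  imports Defs "HOL-Combinatorics.Multiset_Permutations"
begin

text \<open>
  Let \<open>x\<close> be a unit vector at which \<open>\<parallel>P x\<parallel>\<close> is close to \<open>\<parallel>P\<parallel>\<close> and \<open>\<gamma>\<close> a functional norming it.  Subtracting
  \<open>- \<gamma>\<^sup>n P x / \<parallel>P x\<parallel>\<close> from \<open>P\<close> shows that the farthest distance from \<open>P\<close> to the unit ball of \<open>\<P>\<^sub>w\<close> is
  \<open>\<parallel>P\<parallel> + 1\<close>.  If it is attained at \<open>Q\<close>, there are \<open>x\<^sub>k\<close> in the unit ball and norm-one functionals \<open>\<psi>\<^sub>k\<close>
  with \<open>\<psi>\<^sub>k (P x\<^sub>k) \<rightarrow> \<parallel>P\<parallel>\<close> and \<open>\<psi>\<^sub>k (Q x\<^sub>k) \<rightarrow> - 1\<close>.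
  Pass to weak-star limits \<open>z\<close> of \<open>x\<^sub>k\<close>, \<open>\<psi>\<close> of \<open>\<psi>\<^sub>k\<close> and \<open>\<phi>\<close> of the functionals
  \<open>R \<mapsto> \<psi>\<^sub>k (R x\<^sub>k)\<close>.  A polynomial that is weakly continuous on bounded sets is weakly uniformly so,
  hence \<open>\<phi>\<close> agrees on \<open>\<P>\<^sub>w\<close> with the functional \<open>e\<close> evaluating Aron--Berner extensions at \<open>z\<close> and
  \<open>\<psi>\<close>; by the Davie--Gamelin theorem \<open>e\<close> has norm at most 1.  Both functionals have norm 1 already on \<open>\<P>\<^sub>w\<close>,
  so they coincide because norm-preserving extensions from an M-ideal are unique.  Therefore the
  extension of \<open>P\<close> has modulus \<open>\<parallel>P\<parallel>\<close> at \<open>z\<close> and \<open>\<psi>\<close>.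
\<close>

section \<open>Scalars and compactness\<close>

text \<open>Two gaps separate the evaluation at \<open>z\<close> from the evaluations at
  \<open>x k\<close>. First, \<open>z\<close> is usually outside E, while membership in
  \<open>weakly_continuous_polys\<close> controls limits at points of E only; hence the detour
  through a Cauchy property along weak-star convergent filters. Second, the extension is an iterated
  limit, and for general P it is not the limit of P(x) as x tends to z, so \<phi> and e cannot be
  compared at P directly. They are compared on the subspace, and uniqueness carries the comparison
  to P. That uniqueness is an equality case, so e must have norm at most 1 with no loss.
  Polarization alone bounds the extension by a constant that grows with n; the Davie--Gamelin
  averaging removes it. The distance \<parallel>P\<parallel> + 1 is used in the same way: the moduli
  of \<phi> at P and at Q are at most \<parallel>P\<parallel> and 1 and add up to at least the
  distance, so both bounds are equalities, and Q witnesses that both functionals have norm 1 on the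
  subspace. Balls of duals need not be sequentially compact, so all limits run along a filter finer
  than that of the index k.\<close>

lemma real_or_complex_embedding:
  "\<exists>h :: 'k::real_or_complex \<Rightarrow> complex. (\<forall>x y. h (x + y) = h x + h y) \<and> (\<forall>x y. h (x * y) = h x * h y) \<and>
     (\<forall>x. norm (h x) = norm x) \<and> (\<forall>r. h (of_real r) = of_real r) \<and>
     (range h = range of_real \<or> range h = UNIV)"
  using real_or_complex[where 'a='k]
proof (elim disjE exE conjE)
  fix f :: "'k \<Rightarrow> real"
  assume f: "bij f" "\<forall>x y. f (x + y) = f x + f y" "\<forall>r x. f (r *\<^sub>R x) = r *\<^sub>R f x"
    "\<forall>x y. f (x * y) = f x * f y" "\<forall>x. norm (f x) = norm x"
  \<comment> \<open>\<open>f 1\<close> is an idempotent of a field and nonzero because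
    \<open>f\<close> is isometric, hence 1; this fixes \<open>f\<close> on all real scalars.\<close>
  have "f 1 * f 1 = f 1" using f(4) by (metis mult_1)
  moreover have "f 1 \<noteq> 0" using f(5) by (metis norm_one norm_zero zero_neq_one)
  ultimately have f1: "f 1 = 1" by simp
  show ?thesis
  proof (intro exI[of _ "\<lambda>x. complex_of_real (f x)"] conjI allI disjI1)
    show "complex_of_real (f (of_real r)) = complex_of_real r" for r
      using f(3) f1 by (simp add: of_real_def)
    show "range (\<lambda>x. complex_of_real (f x)) = range complex_of_real"
      using f(1) by (metis bij_is_surj image_image)
  qed (use f in auto)
next
  fix f :: "'k \<Rightarrow> complex"
  assume f: "bij f" "\<forall>x y. f (x + y) = f x + f y" "\<forall>r x. f (r *\<^sub>R x) = r *\<^sub>R f x"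
    "\<forall>x y. f (x * y) = f x * f y" "\<forall>x. norm (f x) = norm x"
  have "f 1 * f 1 = f 1" using f(4) by (metis mult_1)
  moreover have "f 1 \<noteq> 0" using f(5) by (metis norm_one norm_zero zero_neq_one)
  ultimately have f1: "f 1 = 1" by simp
  show ?thesis
  proof (intro exI[of _ f] conjI allI disjI2)
    show "f (of_real r) = complex_of_real r" for r
      using f(3) f1 by (simp add: of_real_def)
    show "range f = UNIV"
      using f(1) by (rule bij_is_surj)
  qed (use f in auto)
qed

text \<open>The class offers neither real parts nor conjugates. One fixed embedding into the complex
  numbers supplies both, and \<open>range_kc\<close> leaves a case split only where the size of the
  field matters.\<close>

definition kc :: "'k::real_or_complex \<Rightarrow> complex" where
  "kc = (SOME h. (\<forall>x y. h (x + y) = h x + h y) \<and> (\<forall>x y. h (x * y) = h x * h y) \<and>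
     (\<forall>x. norm (h x) = norm x) \<and> (\<forall>r. h (of_real r) = of_real r) \<and>
     (range h = range of_real \<or> range h = UNIV))"

lemma
  fixes x y :: "'k::real_or_complex" and r :: real
  shows kc_add: "kc (x + y) = kc x + kc y"
  and kc_mult: "kc (x * y) = kc x * kc y"
  and norm_kc [simp]: "norm (kc x) = norm x"
  and kc_of_real [simp]: "kc (of_real r :: 'k) = of_real r"
  and range_kc: "range (kc :: 'k::real_or_complex \<Rightarrow> complex) = range of_real \<or>
                 range (kc :: 'k \<Rightarrow> complex) = UNIV"
  using someI_ex[OF real_or_complex_embedding[where 'k='k], folded kc_def] by auto

lemma kc_0 [simp]: "kc 0 = 0"
  using kc_of_real[of 0] by simp

lemma kc_minus: "kc (- x) = - kc x"
  by (metis add.left_inverse eq_neg_iff_add_eq_0 kc_0 kc_add)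

lemma kc_diff: "kc (x - y) = kc x - kc y"
  using kc_add[of x "- y"] by (simp add: kc_minus)

lemma kc_sum: "kc (sum f A) = (\<Sum>a\<in>A. kc (f a))"
  by (induction A rule: infinite_finite_induct) (auto simp: kc_add)

lemma kc_inject: "kc x = kc y \<longleftrightarrow> x = y"
  by (metis eq_iff_diff_eq_0 kc_diff norm_eq_zero norm_kc)

text \<open>Either possible range, the reals or all complex numbers, is stable under conjugation.
  The conjugates serve as weights in \<open>Goldstine\<close>.\<close>

lemma kc_cnj_ex:
  fixes x :: "'a::real_or_complex"
  shows "\<exists>y :: 'a. kc y = cnj (kc x)"
proof -
  from range_kc[where 'k='a] show ?thesis
  proof
    assume r: "range (kc :: 'a \<Rightarrow> complex) = range of_real"
    have "kc x \<in> range (of_real :: real \<Rightarrow> complex)" unfolding r[symmetric] by simp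
    then obtain t where "kc x = complex_of_real t" by (rule rangeE)
    then show ?thesis by (intro exI[of _ x]) simp
  next
    assume "range (kc :: 'a \<Rightarrow> complex) = UNIV"
    then have "cnj (kc x) \<in> range (kc :: 'a \<Rightarrow> complex)" by simp
    then obtain y :: 'a where "cnj (kc x) = kc y" by (rule rangeE)
    then show ?thesis by (intro exI[of _ y]) simp
  qed
qed

definition kre :: "'k::real_or_complex \<Rightarrow> real" where
  "kre x = Re (kc x)"

lemma kre_diff: "kre (x - y) = kre x - kre y"
  and kre_of_real [simp]: "kre (of_real r) = r"
  and kre_le_norm: "kre x \<le> norm x"
  using complex_Re_le_cmod[of "kc x"] by (simp_all add: kre_def kc_diff)

lemma unimodular_rotation:
  fixes y :: "'k::real_or_complex"
  obtains c where "norm c = 1" "c * y = of_real (norm y)"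
proof (cases "y = 0")
  case True
  with that[of 1] show ?thesis by simp
next
  case False
  with that[of "of_real (norm y) / y"] show ?thesis by (simp add: norm_divide)
qed

text \<open>Compactness is carried over from the reals by \<open>of_real\<close> and from the
  complex numbers by the inverse of \<open>kc\<close>, which is an isometry.\<close>

lemma compact_cball_scalar: "compact (cball (0::'k::real_or_complex) r)"
  using range_kc[where 'k='k]
proof
  assume r: "range (kc :: 'k \<Rightarrow> complex) = range of_real"
  have "cball (0::'k) r = of_real ` cball (0::real) r"
  proof (intro equalityI subsetI)
    fix x :: 'k assume x: "x \<in> cball 0 r"
    have "kc x \<in> range (of_real :: real \<Rightarrow> complex)" unfolding r[symmetric] by simp
    then obtain t where "kc x = complex_of_real t" by (rule rangeE)
    then have "x = of_real t" by (metis kc_inject kc_of_real)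
    with x show "x \<in> of_real ` cball (0::real) r" by auto
  qed auto
  then show ?thesis
    by (simp only:) (intro compact_continuous_image continuous_intros compact_cball)
next
  assume "range (kc :: 'k \<Rightarrow> complex) = UNIV"
  then have kci: "kc (inv (kc :: 'k \<Rightarrow> complex) w) = w" for w by (simp add: surj_f_inv_f)
  have nrm: "norm (inv (kc :: 'k \<Rightarrow> complex) w - inv kc w') = norm (w - w')" for w w'
    using norm_kc[of "inv (kc :: 'k \<Rightarrow> complex) w - inv kc w'"] by (simp add: kc_diff kci)
  have nrm0: "norm (inv (kc :: 'k \<Rightarrow> complex) w) = norm w" for w
    using norm_kc[of "inv (kc :: 'k \<Rightarrow> complex) w"] by (simp add: kci)
  have "continuous_on (cball 0 r) (inv (kc :: 'k \<Rightarrow> complex))"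
    unfolding continuous_on_iff dist_norm nrm by blast
  moreover have "cball (0::'k) r = inv kc ` cball 0 r"
  proof (intro equalityI subsetI)
    fix x :: 'k assume "x \<in> cball 0 r"
    then have "kc x \<in> cball 0 r" "x = inv kc (kc x)"
      by (auto simp: kci kc_inject[symmetric])
    then show "x \<in> inv kc ` cball 0 r" by blast
  qed (auto simp: nrm0)
  ultimately show ?thesis
    by (simp only:) (intro compact_continuous_image compact_cball)
qed

text \<open>The compactness behind the Banach--Alaoglu theorem: by Tychonoff the points
  \<open>p a\<close> stay in a compact product of balls, and their filter has a cluster point
  \<open>c\<close>. Pulling back the neighbourhoods of \<open>c\<close> and meeting with
  \<open>\<F>\<close> gives a finer filter along which all coordinates converge at once.\<close>

lemma refine_filter_bounded_family:
  fixes f :: "'i \<Rightarrow> 'a \<Rightarrow> 'k::real_or_complex"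
  assumes "\<F> \<noteq> bot" and bdd: "\<And>i. \<exists>M. \<forall>a. norm (f i a) \<le> M"
  obtains \<G> l where "\<G> \<le> \<F>" "\<G> \<noteq> bot" "\<And>i. (f i \<longlongrightarrow> l i) \<G>"
proof -
  obtain M where M: "\<And>i a. norm (f i a) \<le> M i" using bdd by metis
  define p where "p a = (\<lambda>i. f i a)" for a
  define K where "K = PiE UNIV (\<lambda>i. cball (0::'k) (M i))"
  have "compactin (product_topology (\<lambda>i. euclidean::'k topology) UNIV) K"
    unfolding K_def compactin_PiE by (simp add: compact_cball_scalar)
  then have "compact K"
    by (simp add: euclidean_product_topology)
  moreover have "filtermap p \<F> \<noteq> bot" using assms(1) by (simp add: filtermap_bot_iff)
  moreover have "eventually (\<lambda>x. x \<in> K) (filtermap p \<F>)"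
    by (simp add: eventually_filtermap K_def p_def M PiE_UNIV_domain)
  ultimately obtain c where c: "inf (nhds c) (filtermap p \<F>) \<noteq> bot"
    unfolding compact_filter by blast
  define \<G> where "\<G> = inf \<F> (filtercomap p (nhds c))"
  have "\<G> \<noteq> bot"
  proof
    assume "\<G> = bot"
    then have "eventually (\<lambda>x. False) \<G>" by simp
    then obtain A B where "eventually A \<F>" "eventually B (nhds c)" "\<And>x. A x \<Longrightarrow> B (p x) \<Longrightarrow> False"
      unfolding \<G>_def eventually_inf eventually_filtercomap by blast
    then have "eventually (\<lambda>y. \<not> B y) (filtermap p \<F>)" "eventually B (nhds c)"
      by (auto simp: eventually_filtermap elim!: eventually_mono)
    then have "eventually (\<lambda>x. False) (inf (nhds c) (filtermap p \<F>))"
      unfolding eventually_inf by blast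
    with c show False by (simp add: trivial_limit_def)
  qed
  moreover have "(f i \<longlongrightarrow> c i) \<G>" for i
  proof -
    have "((\<lambda>x. x i) \<longlongrightarrow> c i) (nhds c)"
      unfolding tendsto_def eventually_nhds
    proof (intro allI impI)
      fix S :: "'k set" assume "open S" "c i \<in> S"
      moreover from \<open>open S\<close> have "open ((\<lambda>x::'i \<Rightarrow> 'k. x i) -` S)"
        by (rule open_vimage[OF _ continuous_on_product_coordinates])
      ultimately show "\<exists>T. open T \<and> c \<in> T \<and> (\<forall>x\<in>T. x i \<in> S)"
        by (intro exI[of _ "(\<lambda>x. x i) -` S"]) auto
    qed
    moreover have "filterlim p (nhds c) \<G>"
      unfolding \<G>_def by (rule filterlim_mono[OF filterlim_filtercomap order_refl inf_le2])
    ultimately have "((\<lambda>a. p a i) \<longlongrightarrow> c i) \<G>"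
      by (rule filterlim_compose)
    then show ?thesis by (simp add: p_def)
  qed
  moreover have "\<G> \<le> \<F>" by (simp add: \<G>_def)
  ultimately show ?thesis using that by blast
qed

section \<open>Normed spaces and their duals\<close>

locale normed_sp =
  fixes E :: "('k::real_or_complex, 'v::ab_group_add) nspace"
  assumes normed: "is_normed_space E"
begin

sublocale V: vector_space "smul E"
  using normed by (simp add: is_normed_space_def)

lemma sub: "V.subspace (vecs E)"
  using normed by (simp add: is_normed_space_def)

lemma zero_mem [simp]: "0 \<in> vecs E"
  and add_mem [simp]: "x \<in> vecs E \<Longrightarrow> y \<in> vecs E \<Longrightarrow> x + y \<in> vecs E"
  and diff_mem [simp]: "x \<in> vecs E \<Longrightarrow> y \<in> vecs E \<Longrightarrow> x - y \<in> vecs E"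
  and minus_mem [simp]: "x \<in> vecs E \<Longrightarrow> - x \<in> vecs E"
  and smul_mem [simp]: "x \<in> vecs E \<Longrightarrow> smul E c x \<in> vecs E"
  and sum_mem: "(\<And>a. a \<in> A \<Longrightarrow> g a \<in> vecs E) \<Longrightarrow> sum g A \<in> vecs E"
  using sub by (auto intro: V.subspace_0 V.subspace_add V.subspace_diff V.subspace_neg
      V.subspace_scale V.subspace_sum)

lemma norm_nonneg [simp]: "x \<in> vecs E \<Longrightarrow> 0 \<le> vnorm E x"
  and norm_eq_0: "x \<in> vecs E \<Longrightarrow> vnorm E x = 0 \<longleftrightarrow> x = 0"
  and norm_smul: "x \<in> vecs E \<Longrightarrow> vnorm E (smul E c x) = norm c * vnorm E x"
  and norm_add_le: "x \<in> vecs E \<Longrightarrow> y \<in> vecs E \<Longrightarrow> vnorm E (x + y) \<le> vnorm E x + vnorm E y"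
  using normed by (auto simp: is_normed_space_def)

lemma norm_0 [simp]: "vnorm E 0 = 0"
  by (simp add: norm_eq_0)

lemma norm_minus: "x \<in> vecs E \<Longrightarrow> vnorm E (- x) = vnorm E x"
  using norm_smul[of x "- 1"] by simp

lemma norm_diff_le: "x \<in> vecs E \<Longrightarrow> y \<in> vecs E \<Longrightarrow> vnorm E (x - y) \<le> vnorm E x + vnorm E y"
  using norm_add_le[of x "- y"] by (simp add: norm_minus)

lemma norm_sum_le: "(\<And>a. a \<in> A \<Longrightarrow> g a \<in> vecs E) \<Longrightarrow> vnorm E (sum g A) \<le> (\<Sum>a\<in>A. vnorm E (g a))"
proof (induction A rule: infinite_finite_induct)
  case (insert a A)
  then have "vnorm E (g a + sum g A) \<le> vnorm E (g a) + vnorm E (sum g A)"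
    by (intro norm_add_le sum_mem) auto
  with insert show ?case by auto
qed auto

lemma zero_mem_unit_ball [simp]: "0 \<in> unit_ball E"
  by (simp add: unit_ball_def)

lemma norm_normalize:
  assumes "x \<in> vecs E" "x \<noteq> 0"
  shows "vnorm E (smul E (of_real (1 / vnorm E x)) x) = 1"
  using assms norm_eq_0[of x] by (simp add: norm_smul norm_divide)

sublocale M: Metric_space "vecs E" "vdist E"
  using normed by (rule Metric_space_vdist)

lemma norm_topology_eq: "norm_topology E = M.mtopology"
  by (simp add: norm_topology_def)

subsection \<open>The dual\<close>

lemma dual_memD:
  assumes "\<phi> \<in> vecs (dual_space E)"
  shows dual_outside: "x \<notin> vecs E \<Longrightarrow> \<phi> x = 0"
    and dual_add: "x \<in> vecs E \<Longrightarrow> y \<in> vecs E \<Longrightarrow> \<phi> (x + y) = \<phi> x + \<phi> y"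
    and dual_smul: "x \<in> vecs E \<Longrightarrow> \<phi> (smul E c x) = c * \<phi> x"
  using assms by (auto simp: dual_space_def)

lemma dual_memI:
  assumes "\<And>x. x \<notin> vecs E \<Longrightarrow> \<phi> x = 0"
    and "\<And>x y. x \<in> vecs E \<Longrightarrow> y \<in> vecs E \<Longrightarrow> \<phi> (x + y) = \<phi> x + \<phi> y"
    and "\<And>x c. x \<in> vecs E \<Longrightarrow> \<phi> (smul E c x) = c * \<phi> x"
    and "\<And>x. x \<in> vecs E \<Longrightarrow> norm (\<phi> x) \<le> C * vnorm E x"
  shows "\<phi> \<in> vecs (dual_space E)"
  using assms by (auto simp: dual_space_def intro!: exI[of _ C])

lemma dual_0 [simp]: "\<phi> \<in> vecs (dual_space E) \<Longrightarrow> \<phi> 0 = 0"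
  using dual_smul[of \<phi> 0 0] by simp

lemma dual_minus: "\<phi> \<in> vecs (dual_space E) \<Longrightarrow> x \<in> vecs E \<Longrightarrow> \<phi> (- x) = - \<phi> x"
  using dual_smul[of \<phi> x "- 1"] by simp

lemma dual_diff:
  "\<phi> \<in> vecs (dual_space E) \<Longrightarrow> x \<in> vecs E \<Longrightarrow> y \<in> vecs E \<Longrightarrow> \<phi> (x - y) = \<phi> x - \<phi> y"
  using dual_add[of \<phi> x "- y"] by (simp add: dual_minus)

lemma dual_sum:
  assumes "\<phi> \<in> vecs (dual_space E)" "\<And>a. a \<in> A \<Longrightarrow> g a \<in> vecs E"
  shows "\<phi> (sum g A) = (\<Sum>a\<in>A. \<phi> (g a))"
  using assms(2)
  by (induction A rule: infinite_finite_induct) (auto simp: assms(1) dual_add sum_mem)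

lemma dual_bdd_above:
  assumes "\<phi> \<in> vecs (dual_space E)"
  shows "bdd_above ((\<lambda>x. norm (\<phi> x)) ` unit_ball E)"
proof -
  obtain C where C: "\<And>x. x \<in> vecs E \<Longrightarrow> norm (\<phi> x) \<le> C * vnorm E x"
    using assms unfolding dual_space_def by fastforce
  have "norm (\<phi> x) \<le> \<bar>C\<bar>" if "x \<in> unit_ball E" for x
  proof -
    have "norm (\<phi> x) \<le> C * vnorm E x" using that C by (simp add: unit_ball_def)
    also have "\<dots> \<le> \<bar>C\<bar> * 1" using that by (intro mult_mono) (auto simp: unit_ball_def)
    finally show ?thesis by simp
  qed
  then show ?thesis by (intro bdd_aboveI2)
qed

lemma dual_norm_ball: "\<phi> \<in> vecs (dual_space E) \<Longrightarrow> x \<in> unit_ball E \<Longrightarrow> norm (\<phi> x) \<le> vnorm (dual_space E) \<phi>"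
  using cSUP_upper[OF _ dual_bdd_above, of x \<phi>] by (simp add: dual_space_def)

lemma dual_norm_nonneg: "\<phi> \<in> vecs (dual_space E) \<Longrightarrow> 0 \<le> vnorm (dual_space E) \<phi>"
  using dual_norm_ball[of \<phi> 0] by simp

lemma dual_norm_le:
  assumes "\<phi> \<in> vecs (dual_space E)" "x \<in> vecs E"
  shows "norm (\<phi> x) \<le> vnorm (dual_space E) \<phi> * vnorm E x"
proof (cases "x = 0")
  case False
  then have pos: "vnorm E x > 0" using assms(2) norm_eq_0[of x] norm_nonneg[of x] by linarith
  let ?y = "smul E (of_real (1 / vnorm E x)) x"
  have "?y \<in> unit_ball E" using norm_normalize[OF assms(2) False] assms(2) by (simp add: unit_ball_def)
  from dual_norm_ball[OF assms(1) this] have "norm (\<phi> x) / vnorm E x \<le> vnorm (dual_space E) \<phi>"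
    using pos by (simp add: dual_smul[OF assms] norm_mult norm_divide)
  with pos show ?thesis by (simp add: field_simps)
qed (use assms in auto)

lemma dual_norm_leI:
  assumes "\<And>x. x \<in> unit_ball E \<Longrightarrow> norm (\<phi> x) \<le> C"
  shows "vnorm (dual_space E) \<phi> \<le> C"
  unfolding dual_space_def using assms by (auto intro!: cSUP_least intro: zero_mem_unit_ball)

lemma dual_unit_ballI:
  assumes "\<And>x. x \<notin> vecs E \<Longrightarrow> \<phi> x = 0"
    and "\<And>x y. x \<in> vecs E \<Longrightarrow> y \<in> vecs E \<Longrightarrow> \<phi> (x + y) = \<phi> x + \<phi> y"
    and "\<And>x c. x \<in> vecs E \<Longrightarrow> \<phi> (smul E c x) = c * \<phi> x"
    and "\<And>x. x \<in> vecs E \<Longrightarrow> norm (\<phi> x) \<le> vnorm E x"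
  shows "\<phi> \<in> unit_ball (dual_space E)"
proof -
  have "\<phi> \<in> vecs (dual_space E)" using assms by (intro dual_memI[where C=1]) auto
  moreover have "vnorm (dual_space E) \<phi> \<le> 1"
    using assms(4) by (intro dual_norm_leI) (force simp: unit_ball_def)
  ultimately show ?thesis by (simp add: unit_ball_def)
qed

lemma normed_dual: "is_normed_space (dual_space E)"
proof -
  let ?D = "dual_space E"
  have s: "smul ?D = (\<lambda>c \<phi> x. c * \<phi> x)" by (simp add: dual_space_def)
  have vs: "vector_space (smul ?D)"
    by standard (auto simp: s fun_eq_iff algebra_simps)
  interpret D: vector_space "smul ?D" by (rule vs)
  have add: "\<phi> + \<psi> \<in> vecs ?D" "vnorm ?D (\<phi> + \<psi>) \<le> vnorm ?D \<phi> + vnorm ?D \<psi>"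
    if p: "\<phi> \<in> vecs ?D" "\<psi> \<in> vecs ?D" for \<phi> \<psi>
  proof -
    show "\<phi> + \<psi> \<in> vecs ?D"
    proof (rule dual_memI[where C = "vnorm ?D \<phi> + vnorm ?D \<psi>"])
      fix x assume "x \<in> vecs E"
      then show "norm ((\<phi> + \<psi>) x) \<le> (vnorm ?D \<phi> + vnorm ?D \<psi>) * vnorm E x"
        using dual_norm_le[OF p(1), of x] dual_norm_le[OF p(2), of x] norm_triangle_ineq[of "\<phi> x" "\<psi> x"]
        by (simp add: distrib_right)
    qed (auto simp: dual_memD[OF p(1)] dual_memD[OF p(2)] algebra_simps)
    show "vnorm ?D (\<phi> + \<psi>) \<le> vnorm ?D \<phi> + vnorm ?D \<psi>"
    proof (rule dual_norm_leI)
      fix x assume "x \<in> unit_ball E"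
      then show "norm ((\<phi> + \<psi>) x) \<le> vnorm ?D \<phi> + vnorm ?D \<psi>"
        using dual_norm_ball[OF p(1), of x] dual_norm_ball[OF p(2), of x] norm_triangle_ineq[of "\<phi> x" "\<psi> x"]
        by simp
    qed
  qed
  have sc: "smul ?D c \<phi> \<in> vecs ?D" if p: "\<phi> \<in> vecs ?D" for \<phi> c
    using dual_norm_le[OF p]
    by (intro dual_memI[where C = "norm c * vnorm ?D \<phi>"])
       (auto simp: s dual_memD[OF p] norm_mult algebra_simps intro!: mult_left_mono)
  have le: "vnorm ?D (smul ?D c \<phi>) \<le> norm c * vnorm ?D \<phi>" if p: "\<phi> \<in> vecs ?D" for \<phi> c
    by (rule dual_norm_leI) (auto simp: s norm_mult intro!: mult_left_mono dual_norm_ball[OF p])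
  have eq: "vnorm ?D (smul ?D c \<phi>) = norm c * vnorm ?D \<phi>" if p: "\<phi> \<in> vecs ?D" for \<phi> c
  proof (cases "c = 0")
    case True
    then show ?thesis using le[OF p, of c] dual_norm_nonneg[OF sc[OF p, of c]] by simp
  next
    case False
    then have "smul ?D (inverse c) (smul ?D c \<phi>) = \<phi>" by (simp add: s fun_eq_iff mult.assoc[symmetric])
    then have "vnorm ?D \<phi> \<le> norm (inverse c) * vnorm ?D (smul ?D c \<phi>)"
      using le[OF sc[OF p, of c], of "inverse c"] by simp
    with False have "norm c * vnorm ?D \<phi> \<le> vnorm ?D (smul ?D c \<phi>)"
      by (simp add: norm_inverse norm_divide field_simps)
    with le[OF p, of c] show ?thesis by simp
  qed
  have "D.subspace (vecs ?D)"
  proof (rule D.subspaceI)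
    show "0 \<in> vecs ?D" by (rule dual_memI[where C = 0]) auto
  qed (auto intro: add sc)
  moreover have "vnorm ?D \<phi> = 0 \<longleftrightarrow> \<phi> = 0" if p: "\<phi> \<in> vecs ?D" for \<phi>
  proof
    assume "vnorm ?D \<phi> = 0"
    then have "\<phi> x = 0" for x
      using dual_norm_le[OF p, of x] dual_outside[OF p, of x] by (cases "x \<in> vecs E") auto
    then show "\<phi> = 0" by auto
  next
    assume "\<phi> = 0"
    then show "vnorm ?D \<phi> = 0"
      using dual_norm_leI[of \<phi> 0] dual_norm_nonneg[OF p] by auto
  qed
  ultimately show ?thesis
    unfolding is_normed_space_def using vs add eq dual_norm_nonneg by blast
qed

end

lemma normed_sp_dual: "normed_sp E \<Longrightarrow> normed_sp (dual_space E)"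
  by (simp add: normed_sp_def normed_sp.normed_dual)

lemma smul_dual_space [simp]: "smul (dual_space E) = (\<lambda>c \<phi> x. c * \<phi> x)"
  by (simp add: dual_space_def)

section \<open>The Hahn--Banach theorem\<close>

context normed_sp
begin

text \<open>Values off \<open>vecs E\<close> are fixed so that functionals agreeing on the space are
  equal as functions; minimality in the pointwise order then yields a genuine equation.\<close>

definition sublinear :: "('v \<Rightarrow> real) \<Rightarrow> bool" where
  "sublinear q \<longleftrightarrow> (\<forall>x. x \<notin> vecs E \<longrightarrow> q x = 0) \<and>
     (\<forall>x\<in>vecs E. \<forall>y\<in>vecs E. q (x + y) \<le> q x + q y) \<and>
     (\<forall>t>0. \<forall>x\<in>vecs E. q (smul E (of_real t) x) = t * q x) \<and>
     (\<forall>x\<in>vecs E. q x \<le> vnorm E x)"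

text \<open>From 0 = q 0 \<le> q x + q (- x). Bounds of this kind keep the infima over parameters
  and over chains finite.\<close>

lemma sublinear_lower:
  assumes "sublinear q" "x \<in> vecs E"
  shows "- vnorm E x \<le> q x"
proof -
  have "q (smul E (of_real 2) 0) = 2 * q 0"
    using assms(1) unfolding sublinear_def by (metis zero_less_numeral zero_mem)
  then have "q 0 = 0" by simp
  moreover have "q (x + - x) \<le> q x + q (- x)" "q (- x) \<le> vnorm E (- x)"
    using assms unfolding sublinear_def by (metis minus_mem)+
  ultimately show ?thesis using norm_minus[OF assms(2)] by simp
qed

text \<open>A sublinear functional below \<open>q\<close> (take t = 0) whose value at - y is at most
  - q y (take t = 1). A minimal \<open>q\<close> must therefore equal every
  \<open>shifted q y\<close>, which forces additivity.\<close>

definition shifted :: "('v \<Rightarrow> real) \<Rightarrow> 'v \<Rightarrow> 'v \<Rightarrow> real" where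
  "shifted q y x = (if x \<in> vecs E then INF t\<in>{0..}. q (x + smul E (of_real t) y) - t * q y else 0)"

lemma shifted_le:
  assumes q: "sublinear q" and y: "y \<in> vecs E" and x: "x \<in> vecs E" and "0 \<le> t"
  shows "shifted q y x \<le> q (x + smul E (of_real t) y) - t * q y"
proof -
  have "- vnorm E x \<le> q (x + smul E (of_real t) y) - t * q y" if "0 \<le> t" for t
  proof (cases "t = 0")
    case True
    then show ?thesis using sublinear_lower[OF q x] by simp
  next
    case False
    with that have "t > 0" by simp
    then have "t * q y = q (smul E (of_real t) y)" using q y by (simp add: sublinear_def)
    also have "\<dots> = q ((x + smul E (of_real t) y) + - x)" by simp
    also have "\<dots> \<le> q (x + smul E (of_real t) y) + q (- x)"
      using q x y unfolding sublinear_def by (metis minus_mem add_mem smul_mem)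
    also have "q (- x) \<le> vnorm E x"
      using q x norm_minus[OF x] unfolding sublinear_def by (metis minus_mem)
    finally show ?thesis by simp
  qed
  then have "bdd_below ((\<lambda>t. q (x + smul E (of_real t) y) - t * q y) ` {0..})"
    by (intro bdd_belowI2) auto
  with assms(4) x show ?thesis
    unfolding shifted_def by (auto intro!: cINF_lower)
qed

lemma le_shifted:
  assumes "x \<in> vecs E" "\<And>t. 0 \<le> t \<Longrightarrow> c \<le> q (x + smul E (of_real t) y) - t * q y"
  shows "c \<le> shifted q y x"
  using assms unfolding shifted_def by (auto intro!: cINF_greatest)

text \<open>Parameters t and t' chosen for two summands combine into t + t' for their sum, and
  scaling by s turns t into s * t.\<close>

lemma sublinear_shifted:
  assumes q: "sublinear q" and y: "y \<in> vecs E"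
  shows "sublinear (shifted q y)"
  unfolding sublinear_def
proof (intro conjI allI impI ballI)
  fix x x' assume x: "x \<in> vecs E" "x' \<in> vecs E"
  have "shifted q y (x + x') - shifted q y x' \<le> shifted q y x"
  proof (rule le_shifted[OF x(1)])
    fix t :: real assume t: "0 \<le> t"
    have "shifted q y (x + x') - (q (x + smul E (of_real t) y) - t * q y) \<le> shifted q y x'"
    proof (rule le_shifted[OF x(2)])
      fix t' :: real assume t': "0 \<le> t'"
      have "shifted q y (x + x') \<le> q ((x + x') + smul E (of_real (t + t')) y) - (t + t') * q y"
        using t t' x by (intro shifted_le q y) auto
      also have "(x + x') + smul E (of_real (t + t')) y
          = (x + smul E (of_real t) y) + (x' + smul E (of_real t') y)"
        by (simp add: V.scale_left_distrib)
      also have "q \<dots> \<le> q (x + smul E (of_real t) y) + q (x' + smul E (of_real t') y)"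
        using q x y by (simp add: sublinear_def)
      finally show "shifted q y (x + x') - (q (x + smul E (of_real t) y) - t * q y)
          \<le> q (x' + smul E (of_real t') y) - t' * q y"
        by (simp add: algebra_simps)
    qed
    then show "shifted q y (x + x') - shifted q y x' \<le> q (x + smul E (of_real t) y) - t * q y"
      by simp
  qed
  then show "shifted q y (x + x') \<le> shifted q y x + shifted q y x'" by simp
next
  have le: "shifted q y (smul E (of_real s) x) \<le> s * shifted q y x" if s: "s > 0" and x: "x \<in> vecs E" for s x
  proof -
    have "shifted q y (smul E (of_real s) x) / s \<le> shifted q y x"
    proof (rule le_shifted[OF x])
      fix t :: real assume t: "0 \<le> t"
      have "shifted q y (smul E (of_real s) x)
          \<le> q (smul E (of_real s) x + smul E (of_real (s * t)) y) - (s * t) * q y"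
        using s t x by (intro shifted_le q y) auto
      also have "smul E (of_real s) x + smul E (of_real (s * t)) y = smul E (of_real s) (x + smul E (of_real t) y)"
        by (simp add: V.scale_right_distrib)
      also have "q \<dots> = s * q (x + smul E (of_real t) y)"
        using q s x y by (simp add: sublinear_def)
      finally show "shifted q y (smul E (of_real s) x) / s \<le> q (x + smul E (of_real t) y) - t * q y"
        using s by (simp add: field_simps)
    qed
    then show ?thesis using s by (simp add: field_simps)
  qed
  fix s :: real and x assume s: "s > 0" and x: "x \<in> vecs E"
  have "smul E (of_real (1 / s)) (smul E (of_real s) x) = x"
    using s by (simp flip: of_real_mult)
  then have "shifted q y x \<le> 1 / s * shifted q y (smul E (of_real s) x)"
    using le[of "1 / s" "smul E (of_real s) x"] s x by simp
  then have "s * shifted q y x \<le> shifted q y (smul E (of_real s) x)"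
    using s by (simp add: field_simps)
  with le[OF s x] show "shifted q y (smul E (of_real s) x) = s * shifted q y x" by simp
next
  fix x assume x: "x \<in> vecs E"
  have "shifted q y x \<le> q x" using shifted_le[OF q y x, of 0] by simp
  also have "\<dots> \<le> vnorm E x" using q x by (simp add: sublinear_def)
  finally show "shifted q y x \<le> vnorm E x" .
qed (simp add: shifted_def)

text \<open>Of two members of the chain the smaller one bounds both summands at once; this is where
  the chain condition enters subadditivity.\<close>

lemma sublinear_chain_Inf:
  assumes C: "C \<noteq> {}" "\<And>q. q \<in> C \<Longrightarrow> sublinear q"
    and chain: "\<And>q q'. q \<in> C \<Longrightarrow> q' \<in> C \<Longrightarrow> q \<le> q' \<or> q' \<le> q"
  shows "sublinear (\<lambda>x. INF q\<in>C. q x)" and "\<And>q x. q \<in> C \<Longrightarrow> (INF q\<in>C. q x) \<le> q x"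
proof -
  let ?u = "\<lambda>x. INF q\<in>C. q x"
  show le: "?u x \<le> q x" if "q \<in> C" for q x
  proof -
    have "bdd_below ((\<lambda>q. q x) ` C)"
    proof (cases "x \<in> vecs E")
      case True
      then show ?thesis using C(2) sublinear_lower by (intro bdd_belowI2[where m = "- vnorm E x"]) auto
    next
      case False
      show ?thesis
      proof (rule bdd_belowI2[where m = 0])
        fix q assume "q \<in> C"
        then show "0 \<le> q x" using C(2)[of q] False by (simp add: sublinear_def)
      qed
    qed
    then show ?thesis using that by (rule cINF_lower)
  qed
  show "sublinear ?u"
    unfolding sublinear_def
  proof (intro conjI allI impI ballI)
    fix x assume "x \<notin> vecs E"
    then have "(\<lambda>q. q x) ` C = {0}" using C unfolding sublinear_def by force
    then show "?u x = 0" by simp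
  next
    fix x y assume xy: "x \<in> vecs E" "y \<in> vecs E"
    have "?u (x + y) - ?u y \<le> ?u x"
    proof (rule cINF_greatest[OF C(1)])
      fix q assume q: "q \<in> C"
      have "?u (x + y) - q x \<le> ?u y"
      proof (rule cINF_greatest[OF C(1)])
        fix q' assume q': "q' \<in> C"
        obtain p where p: "p \<in> C" "p \<le> q" "p \<le> q'"
          using chain[OF q q'] q q' by blast
        have "?u (x + y) \<le> p (x + y)" by (rule le[OF p(1)])
        also have "\<dots> \<le> p x + p y" using C(2)[OF p(1)] xy by (simp add: sublinear_def)
        also have "\<dots> \<le> q x + q' y" using p(2,3) by (simp add: le_fun_def add_mono)
        finally show "?u (x + y) - q x \<le> q' y" by simp
      qed
      then show "?u (x + y) - ?u y \<le> q x" by simp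
    qed
    then show "?u (x + y) \<le> ?u x + ?u y" by simp
  next
    fix t :: real and x assume t: "t > 0" and x: "x \<in> vecs E"
    have hom: "q (smul E (of_real t) x) = t * q x" if "q \<in> C" for q
      using C(2)[OF that] t x by (simp add: sublinear_def)
    show "?u (smul E (of_real t) x) = t * ?u x"
    proof (rule antisym)
      have "?u (smul E (of_real t) x) / t \<le> ?u x"
      proof (rule cINF_greatest[OF C(1)])
        fix q assume "q \<in> C"
        then show "?u (smul E (of_real t) x) / t \<le> q x"
          using le[of q "smul E (of_real t) x"] hom t by (simp add: field_simps)
      qed
      then show "?u (smul E (of_real t) x) \<le> t * ?u x" using t by (simp add: field_simps)
      show "t * ?u x \<le> ?u (smul E (of_real t) x)"
      proof (rule cINF_greatest[OF C(1)])
        fix q assume "q \<in> C"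
        then show "t * ?u x \<le> q (smul E (of_real t) x)"
          using le[of q x] hom[of q] t by simp
      qed
    qed
  next
    fix x assume x: "x \<in> vecs E"
    obtain q where q: "q \<in> C" using C(1) by blast
    have "?u x \<le> q x" by (rule le[OF q])
    also have "\<dots> \<le> vnorm E x" using C(2)[OF q] x by (simp add: sublinear_def)
    finally show "?u x \<le> vnorm E x" .
  qed
qed

lemma minimal_sublinear:
  assumes "sublinear p"
  obtains m where "sublinear m" "m \<le> p" "\<And>q. sublinear q \<Longrightarrow> q \<le> m \<Longrightarrow> q = m"
proof -
  define A where "A = {q. sublinear q \<and> q \<le> p}"
  \<comment> \<open>The order is reversed because Zorn's lemma produces maximal elements.\<close>
  define below where "below = (\<lambda>a b :: 'v \<Rightarrow> real. b \<le> a)"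
  have "\<exists>m\<in>A. \<forall>a\<in>A. below m a \<longrightarrow> a = m"
  proof (rule predicate_Zorn)
    show "partial_order_on A (relation_of below A)"
      by (rule partial_order_on_relation_ofI) (auto simp: below_def)
    fix C assume C: "C \<in> Chains (relation_of below A)"
    then have CA: "\<And>q. q \<in> C \<Longrightarrow> q \<in> A" and ch: "\<And>q q'. q \<in> C \<Longrightarrow> q' \<in> C \<Longrightarrow> q \<le> q' \<or> q' \<le> q"
      unfolding Chains_def relation_of_def below_def by blast+
    show "\<exists>u\<in>A. \<forall>a\<in>C. below a u"
    proof (cases "C = {}")
      case True
      then show ?thesis using assms by (intro bexI[of _ p]) (auto simp: A_def)
    next
      case False
      note u = sublinear_chain_Inf[OF False _ ch]
      have C': "\<And>q. q \<in> C \<Longrightarrow> sublinear q" using CA by (simp add: A_def)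
      obtain q0 where "q0 \<in> C" using False by blast
      then have "(\<lambda>x. INF q\<in>C. q x) \<le> q0" using u(2) C' by (simp add: le_fun_def)
      also have "q0 \<le> p" using CA[OF \<open>q0 \<in> C\<close>] by (simp add: A_def)
      finally have "(\<lambda>x. INF q\<in>C. q x) \<in> A" using u(1) C' by (simp add: A_def)
      then show ?thesis using u(2) C' by (intro bexI) (auto simp: below_def le_fun_def)
    qed
  qed
  then obtain m where "m \<in> A" "\<And>a. a \<in> A \<Longrightarrow> a \<le> m \<Longrightarrow> a = m" unfolding below_def by blast
  then show ?thesis using that[of m] by (auto simp: A_def intro: order_trans)
qed

text \<open>The minimal functional is sought below \<open>shifted N x0\<close> and not merely below
  the norm \<open>N\<close>: this makes its value at - x0 at most - \<parallel>x0\<parallel>, and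
  linearity turns that into attainment at x0.\<close>

lemma real_Hahn_Banach:
  assumes x0: "x0 \<in> vecs E"
  obtains q where "\<And>x y. x \<in> vecs E \<Longrightarrow> y \<in> vecs E \<Longrightarrow> q (x + y) = q x + q y"
    and "\<And>t x. x \<in> vecs E \<Longrightarrow> q (smul E (of_real t) x) = t * q x"
    and "\<And>x. x \<in> vecs E \<Longrightarrow> q x \<le> vnorm E x" and "q x0 = vnorm E x0"
proof -
  define N where "N x = (if x \<in> vecs E then vnorm E x else 0)" for x
  have N: "sublinear N"
    by (auto simp: sublinear_def N_def norm_add_le norm_smul)
  obtain m where m: "sublinear m" "m \<le> shifted N x0"
    and min: "\<And>q. sublinear q \<Longrightarrow> q \<le> m \<Longrightarrow> q = m"
    using minimal_sublinear[OF sublinear_shifted[OF N x0]] by metis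
  have eq: "shifted m y = m" if y: "y \<in> vecs E" for y
  proof (rule min[OF sublinear_shifted[OF m(1) y]], rule le_funI)
    fix x
    show "shifted m y x \<le> m x"
    proof (cases "x \<in> vecs E")
      case True
      then show ?thesis using shifted_le[OF m(1) y True, of 0] by simp
    next
      case False
      then show ?thesis using m(1) by (simp add: shifted_def sublinear_def)
    qed
  qed
  have add: "m (x + y) = m x + m y" if "x \<in> vecs E" "y \<in> vecs E" for x y
  proof (rule antisym)
    show "m (x + y) \<le> m x + m y" using m(1) that by (simp add: sublinear_def)
    have "m x \<le> m (x + y) - m y"
      using shifted_le[OF m(1) that(2,1), of 1] by (simp add: eq[OF that(2)])
    then show "m x + m y \<le> m (x + y)" by simp
  qed
  have pos: "m (smul E (of_real t) x) = t * m x" if "t > 0" "x \<in> vecs E" for t x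
    using m(1) that by (simp add: sublinear_def)
  have m0: "m 0 = 0" using add[of 0 0] by simp
  have neg: "m (- x) = - m x" if "x \<in> vecs E" for x
    using add[of x "- x"] that m0 by simp
  have hom: "m (smul E (of_real t) x) = t * m x" if x: "x \<in> vecs E" for t x
  proof (cases "t > 0")
    case False
    show ?thesis
    proof (cases "t = 0")
      case False
      with \<open>\<not> t > 0\<close> have "- t > 0" by simp
      from pos[OF this x] have "m (- smul E (of_real t) x) = - t * m x" by simp
      then show ?thesis using neg[of "smul E (of_real t) x"] x by simp
    qed (simp add: m0)
  qed (use pos x in simp)
  have le: "m x \<le> vnorm E x" if "x \<in> vecs E" for x
    using m(1) that by (simp add: sublinear_def)
  have "m (- x0) \<le> shifted N x0 (- x0)" using m(2) by (simp add: le_fun_def)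
  also have "\<dots> \<le> N (- x0 + smul E (of_real 1) x0) - 1 * N x0"
    using x0 by (intro shifted_le N) auto
  also have "\<dots> = - vnorm E x0" using x0 by (simp add: N_def)
  finally have "vnorm E x0 \<le> m x0" using neg[OF x0] by simp
  then have "m x0 = vnorm E x0" using le[OF x0] by simp
  with add hom le that show ?thesis by blast
qed

text \<open>In the complex case the functional is recovered from its real part as q x - j * q (j x),
  where \<open>j\<close> is the preimage of the imaginary unit.\<close>

lemma complexify:
  fixes q :: "'v \<Rightarrow> real"
  assumes add: "\<And>x y. x \<in> vecs E \<Longrightarrow> y \<in> vecs E \<Longrightarrow> q (x + y) = q x + q y"
    and hom: "\<And>t x. x \<in> vecs E \<Longrightarrow> q (smul E (of_real t) x) = t * q x"
  obtains \<phi> where "\<And>x. x \<notin> vecs E \<Longrightarrow> \<phi> x = 0"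
    and "\<And>x y. x \<in> vecs E \<Longrightarrow> y \<in> vecs E \<Longrightarrow> \<phi> (x + y) = \<phi> x + \<phi> y"
    and "\<And>x c. x \<in> vecs E \<Longrightarrow> \<phi> (smul E c x) = c * \<phi> x"
    and "\<And>x. x \<in> vecs E \<Longrightarrow> kre (\<phi> x) = q x"
proof -
  from range_kc[where 'k='k] show ?thesis
  proof
    assume r: "range (kc :: 'k \<Rightarrow> complex) = range of_real"
    have real: "c = of_real (kre c)" for c :: 'k
    proof -
      have "kc c \<in> range (of_real :: real \<Rightarrow> complex)" unfolding r[symmetric] by simp
      then obtain t where t: "kc c = complex_of_real t" by (rule rangeE)
      then have "c = of_real t" by (metis kc_inject kc_of_real)
      with t show ?thesis by simp
    qed
    let ?f = "\<lambda>x. if x \<in> vecs E then of_real (q x) else 0"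
    show ?thesis
    proof (rule that[of ?f])
      show "?f (smul E c x) = c * ?f x" if "x \<in> vecs E" for c x
      proof -
        obtain t where "c = of_real t" using real by blast
        then show ?thesis using that by (simp add: hom)
      qed
    qed (auto simp: add)
  next
    assume r: "range (kc :: 'k \<Rightarrow> complex) = UNIV"
    then have "\<i> \<in> range (kc :: 'k \<Rightarrow> complex)" by simp
    then obtain j :: 'k where j: "\<i> = kc j" by (rule rangeE)
    have "kc (j * j) = kc (of_real (- 1) :: 'k)"
      by (simp only: kc_mult j[symmetric] kc_of_real) simp
    then have jj: "j * j = - 1" by (simp only: kc_inject) simp
    have dec: "c = of_real (Re (kc c)) + j * of_real (Im (kc c))" for c :: 'k
      by (subst kc_inject[symmetric]) (simp add: kc_add kc_mult j[symmetric] complex_eq_iff)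
    let ?f = "\<lambda>x. if x \<in> vecs E then of_real (q x) - j * of_real (q (smul E j x)) else 0"
    show ?thesis
    proof (rule that[of ?f])
      fix x c assume x: "x \<in> vecs E"
      obtain a b where c: "c = of_real a + j * of_real b" using dec by blast
      have "smul E c x = smul E (of_real a) x + smul E (of_real b) (smul E j x)"
        by (simp add: c V.scale_left_distrib mult.commute)
      then have 1: "q (smul E c x) = a * q x + b * q (smul E j x)"
        using x by (simp only: add hom smul_mem)
      have "j * c = of_real a * j - of_real b"
        using jj by (simp add: c algebra_simps flip: mult.assoc)
      then have "smul E j (smul E c x) = smul E (of_real a) (smul E j x) + smul E (of_real (- b)) x"
        by (simp add: V.scale_left_diff_distrib)
      then have 2: "q (smul E j (smul E c x)) = a * q (smul E j x) - b * q x"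
        using x by (simp only: add hom smul_mem)
      have "of_real (q (smul E c x)) - j * of_real (q (smul E j (smul E c x)))
          = of_real a * of_real (q x) + of_real b * of_real (q (smul E j x))
          - j * (of_real a * of_real (q (smul E j x)) - of_real b * of_real (q x))"
        by (simp only: 1 2 of_real_add of_real_mult of_real_diff)
      \<comment> \<open>The defect from homogeneity is written as a multiple of 1 + j * j, which
        vanishes.\<close>
      also have "\<dots> = (of_real a + j * of_real b) * (of_real (q x) - j * of_real (q (smul E j x)))
          + (1 + j * j) * (of_real b * of_real (q (smul E j x)))"
        by (simp add: algebra_simps)
      finally show "?f (smul E c x) = c * ?f x"
        using x by (simp add: c jj)
    next
      fix x assume x: "x \<in> vecs E"
      have "kre (j * of_real t) = 0" for t
        by (simp add: kre_def kc_mult j[symmetric])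
      then show "kre (?f x) = q x" using x by (simp add: kre_diff)
    qed (auto simp: V.scale_right_distrib add algebra_simps)
  qed
qed

theorem norming_functional:
  assumes x0: "x0 \<in> vecs E"
  obtains \<phi> where "\<phi> \<in> unit_ball (dual_space E)" "\<phi> x0 = of_real (vnorm E x0)"
proof -
  obtain q where q: "\<And>x y. x \<in> vecs E \<Longrightarrow> y \<in> vecs E \<Longrightarrow> q (x + y) = q x + q y"
    "\<And>t x. x \<in> vecs E \<Longrightarrow> q (smul E (of_real t) x) = t * q x"
    and le: "\<And>x. x \<in> vecs E \<Longrightarrow> q x \<le> vnorm E x" and q0: "q x0 = vnorm E x0"
    using real_Hahn_Banach[OF x0] by metis
  obtain \<phi> where \<phi>: "\<And>x. x \<notin> vecs E \<Longrightarrow> \<phi> x = 0"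
    "\<And>x y. x \<in> vecs E \<Longrightarrow> y \<in> vecs E \<Longrightarrow> \<phi> (x + y) = \<phi> x + \<phi> y"
    "\<And>x c. x \<in> vecs E \<Longrightarrow> \<phi> (smul E c x) = c * \<phi> x"
    and re: "\<And>x. x \<in> vecs E \<Longrightarrow> kre (\<phi> x) = q x"
    using complexify[OF q] by metis
  have bd: "norm (\<phi> x) \<le> vnorm E x" if x: "x \<in> vecs E" for x
  proof -
    obtain c where c: "norm c = 1" "c * \<phi> x = of_real (norm (\<phi> x))" by (rule unimodular_rotation)
    then have "norm (\<phi> x) = kre (\<phi> (smul E c x))" using x by (simp add: \<phi>(3))
    also have "\<dots> \<le> vnorm E (smul E c x)" using x by (simp add: re le)
    finally show ?thesis using x c by (simp add: norm_smul)
  qed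
  \<comment> \<open>The real part of the value at \<open>x0\<close> is already the full norm, so no
    room is left for an imaginary part.\<close>
  have "norm (kc (\<phi> x0)) \<le> Re (kc (\<phi> x0))"
    using bd[OF x0] re[OF x0] q0 by (simp add: kre_def)
  then have "kc (\<phi> x0) = of_real (Re (kc (\<phi> x0)))"
  proof -
    have "(norm (kc (\<phi> x0)))\<^sup>2 \<le> (Re (kc (\<phi> x0)))\<^sup>2"
      using \<open>norm (kc (\<phi> x0)) \<le> Re (kc (\<phi> x0))\<close> by (intro power_mono) auto
    then have "Im (kc (\<phi> x0)) = 0" unfolding cmod_power2 by simp
    then show ?thesis by (simp add: complex_eq_iff)
  qed
  then have "kc (\<phi> x0) = kc (of_real (vnorm E x0) :: 'k)"
    using re[OF x0] q0 by (simp add: kre_def)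
  then have "\<phi> x0 = of_real (vnorm E x0)" by (simp only: kc_inject)
  moreover have "\<phi> \<in> unit_ball (dual_space E)" using \<phi> bd by (rule dual_unit_ballI)
  ultimately show ?thesis using that by blast
qed

end

section \<open>Weak-star density\<close>

lemma cmod_diff_scaled_square:
  "(cmod (r - complex_of_real t * a))\<^sup>2 = (cmod r)\<^sup>2 - 2 * t * Re (cnj r * a) + t\<^sup>2 * (cmod a)\<^sup>2"
  unfolding cmod_power2 by (simp add: power2_eq_square algebra_simps)

context normed_sp
begin

text \<open>Minimize the squared distance between the values of finitely many functionals on a ball and
  those of \<open>z\<close>.  The first-order condition at a near-minimizer produces a functional on which \<open>z\<close>
  would exceed its norm, unless the minimum is 0.\<close>

theorem Goldstine:
  assumes "r > 0" and z: "z \<in> vecs (bidual_space E)" and zr: "vnorm (bidual_space E) z \<le> r"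
    and fin: "finite \<Phi>" and \<Phi>: "\<Phi> \<subseteq> vecs (dual_space E)" and "\<epsilon> > 0"
  shows "\<exists>x\<in>vecs E. vnorm E x \<le> r \<and> (\<forall>\<phi>\<in>\<Phi>. norm (\<phi> x - z \<phi>) < \<epsilon>)"
proof (rule ccontr)
  assume contra: "\<not> ?thesis"
  interpret D: normed_sp "dual_space E" by (rule normed_sp.intro) (rule normed_dual)
  have d: "\<phi> \<in> vecs (dual_space E)" if "\<phi> \<in> \<Phi>" for \<phi> using \<Phi> that by blast
  define B where "B = {x \<in> vecs E. vnorm E x \<le> r}"
  define \<Delta> where "\<Delta> x = (\<Sum>\<phi>\<in>\<Phi>. (norm (z \<phi> - \<phi> x))\<^sup>2)" for x
  \<comment> \<open>Bounds the second-order term, because any two points of the ball differ by at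
    most 2 * r; the summand 1 permits division by \<open>M\<close>.\<close>
  define M where "M = (\<Sum>\<phi>\<in>\<Phi>. (vnorm (dual_space E) \<phi> * (2 * r))\<^sup>2) + 1"
  define e where "e = \<epsilon>\<^sup>2"
  have "M \<ge> 1" unfolding M_def by (simp add: sum_nonneg)
  have "e > 0" using \<open>\<epsilon> > 0\<close> by (simp add: e_def)
  have far: "e \<le> \<Delta> x" if "x \<in> B" for x
  proof -
    have "\<not> (\<forall>\<phi>\<in>\<Phi>. norm (\<phi> x - z \<phi>) < \<epsilon>)"
      using contra that unfolding B_def by blast
    then obtain \<phi> where \<phi>: "\<phi> \<in> \<Phi>" "\<epsilon> \<le> norm (\<phi> x - z \<phi>)"
      by (auto simp: not_less)
    then have "e \<le> (norm (z \<phi> - \<phi> x))\<^sup>2"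
      unfolding e_def using \<open>\<epsilon> > 0\<close> by (simp add: norm_minus_commute power_mono)
    also have "\<dots> \<le> \<Delta> x"
      unfolding \<Delta>_def using fin \<phi>(1) by (intro member_le_sum) auto
    finally show ?thesis .
  qed
  have "0 \<in> B" using \<open>r > 0\<close> by (simp add: B_def)
  \<comment> \<open>With this step length the second-order term, divided by t, is at most e / 2. The
    slack t * e / 2 granted to the near-minimizer contributes another e / 2, so the first-order gain
    2 * (kre (\<psi> x) - kre (\<psi> x0)) is below e.\<close>
  define t where "t = min 1 (e / (2 * M))"
  have t: "t > 0" "t \<le> 1" "t * M \<le> e / 2"
    using \<open>e > 0\<close> \<open>M \<ge> 1\<close> by (auto simp: t_def min_def field_simps)
  have "\<exists>x0\<in>B. \<forall>x\<in>B. \<Delta> x0 < \<Delta> x + t * e / 2"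
  proof -
    have bdd: "bdd_below (\<Delta> ` B)" by (rule bdd_belowI2[where m = e]) (rule far)
    have "(INF x\<in>B. \<Delta> x) < (INF x\<in>B. \<Delta> x) + t * e / 2" using t \<open>e > 0\<close> by simp
    then obtain x0 where "x0 \<in> B" "\<Delta> x0 < (INF x\<in>B. \<Delta> x) + t * e / 2"
      using cINF_less_iff[OF _ bdd, of "(INF x\<in>B. \<Delta> x) + t * e / 2"] \<open>0 \<in> B\<close> by blast
    then show ?thesis using cINF_lower[OF bdd] by (intro bexI[of _ x0]) fastforce+
  qed
  then obtain x0 where x0: "x0 \<in> B" and min: "\<And>x. x \<in> B \<Longrightarrow> \<Delta> x0 < \<Delta> x + t * e / 2" by blast
  have x0E: "x0 \<in> vecs E" using x0 by (simp add: B_def)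
  have "\<forall>\<phi>. \<exists>y :: 'k. kc y = cnj (kc (z \<phi> - \<phi> x0))" by (intro allI kc_cnj_ex)
  from choice[OF this] obtain w :: "('v \<Rightarrow> 'k) \<Rightarrow> 'k"
    where w: "\<And>\<phi>. kc (w \<phi>) = cnj (kc (z \<phi> - \<phi> x0))" by blast
  \<comment> \<open>Up to a factor this is the derivative of the squared distance at
    \<open>x0\<close>: the weights are conjugated residuals, so Re \<psi> gives the first-order
    term, and between \<open>z\<close> and \<open>x0\<close> it returns the sum of the squared
    residuals.\<close>
  define \<psi> where "\<psi> = (\<Sum>\<phi>\<in>\<Phi>. smul (dual_space E) (w \<phi>) \<phi>)"
  have \<psi>: "\<psi> \<in> vecs (dual_space E)"
    unfolding \<psi>_def by (intro D.sum_mem D.smul_mem d)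
  have sum_apply: "sum f A x = (\<Sum>a\<in>A. f a x)" for f :: "'c \<Rightarrow> 'v \<Rightarrow> 'k" and A x
    by (induction A rule: infinite_finite_induct) auto
  have \<psi>_apply: "\<psi> x = (\<Sum>\<phi>\<in>\<Phi>. w \<phi> * \<phi> x)" for x
    by (simp add: \<psi>_def sum_apply)
  interpret DD: normed_sp "bidual_space E" by (rule normed_sp.intro) (rule D.normed_dual)
  have z\<psi>: "z \<psi> = (\<Sum>\<phi>\<in>\<Phi>. w \<phi> * z \<phi>)"
  proof -
    have "z \<psi> = (\<Sum>\<phi>\<in>\<Phi>. z (smul (dual_space E) (w \<phi>) \<phi>))"
      unfolding \<psi>_def by (intro D.dual_sum z D.smul_mem d)
    also have "\<dots> = (\<Sum>\<phi>\<in>\<Phi>. w \<phi> * z \<phi>)"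
      by (intro sum.cong refl D.dual_smul z d)
    finally show ?thesis .
  qed
  have upper: "kre (\<psi> x) \<le> kre (\<psi> x0) + e / 2" if x: "x \<in> B" for x
  proof -
    have xE: "x \<in> vecs E" using x by (simp add: B_def)
    define y where "y = x0 + smul E (of_real t) (x - x0)"
    have yE: "y \<in> vecs E" using xE x0E by (simp add: y_def)
    have "y = smul E (of_real (1 - t)) x0 + smul E (of_real t) x"
      by (simp add: y_def V.scale_right_diff_distrib V.scale_left_diff_distrib)
    then have "vnorm E y \<le> vnorm E (smul E (of_real (1 - t)) x0) + vnorm E (smul E (of_real t) x)"
      using norm_add_le[of "smul E (of_real (1 - t)) x0" "smul E (of_real t) x"] xE x0E by simp
    also have "\<dots> = \<bar>1 - t\<bar> * vnorm E x0 + \<bar>t\<bar> * vnorm E x"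
      using xE x0E by (simp only: norm_smul norm_of_real)
    also have "\<dots> = (1 - t) * vnorm E x0 + t * vnorm E x" using t by simp
    also have "\<dots> \<le> (1 - t) * r + t * r"
      using t x x0 by (intro add_mono mult_left_mono) (auto simp: B_def)
    finally have "y \<in> B" using yE by (simp add: B_def algebra_simps)
    have "\<Delta> y = (\<Sum>\<phi>\<in>\<Phi>. (norm (z \<phi> - \<phi> x0))\<^sup>2 - 2 * t * kre (w \<phi> * (\<phi> x - \<phi> x0))
          + t\<^sup>2 * (norm (\<phi> x - \<phi> x0))\<^sup>2)"
      unfolding \<Delta>_def
    proof (rule sum.cong[OF refl])
      fix \<phi> assume "\<phi> \<in> \<Phi>"
      note \<phi> = d[OF this]
      have eq: "z \<phi> - \<phi> y = (z \<phi> - \<phi> x0) - of_real t * (\<phi> x - \<phi> x0)"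
        using xE x0E by (simp add: y_def dual_add[OF \<phi>] dual_smul[OF \<phi>] dual_diff[OF \<phi>])
      have "norm (z \<phi> - \<phi> y) = cmod (kc (z \<phi> - \<phi> x0) - complex_of_real t * kc (\<phi> x - \<phi> x0))"
        unfolding eq norm_kc[symmetric, where x = "z \<phi> - \<phi> x0 - of_real t * (\<phi> x - \<phi> x0)"]
        by (simp only: kc_diff kc_mult kc_of_real)
      then show "(norm (z \<phi> - \<phi> y))\<^sup>2 = (norm (z \<phi> - \<phi> x0))\<^sup>2 - 2 * t * kre (w \<phi> * (\<phi> x - \<phi> x0))
          + t\<^sup>2 * (norm (\<phi> x - \<phi> x0))\<^sup>2"
        by (simp only: cmod_diff_scaled_square kre_def kc_mult w norm_kc)
    qed
    also have "\<dots> = \<Delta> x0 - 2 * t * (\<Sum>\<phi>\<in>\<Phi>. kre (w \<phi> * (\<phi> x - \<phi> x0)))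
        + t\<^sup>2 * (\<Sum>\<phi>\<in>\<Phi>. (norm (\<phi> x - \<phi> x0))\<^sup>2)"
      by (simp add: \<Delta>_def sum.distrib sum_subtractf sum_distrib_left)
    also have "(\<Sum>\<phi>\<in>\<Phi>. kre (w \<phi> * (\<phi> x - \<phi> x0))) = kre (\<psi> x) - kre (\<psi> x0)"
      by (simp add: \<psi>_apply kre_def kc_sum Re_sum algebra_simps kc_diff sum_subtractf)
    also have "t\<^sup>2 * (\<Sum>\<phi>\<in>\<Phi>. (norm (\<phi> x - \<phi> x0))\<^sup>2) \<le> t\<^sup>2 * M"
    proof -
      have "(\<Sum>\<phi>\<in>\<Phi>. (norm (\<phi> x - \<phi> x0))\<^sup>2) \<le> (\<Sum>\<phi>\<in>\<Phi>. (vnorm (dual_space E) \<phi> * (2 * r))\<^sup>2)"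
      proof (rule sum_mono)
        fix \<phi> assume "\<phi> \<in> \<Phi>"
        note \<phi> = d[OF this]
        have "norm (\<phi> x - \<phi> x0) \<le> vnorm (dual_space E) \<phi> * vnorm E (x - x0)"
          using dual_norm_le[OF \<phi>, of "x - x0"] xE x0E by (simp add: dual_diff[OF \<phi>])
        also have "\<dots> \<le> vnorm (dual_space E) \<phi> * (2 * r)"
          using norm_diff_le[OF xE x0E] x x0 by (intro mult_left_mono dual_norm_nonneg \<phi>) (auto simp: B_def)
        finally show "(norm (\<phi> x - \<phi> x0))\<^sup>2 \<le> (vnorm (dual_space E) \<phi> * (2 * r))\<^sup>2"
          by (intro power_mono) auto
      qed
      then show ?thesis by (intro mult_left_mono) (auto simp: M_def)
    qed
    finally have "\<Delta> y \<le> \<Delta> x0 - 2 * t * (kre (\<psi> x) - kre (\<psi> x0)) + t\<^sup>2 * M" by simp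
    with min[OF \<open>y \<in> B\<close>] have "t * (2 * (kre (\<psi> x) - kre (\<psi> x0))) < t * (t * M + e / 2)"
      by (simp add: algebra_simps power2_eq_square)
    then have "2 * (kre (\<psi> x) - kre (\<psi> x0)) < t * M + e / 2" using t by simp
    with t show ?thesis by simp
  qed
  define C where "C = kre (\<psi> x0) + e / 2"
  have "norm (\<psi> x) \<le> C / r" if x: "x \<in> unit_ball E" for x
  proof -
    have xE: "x \<in> vecs E" using x by (simp add: unit_ball_def)
    obtain c where c: "norm c = 1" "c * \<psi> x = of_real (norm (\<psi> x))" by (rule unimodular_rotation)
    have "smul E (of_real r * c) x \<in> B"
      using x \<open>r > 0\<close> xE c by (simp add: B_def norm_smul norm_mult unit_ball_def mult_left_le)
    then have "kre (\<psi> (smul E (of_real r * c) x)) \<le> C" using upper by (simp add: C_def)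
    moreover have "\<psi> (smul E (of_real r * c) x) = of_real (r * norm (\<psi> x))"
      using c by (simp add: dual_smul[OF \<psi> xE] mult.assoc)
    ultimately have "r * norm (\<psi> x) \<le> C" by (metis kre_of_real)
    then show ?thesis using \<open>r > 0\<close> by (simp add: field_simps)
  qed
  then have n\<psi>: "vnorm (dual_space E) \<psi> \<le> C / r" by (rule dual_norm_leI)
  have "kre (z \<psi>) \<le> norm (z \<psi>)" by (rule kre_le_norm)
  also have "\<dots> \<le> vnorm (bidual_space E) z * vnorm (dual_space E) \<psi>"
    by (rule D.dual_norm_le[OF z \<psi>])
  also have "\<dots> \<le> r * (C / r)"
    using zr n\<psi> \<open>r > 0\<close> by (intro mult_mono dual_norm_nonneg \<psi>) auto
  finally have "kre (z \<psi>) \<le> kre (\<psi> x0) + e / 2" using \<open>r > 0\<close> by (simp add: C_def)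
  \<comment> \<open>Here the bound e / 2 on the excess at \<open>z\<close> meets its true value
    \<Delta> x0, which is at least e.\<close>
  moreover have "kre (z \<psi>) - kre (\<psi> x0) = \<Delta> x0"
  proof -
    have "kre (w \<phi> * z \<phi>) - kre (w \<phi> * \<phi> x0) = (norm (z \<phi> - \<phi> x0))\<^sup>2" for \<phi>
    proof -
      have "kre (w \<phi> * z \<phi>) - kre (w \<phi> * \<phi> x0) = Re (cnj (kc (z \<phi> - \<phi> x0)) * kc (z \<phi> - \<phi> x0))"
        by (simp add: kre_def kc_mult w kc_diff algebra_simps)
      also have "\<dots> = (cmod (kc (z \<phi> - \<phi> x0)))\<^sup>2"
        unfolding cmod_power2 by (simp add: power2_eq_square)
      finally show ?thesis by simp
    qed
    then show ?thesis
      by (simp add: z\<psi> \<psi>_apply kre_def kc_sum Re_sum sum_subtractf[symmetric] \<Delta>_def)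
  qed
  ultimately show False using far[OF x0] \<open>e > 0\<close> by simp
qed

section \<open>The filter of weak-star approximation\<close>

lemma eventually_weak_star_mem: "eventually (\<lambda>x. x \<in> vecs E) (weak_star_to E z)"
  unfolding weak_star_to_def by (rule filter_leD[OF inf_le1]) (simp add: eventually_principal)

lemma tendsto_weak_star_to:
  assumes "\<phi> \<in> vecs (dual_space E)"
  shows "(\<phi> \<longlongrightarrow> z \<phi>) (weak_star_to E z)"
proof -
  have "weak_star_to E z \<le> filtercomap \<phi> (nhds (z \<phi>))"
    unfolding weak_star_to_def using assms by (intro le_infI2 INF_lower) auto
  then show ?thesis by (rule filterlim_iff_le_filtercomap[THEN iffD2])
qed

lemma eventually_weak_star_to:
  "eventually P (weak_star_to E z) \<longleftrightarrow>
     (\<exists>\<Phi> \<epsilon>. finite \<Phi> \<and> \<Phi> \<subseteq> vecs (dual_space E) \<and> \<epsilon> > 0 \<and>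
        (\<forall>x\<in>vecs E. (\<forall>\<phi>\<in>\<Phi>. norm (\<phi> x - z \<phi>) < \<epsilon>) \<longrightarrow> P x))"
    (is "?L \<longleftrightarrow> ?R")
proof
  assume ?L
  then obtain Q where "eventually Q (INF \<phi>\<in>vecs (dual_space E). filtercomap \<phi> (nhds (z \<phi>)))"
    and QP: "\<And>x. x \<in> vecs E \<Longrightarrow> Q x \<Longrightarrow> P x"
    unfolding weak_star_to_def eventually_inf eventually_principal by blast
  from eventually_INF[THEN iffD1, OF this(1)] obtain \<Phi> where \<Phi>: "\<Phi> \<subseteq> vecs (dual_space E)" "finite \<Phi>"
    and "eventually Q (INF \<phi>\<in>\<Phi>. filtercomap \<phi> (nhds (z \<phi>)))"
    by blast
  then obtain R where R: "\<forall>\<phi>\<in>\<Phi>. eventually (R \<phi>) (filtercomap \<phi> (nhds (z \<phi>)))"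
    and RQ: "\<And>x. (\<forall>\<phi>\<in>\<Phi>. R \<phi> x) \<Longrightarrow> Q x"
    unfolding eventually_INF_finite[OF \<Phi>(2)] by blast
  have "\<exists>e>0. \<forall>x. norm (\<phi> x - z \<phi>) < e \<longrightarrow> R \<phi> x" if "\<phi> \<in> \<Phi>" for \<phi>
    using R that unfolding eventually_filtercomap eventually_nhds_metric dist_norm by meson
  then obtain e where e: "\<And>\<phi>. \<phi> \<in> \<Phi> \<Longrightarrow> e \<phi> > 0 \<and> (\<forall>x. norm (\<phi> x - z \<phi>) < e \<phi> \<longrightarrow> R \<phi> x)"
    by metis
  define \<epsilon> where "\<epsilon> = Min (insert 1 (e ` \<Phi>))"
  have "\<epsilon> > 0" using \<Phi>(2) e by (simp add: \<epsilon>_def)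
  moreover have "\<epsilon> \<le> e \<phi>" if "\<phi> \<in> \<Phi>" for \<phi> using \<Phi>(2) that by (simp add: \<epsilon>_def)
  then have "P x" if "x \<in> vecs E" "\<forall>\<phi>\<in>\<Phi>. norm (\<phi> x - z \<phi>) < \<epsilon>" for x
    using QP[OF that(1)] RQ e that(2) by (meson less_le_trans)
  ultimately show ?R using \<Phi> by blast
next
  assume ?R
  then obtain \<Phi> \<epsilon> where \<Phi>: "finite \<Phi>" "\<Phi> \<subseteq> vecs (dual_space E)" "\<epsilon> > 0"
    and P: "\<forall>x\<in>vecs E. (\<forall>\<phi>\<in>\<Phi>. norm (\<phi> x - z \<phi>) < \<epsilon>) \<longrightarrow> P x" by blast
  have "eventually (\<lambda>x. norm (\<phi> x - z \<phi>) < \<epsilon>) (weak_star_to E z)" if "\<phi> \<in> \<Phi>" for \<phi>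
    using tendstoD[OF tendsto_weak_star_to \<Phi>(3), of \<phi> z] \<Phi>(2) that by (auto simp: dist_norm)
  then have "eventually (\<lambda>x. \<forall>\<phi>\<in>\<Phi>. norm (\<phi> x - z \<phi>) < \<epsilon>) (weak_star_to E z)"
    using \<Phi>(1) by (simp add: eventually_ball_finite)
  with eventually_weak_star_mem show ?L by eventually_elim (simp add: P)
qed

text \<open>\<open>weak_star_to\<close> ignores norms, while weak continuity speaks about bounded
  filters only. This is Goldstine's theorem in the form in which it is applied: the trace of the
  filter on the ball is proper.\<close>

lemma weak_star_to_ball_nontrivial:
  assumes "r > 0" "z \<in> vecs (bidual_space E)" "vnorm (bidual_space E) z \<le> r"
  shows "inf (weak_star_to E z) (principal {x \<in> vecs E. vnorm E x \<le> r}) \<noteq> bot"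
proof
  let ?S = "{x \<in> vecs E. vnorm E x \<le> r}"
  assume "inf (weak_star_to E z) (principal ?S) = bot"
  then have "eventually (\<lambda>x. False) (inf (weak_star_to E z) (principal ?S))" by simp
  then have "eventually (\<lambda>x. x \<in> ?S \<longrightarrow> False) (weak_star_to E z)"
    unfolding eventually_inf_principal .
  then obtain \<Phi> \<epsilon> where "finite \<Phi>" "\<Phi> \<subseteq> vecs (dual_space E)" "\<epsilon> > 0"
    and no: "\<forall>x\<in>vecs E. (\<forall>\<phi>\<in>\<Phi>. norm (\<phi> x - z \<phi>) < \<epsilon>) \<longrightarrow> x \<in> ?S \<longrightarrow> False"
    unfolding eventually_weak_star_to by (elim exE conjE)
  from Goldstine[OF assms this(1-3)] obtain x
    where "x \<in> vecs E" "vnorm E x \<le> r" "\<forall>\<phi>\<in>\<Phi>. norm (\<phi> x - z \<phi>) < \<epsilon>" by (elim bexE conjE)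
  with no show False by simp
qed

lemma weak_star_to_nontrivial:
  assumes "z \<in> vecs (bidual_space E)"
  shows "weak_star_to E z \<noteq> bot"
proof -
  have "0 < \<bar>vnorm (bidual_space E) z\<bar> + 1" "vnorm (bidual_space E) z \<le> \<bar>vnorm (bidual_space E) z\<bar> + 1"
    by linarith+
  from weak_star_to_ball_nontrivial[OF this(1) assms this(2)] show ?thesis by auto
qed

end

section \<open>Multilinear maps and polarization\<close>

locale normed_pair = E: normed_sp E + F: normed_sp F
  for E :: "('k::real_or_complex, 'e::ab_group_add) nspace"
    and F :: "('k, 'f::ab_group_add) nspace"
begin

section \<open>Calculus of multilinear maps on lists\<close>

lemma multilinear_mem:
  "multilinear_map n E F A \<Longrightarrow> length xs = n \<Longrightarrow> set xs \<subseteq> vecs E \<Longrightarrow> A xs \<in> vecs F"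
  by (simp add: multilinear_map_def)

lemma multilinear_add:
  assumes "multilinear_map n E F A" "Suc (length us + length vs) = n" "set us \<subseteq> vecs E"
    "set vs \<subseteq> vecs E" "x \<in> vecs E" "y \<in> vecs E"
  shows "A (us @ (x + y) # vs) = A (us @ x # vs) + A (us @ y # vs)"
proof -
  have "\<forall>i<n. \<forall>a\<in>vecs E. \<forall>b\<in>vecs E.
      A ((us @ x # vs)[i := a + b]) = A ((us @ x # vs)[i := a]) + A ((us @ x # vs)[i := b])"
    using assms unfolding multilinear_map_def by (auto simp del: list_update_append)
  from this[rule_format, of "length us" x y] show ?thesis
    using assms by simp
qed

lemma multilinear_smul:
  assumes "multilinear_map n E F A" "Suc (length us + length vs) = n" "set us \<subseteq> vecs E"
    "set vs \<subseteq> vecs E" "x \<in> vecs E"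
  shows "A (us @ smul E c x # vs) = smul F c (A (us @ x # vs))"
proof -
  have "\<forall>i<n. \<forall>c. \<forall>a\<in>vecs E.
      A ((us @ x # vs)[i := smul E c a]) = smul F c (A ((us @ x # vs)[i := a]))"
    using assms unfolding multilinear_map_def by (auto simp del: list_update_append)
  from this[rule_format, of "length us" x c] show ?thesis
    using assms by simp
qed

lemma multilinear_mapI:
  assumes "\<And>xs. length xs = n \<Longrightarrow> set xs \<subseteq> vecs E \<Longrightarrow> A xs \<in> vecs F"
    and "\<And>us vs x y. Suc (length us + length vs) = n \<Longrightarrow> set us \<subseteq> vecs E \<Longrightarrow> set vs \<subseteq> vecs E \<Longrightarrow>
      x \<in> vecs E \<Longrightarrow> y \<in> vecs E \<Longrightarrow> A (us @ (x + y) # vs) = A (us @ x # vs) + A (us @ y # vs)"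
    and "\<And>us vs x c. Suc (length us + length vs) = n \<Longrightarrow> set us \<subseteq> vecs E \<Longrightarrow> set vs \<subseteq> vecs E \<Longrightarrow>
      x \<in> vecs E \<Longrightarrow> A (us @ smul E c x # vs) = smul F c (A (us @ x # vs))"
  shows "multilinear_map n E F A"
  unfolding multilinear_map_def
proof (intro allI impI conjI ballI)
  fix xs :: "'e list" assume xs: "length xs = n \<and> set xs \<subseteq> vecs E"
  then show "A xs \<in> vecs F" using assms(1) by simp
  fix i assume i: "i < n"
  have sub: "set (take i xs) \<subseteq> vecs E" "set (drop (Suc i) xs) \<subseteq> vecs E"
    using xs set_take_subset[of i xs] set_drop_subset[of "Suc i" xs] by blast+
  have len: "Suc (length (take i xs) + length (drop (Suc i) xs)) = n" using xs i by simp
  have upd: "xs[i := a] = take i xs @ a # drop (Suc i) xs" for a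
    using xs i by (simp add: upd_conv_take_nth_drop)
  show "A (xs[i := x + y]) = A (xs[i := x]) + A (xs[i := y])" if "x \<in> vecs E" "y \<in> vecs E" for x y
    unfolding upd by (rule assms(2)[OF len sub that])
  show "A (xs[i := smul E c x]) = smul F c (A (xs[i := x]))" if "x \<in> vecs E" for c x
    unfolding upd by (rule assms(3)[OF len sub that])
qed

lemma multilinear_zero:
  assumes "multilinear_map n E F A" "Suc (length us + length vs) = n" "set us \<subseteq> vecs E"
    "set vs \<subseteq> vecs E"
  shows "A (us @ 0 # vs) = 0"
  using multilinear_smul[OF assms, of 0 0] by simp

lemma multilinear_diff:
  assumes "multilinear_map n E F A" "Suc (length us + length vs) = n" "set us \<subseteq> vecs E"
    "set vs \<subseteq> vecs E" "x \<in> vecs E" "y \<in> vecs E"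
  shows "A (us @ (x - y) # vs) = A (us @ x # vs) - A (us @ y # vs)"
  using multilinear_add[OF assms(1-4), of "x - y" y] assms by (simp add: algebra_simps)

lemma multilinear_sum:
  assumes A: "multilinear_map n E F A" "Suc (length us + length vs) = n" "set us \<subseteq> vecs E"
    "set vs \<subseteq> vecs E" and g: "\<And>i. i \<in> I \<Longrightarrow> g i \<in> vecs E"
  shows "A (us @ (\<Sum>i\<in>I. g i) # vs) = (\<Sum>i\<in>I. A (us @ g i # vs))"
  using g
proof (induction I rule: infinite_finite_induct)
  case (insert a I)
  then show ?case by (simp add: multilinear_add[OF A] E.sum_mem)
qed (simp_all add: multilinear_zero[OF A])

lemma sum_lists_Suc:
  fixes h :: "'i list \<Rightarrow> 'f"
  assumes "finite I"
  shows "(\<Sum>fs | set fs \<subseteq> I \<and> length fs = Suc m. h fs)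
    = (\<Sum>i\<in>I. \<Sum>fs | set fs \<subseteq> I \<and> length fs = m. h (i # fs))"
proof -
  let ?L = "{fs. set fs \<subseteq> I \<and> length fs = m}"
  have "(\<Sum>fs | set fs \<subseteq> I \<and> length fs = Suc m. h fs)
      = (\<Sum>p \<in> ?L \<times> I. h ((\<lambda>(fs, i). i # fs) p))"
    unfolding lists_length_Suc_eq by (subst sum.reindex) (auto simp: inj_on_def)
  also have "\<dots> = (\<Sum>fs\<in>?L. \<Sum>i\<in>I. h (i # fs))"
    by (simp add: sum.cartesian_product split_def)
  finally show ?thesis by (subst sum.swap)
qed

text \<open>The prefix \<open>us\<close> collects the terms already chosen, so that the induction
  expands one copy of the sum at a time.\<close>

lemma multilinear_expand:
  assumes A: "multilinear_map n E F A" and I: "finite I" and g: "\<And>i. i \<in> I \<Longrightarrow> g i \<in> vecs E"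
  shows "length us + m = n \<Longrightarrow> set us \<subseteq> vecs E \<Longrightarrow>
    A (us @ replicate m (\<Sum>i\<in>I. g i)) = (\<Sum>fs | set fs \<subseteq> I \<and> length fs = m. A (us @ map g fs))"
proof (induction m arbitrary: us)
  case 0
  have "{fs. set fs \<subseteq> I \<and> length fs = 0} = {[]}" by auto
  then show ?case by simp
next
  case (Suc m)
  have "A (us @ (\<Sum>i\<in>I. g i) # replicate m (\<Sum>i\<in>I. g i))
      = (\<Sum>i\<in>I. A (us @ g i # replicate m (\<Sum>i\<in>I. g i)))"
    using Suc.prems g by (intro multilinear_sum[OF A]) (auto intro!: E.sum_mem)
  also have "\<dots> = (\<Sum>i\<in>I. \<Sum>fs | set fs \<subseteq> I \<and> length fs = m. A (us @ map g (i # fs)))"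
  proof (rule sum.cong[OF refl])
    fix i assume "i \<in> I"
    then show "A (us @ g i # replicate m (\<Sum>i\<in>I. g i))
        = (\<Sum>fs | set fs \<subseteq> I \<and> length fs = m. A (us @ map g (i # fs)))"
      using Suc.IH[of "us @ [g i]"] Suc.prems g by simp
  qed
  also have "\<dots> = (\<Sum>fs | set fs \<subseteq> I \<and> length fs = Suc m. A (us @ map g fs))"
    by (rule sum_lists_Suc[OF I, symmetric])
  finally show ?case by simp
qed

lemma multilinear_replicate_smul:
  assumes A: "multilinear_map n E F A" and x: "x \<in> vecs E"
  shows "length us + m = n \<Longrightarrow> set us \<subseteq> vecs E \<Longrightarrow>
    A (us @ replicate m (smul E c x)) = smul F (c ^ m) (A (us @ replicate m x))"
proof (induction m arbitrary: us)
  case (Suc m)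
  have "A (us @ smul E c x # replicate m (smul E c x)) = smul F c (A (us @ x # replicate m (smul E c x)))"
    using Suc.prems x by (intro multilinear_smul[OF A]) auto
  then show ?case using Suc.IH[of "us @ [x]"] Suc.prems x by simp
qed simp

lemma sum_const_smul:
  assumes "finite S"
  shows "(\<Sum>a\<in>S. v) = smul F (of_nat (card S)) v"
  using assms by (induction S) (auto simp: F.V.scale_left_distrib add.commute)

text \<open>The alternating subset sum of the polarization formula: n! times the symmetric form of
  P, expressed by values of P alone.\<close>

definition polar :: "nat \<Rightarrow> ('e \<Rightarrow> 'f) \<Rightarrow> 'e list \<Rightarrow> 'f" where
  "polar n P xs = smul F ((- 1) ^ n) (\<Sum>T\<in>Pow {..<n}. smul F ((- 1) ^ card T) (P (\<Sum>i\<in>T. xs ! i)))"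

text \<open>Toggling an element outside R matches supersets of even and odd size, so everything
  cancels unless R leaves nothing outside.\<close>

lemma sum_sign_supersets:
  assumes "R \<subseteq> {..<n}"
  shows "(\<Sum>T | T \<in> Pow {..<n} \<and> R \<subseteq> T. (- 1 :: 'k) ^ card T) = (if R = {..<n} then (- 1) ^ n else 0)"
proof (cases "R = {..<n}")
  case True
  then have "{T. T \<in> Pow {..<n} \<and> R \<subseteq> T} = {{..<n}}" by auto
  then show ?thesis using True by simp
next
  case False
  then have "card {T. T \<subseteq> {..<n} \<and> R \<subseteq> T \<and> even (card T)} = card {T. T \<subseteq> {..<n} \<and> R \<subseteq> T \<and> odd (card T)}"
    using assms by (intro card_subsupersets_even_odd) auto
  moreover have "finite {T. T \<in> Pow {..<n} \<and> R \<subseteq> T}" by simp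
  ultimately show ?thesis
    using False by (subst sum_alternating_cancels) (auto simp: conj_assoc)
qed

text \<open>After expansion and interchange of sums, an index list \<open>fs\<close> collects the
  signs of all T containing its entries. By \<open>sum_sign_supersets\<close> only lists hitting
  every index survive, and those of length n are the permutations.\<close>

lemma polarization:
  assumes A: "multilinear_map n E F A" and P: "\<And>x. x \<in> vecs E \<Longrightarrow> P x = A (replicate n x)"
    and xs: "length xs = n" "set xs \<subseteq> vecs E"
  shows "polar n P xs = (\<Sum>fs\<in>permutations_of_set {..<n}. A (map ((!) xs) fs))"
proof -
  let ?L = "{fs :: nat list. set fs \<subseteq> {..<n} \<and> length fs = n}"
  have finL: "finite ?L" by (rule finite_lists_length_eq) simp
  have mem: "xs ! i \<in> vecs E" if "i < n" for i using xs that nth_mem by blast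
  have "(\<Sum>T\<in>Pow {..<n}. smul F ((- 1) ^ card T) (P (\<Sum>i\<in>T. xs ! i)))
      = (\<Sum>T\<in>Pow {..<n}. \<Sum>fs\<in>{fs\<in>?L. set fs \<subseteq> T}. smul F ((- 1) ^ card T) (A (map ((!) xs) fs)))"
  proof (rule sum.cong[OF refl])
    fix T assume T: "T \<in> Pow {..<n}"
    then have fin: "finite T" using finite_subset[of T "{..<n}"] by auto
    have m: "xs ! i \<in> vecs E" if "i \<in> T" for i using T that mem by auto
    have "P (\<Sum>i\<in>T. xs ! i) = A ([] @ replicate n (\<Sum>i\<in>T. xs ! i))"
      using P[OF E.sum_mem[of T "(!) xs"]] m by simp
    also have "\<dots> = (\<Sum>fs | set fs \<subseteq> T \<and> length fs = n. A ([] @ map ((!) xs) fs))"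
      by (rule multilinear_expand[OF A fin m]) auto
    also have "{fs. set fs \<subseteq> T \<and> length fs = n} = {fs\<in>?L. set fs \<subseteq> T}" using T by auto
    finally show "smul F ((- 1) ^ card T) (P (\<Sum>i\<in>T. xs ! i))
        = (\<Sum>fs\<in>{fs\<in>?L. set fs \<subseteq> T}. smul F ((- 1) ^ card T) (A (map ((!) xs) fs)))"
      by (simp add: F.V.scale_sum_right)
  qed
  also have "\<dots> = (\<Sum>fs\<in>?L. \<Sum>T | T \<in> Pow {..<n} \<and> set fs \<subseteq> T. smul F ((- 1) ^ card T) (A (map ((!) xs) fs)))"
    by (rule sum.swap_restrict) (auto intro: finL)
  also have "\<dots> = (\<Sum>fs\<in>?L. smul F (if set fs = {..<n} then (- 1) ^ n else 0) (A (map ((!) xs) fs)))"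
  proof (rule sum.cong[OF refl])
    fix fs assume "fs \<in> ?L"
    then have "set fs \<subseteq> {..<n}" by simp
    from sum_sign_supersets[OF this]
    show "(\<Sum>T | T \<in> Pow {..<n} \<and> set fs \<subseteq> T. smul F ((- 1) ^ card T) (A (map ((!) xs) fs)))
        = smul F (if set fs = {..<n} then (- 1) ^ n else 0) (A (map ((!) xs) fs))"
      by (simp only: F.V.scale_sum_left[symmetric])
  qed
  also have "\<dots> = (\<Sum>fs\<in>permutations_of_set {..<n}. smul F ((- 1) ^ n) (A (map ((!) xs) fs)))"
  proof (rule sum.mono_neutral_cong_right[OF finL])
    show "permutations_of_set {..<n} \<subseteq> ?L"
      using length_finite_permutations_of_set[of _ "{..<n}"] permutations_of_setD by fastforce
    show "\<forall>fs\<in>?L - permutations_of_set {..<n}.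
        smul F (if set fs = {..<n} then (- 1) ^ n else 0) (A (map ((!) xs) fs)) = 0"
      by (auto simp: permutations_of_set_def card_distinct)
  qed (auto dest: permutations_of_setD)
  finally show ?thesis
    by (simp add: polar_def F.V.scale_sum_right[symmetric] flip: power_mult_distrib)
qed

section \<open>Symmetrization\<close>

definition symmetrization :: "nat \<Rightarrow> ('e list \<Rightarrow> 'f) \<Rightarrow> 'e list \<Rightarrow> 'f" where
  "symmetrization n A xs =
     smul F (inverse (of_nat (fact n))) (\<Sum>fs\<in>permutations_of_set {..<n}. A (map ((!) xs) fs))"

text \<open>A permuted argument list still has \<open>x\<close> in one slot, and that slot does not
  depend on \<open>x\<close>; so linearity of \<open>A\<close> passes to each summand of the
  symmetrization.\<close>

lemma permutation_list_update:
  assumes fs: "fs \<in> permutations_of_set {..<n}" and len: "Suc (length us + length vs) = n"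
  obtains us' vs' where "Suc (length us' + length vs') = n"
    "set us' \<subseteq> set us \<union> set vs" "set vs' \<subseteq> set us \<union> set vs"
    "\<And>x. map ((!) (us @ x # vs)) fs = us' @ x # vs'"
proof -
  have d: "set fs = {..<n}" "distinct fs" using permutations_of_setD[OF fs] by auto
  have "length us \<in> set fs" using d len by auto
  then obtain as bs where fs_eq: "fs = as @ length us # bs" by (meson split_list)
  have notin: "length us \<notin> set as" "length us \<notin> set bs" using d(2) by (auto simp: fs_eq)
  define h where "h i = (if i < length us then us ! i else vs ! (i - Suc (length us)))" for i
  have h: "(us @ x # vs) ! i = h i" if "i \<noteq> length us" for x i
    using that by (auto simp: h_def nth_append nth_Cons')
  have hm: "h i \<in> set us \<union> set vs" if "i < n" "i \<noteq> length us" for i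
    using that len by (auto simp: h_def)
  show ?thesis
  proof (rule that[of "map h as" "map h bs"])
    show "Suc (length (map h as) + length (map h bs)) = n"
      using length_finite_permutations_of_set[OF fs] by (simp add: fs_eq)
    have "set as \<subseteq> {..<n}" "set bs \<subseteq> {..<n}" using d(1) by (auto simp: fs_eq)
    then show "set (map h as) \<subseteq> set us \<union> set vs" "set (map h bs) \<subseteq> set us \<union> set vs"
      using notin hm by (auto simp: subset_iff)
    fix x
    have "map ((!) (us @ x # vs)) as = map h as" "map ((!) (us @ x # vs)) bs = map h bs"
      using notin by (auto intro!: h)
    then show "map ((!) (us @ x # vs)) fs = map h as @ x # map h bs"
      by (simp add: fs_eq)
  qed
qed

lemma map_nth_permutation_mem:
  assumes "fs \<in> permutations_of_set {..<n}" "length xs = n" "set xs \<subseteq> S"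
  shows "length (map ((!) xs) fs) = n" "set (map ((!) xs) fs) \<subseteq> S"
proof -
  show "length (map ((!) xs) fs) = n"
    using length_finite_permutations_of_set[OF assms(1)] by simp
  have "xs ! i \<in> S" if "i \<in> set fs" for i
    using that nth_mem[of i xs] assms(2,3) permutations_of_setD(1)[OF assms(1)] by auto
  then show "set (map ((!) xs) fs) \<subseteq> S" by auto
qed

lemma multilinear_symmetrization:
  assumes A: "multilinear_map n E F A"
  shows "multilinear_map n E F (symmetrization n A)"
proof (rule multilinear_mapI)
  fix xs :: "'e list" assume "length xs = n" "set xs \<subseteq> vecs E"
  then show "symmetrization n A xs \<in> vecs F"
    unfolding symmetrization_def
    by (intro F.smul_mem F.sum_mem multilinear_mem[OF A] map_nth_permutation_mem)
next
  fix us vs :: "'e list" and x y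
  assume as: "Suc (length us + length vs) = n" "set us \<subseteq> vecs E" "set vs \<subseteq> vecs E" "x \<in> vecs E" "y \<in> vecs E"
  have "A (map ((!) (us @ (x + y) # vs)) fs) = A (map ((!) (us @ x # vs)) fs) + A (map ((!) (us @ y # vs)) fs)"
    if fs: "fs \<in> permutations_of_set {..<n}" for fs
  proof -
    from permutation_list_update[OF fs as(1)] obtain us' vs' where *: "Suc (length us' + length vs') = n"
      "set us' \<subseteq> set us \<union> set vs" "set vs' \<subseteq> set us \<union> set vs"
      "\<And>x. map ((!) (us @ x # vs)) fs = us' @ x # vs'" by blast
    show ?thesis unfolding *(4) using * as by (intro multilinear_add[OF A]) auto
  qed
  then show "symmetrization n A (us @ (x + y) # vs) = symmetrization n A (us @ x # vs) + symmetrization n A (us @ y # vs)"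
    by (simp add: symmetrization_def sum.distrib F.V.scale_right_distrib)
next
  fix us vs :: "'e list" and x c
  assume as: "Suc (length us + length vs) = n" "set us \<subseteq> vecs E" "set vs \<subseteq> vecs E" "x \<in> vecs E"
  have "A (map ((!) (us @ smul E c x # vs)) fs) = smul F c (A (map ((!) (us @ x # vs)) fs))"
    if fs: "fs \<in> permutations_of_set {..<n}" for fs
  proof -
    from permutation_list_update[OF fs as(1)] obtain us' vs' where *: "Suc (length us' + length vs') = n"
      "set us' \<subseteq> set us \<union> set vs" "set vs' \<subseteq> set us \<union> set vs"
      "\<And>x. map ((!) (us @ x # vs)) fs = us' @ x # vs'" by blast
    show ?thesis unfolding *(4) using * as by (intro multilinear_smul[OF A]) auto
  qed
  then show "symmetrization n A (us @ smul E c x # vs) = smul F c (symmetrization n A (us @ x # vs))"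
    by (simp add: symmetrization_def F.V.scale_sum_right[symmetric] mult.commute)
qed

text \<open>If \<open>xs\<close> is \<open>ys\<close> rearranged by \<open>p\<close>, composing with
  \<open>p\<close> merely reorders the index permutations over which the sum runs.\<close>

lemma symmetric_symmetrization: "symmetric_map n E (symmetrization n A)"
  unfolding symmetric_map_def
proof (intro allI impI, elim conjE)
  fix xs ys :: "'e list"
  assume xs: "length xs = n" "mset xs = mset ys"
  obtain p where p: "p permutes {..<length ys}" "permute_list p ys = xs"
    using xs(2) by (rule mset_eq_permutation)
  have len: "length ys = n" using xs mset_eq_length by metis
  have bij: "bij_betw (map p) (permutations_of_set {..<n}) (permutations_of_set {..<n})"
  proof (rule bij_betwI[where g = "map (inv p)"])
    have pn: "p permutes {..<n}" using p len by simp
    show "map p \<in> permutations_of_set {..<n} \<rightarrow> permutations_of_set {..<n}"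
      "map (inv p) \<in> permutations_of_set {..<n} \<rightarrow> permutations_of_set {..<n}"
      using permutes_image[OF pn] permutes_image[OF permutes_inv[OF pn]]
        permutes_inj_on[OF pn] permutes_inj_on[OF permutes_inv[OF pn]]
      by (auto simp: permutations_of_set_def distinct_map)
    show "map (inv p) (map p fs) = fs" "map p (map (inv p) fs) = fs" for fs
      using permutes_inverses[OF pn] by (simp_all add: comp_def)
  qed
  have "(\<Sum>fs\<in>permutations_of_set {..<n}. A (map ((!) xs) fs))
      = (\<Sum>fs\<in>permutations_of_set {..<n}. A (map ((!) ys) (map p fs)))"
  proof (rule sum.cong[OF refl])
    fix fs assume fs: "fs \<in> permutations_of_set {..<n}"
    have "xs ! i = ys ! p i" if "i < n" for i
      using permute_list_nth[OF p(1), of i] p(2) len that by simp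
    then show "A (map ((!) xs) fs) = A (map ((!) ys) (map p fs))"
      using permutations_of_setD(1)[OF fs] by (intro arg_cong[where f = A]) auto
  qed
  also have "\<dots> = (\<Sum>fs\<in>permutations_of_set {..<n}. A (map ((!) ys) fs))"
    by (rule sum.reindex_bij_betw[OF bij])
  finally show "symmetrization n A xs = symmetrization n A ys"
    by (simp add: symmetrization_def)
qed

lemma symmetrization_replicate:
  "symmetrization n A (replicate n x) = A (replicate n x)"
proof -
  have "map ((!) (replicate n x)) fs = replicate n x" if "fs \<in> permutations_of_set {..<n}" for fs
    using permutations_of_setD(1)[OF that] length_finite_permutations_of_set[OF that]
    by (intro replicate_eqI) auto
  then have "(\<Sum>fs\<in>permutations_of_set {..<n}. A (map ((!) (replicate n x)) fs))
      = smul F (of_nat (card (permutations_of_set {..<n}))) (A (replicate n x))"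
    by (simp add: sum_const_smul)
  then show ?thesis by (simp add: symmetrization_def)
qed

text \<open>For symmetric \<open>A\<close> all n! terms of the polarization coincide. Since
  \<open>polar\<close> depends on P only, the form chosen in \<open>symmetric_form\<close> is unique
  on lists in E, and bounds and linearity can be read off the formula.\<close>

lemma symmetric_multilinear_polar:
  assumes A: "multilinear_map n E F A" "symmetric_map n E A"
    and P: "\<And>x. x \<in> vecs E \<Longrightarrow> P x = A (replicate n x)"
    and xs: "length xs = n" "set xs \<subseteq> vecs E"
  shows "A xs = smul F (inverse (of_nat (fact n))) (polar n P xs)"
proof -
  have "A (map ((!) xs) fs) = A xs" if fs: "fs \<in> permutations_of_set {..<n}" for fs
  proof -
    have "mset fs = mset_set {..<n}"
      using permutations_of_setD[OF fs] by (metis mset_set_set)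
    also have "\<dots> = mset [0..<n]" by (simp add: atLeast0LessThan)
    finally have "mset (map ((!) xs) fs) = mset (map ((!) xs) [0..<n])" by (simp only: mset_map)
    also have "map ((!) xs) [0..<n] = xs" using xs(1) map_nth by blast
    finally show ?thesis
      using A(2) map_nth_permutation_mem[OF fs xs] unfolding symmetric_map_def by blast
  qed
  then have "(\<Sum>fs\<in>permutations_of_set {..<n}. A (map ((!) xs) fs))
      = smul F (of_nat (card (permutations_of_set {..<n}))) (A xs)"
    by (simp add: sum_const_smul)
  moreover have "polar n P xs = (\<Sum>fs\<in>permutations_of_set {..<n}. A (map ((!) xs) fs))"
    by (rule polarization[OF A(1) _ xs]) (rule P)
  ultimately have "polar n P xs = smul F (of_nat (card (permutations_of_set {..<n}))) (A xs)" by simp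
  then show ?thesis by simp
qed

end

section \<open>Spaces of polynomials\<close>

context normed_pair
begin

section \<open>Norm estimates for multilinear maps\<close>

lemma multilinear_replicate_mem:
  "multilinear_map n E F A \<Longrightarrow> x \<in> vecs E \<Longrightarrow> A (replicate n x) \<in> vecs F"
  by (rule multilinear_mem) (auto simp: set_replicate_conv_if)

text \<open>The entries of \<open>vs\<close> are normalized one at a time and moved into the prefix
  \<open>us\<close>, which stays in the unit ball.\<close>

lemma multilinear_norm_le_aux:
  assumes A: "multilinear_map n E F A"
    and K: "\<And>xs. length xs = n \<Longrightarrow> set xs \<subseteq> unit_ball E \<Longrightarrow> vnorm F (A xs) \<le> K"
  shows "length us + length vs = n \<Longrightarrow> set us \<subseteq> unit_ball E \<Longrightarrow> set vs \<subseteq> vecs E \<Longrightarrow>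
    vnorm F (A (us @ vs)) \<le> K * prod_list (map (vnorm E) vs)"
proof (induction vs arbitrary: us)
  case Nil
  then show ?case using K[of us] by simp
next
  case (Cons v vs)
  have v: "v \<in> vecs E" and vs: "set vs \<subseteq> vecs E" and us: "set us \<subseteq> vecs E"
    using Cons.prems by (auto simp: unit_ball_def)
  show ?case
  proof (cases "v = 0")
    case True
    then show ?thesis using multilinear_zero[OF A _ us vs] Cons.prems by simp
  next
    case False
    define u where "u = smul E (of_real (1 / vnorm E v)) v"
    have pos: "vnorm E v > 0" using E.norm_eq_0[OF v] E.norm_nonneg[OF v] False by linarith
    have u: "u \<in> unit_ball E"
      using E.norm_normalize[OF v False] v by (simp add: u_def unit_ball_def)
    then have uE: "u \<in> vecs E" by (simp add: unit_ball_def)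
    have vu: "v = smul E (of_real (vnorm E v)) u"
      using pos by (simp add: u_def flip: of_real_mult)
    have "A (us @ v # vs) = smul F (of_real (vnorm E v)) (A (us @ u # vs))"
      by (subst vu) (use Cons.prems uE us vs in \<open>auto intro!: multilinear_smul[OF A]\<close>)
    moreover have "A (us @ u # vs) \<in> vecs F"
      using Cons.prems uE us vs by (intro multilinear_mem[OF A]) auto
    moreover have "vnorm F (A ((us @ [u]) @ vs)) \<le> K * prod_list (map (vnorm E) vs)"
      using Cons.prems u by (intro Cons.IH) auto
    ultimately show ?thesis using pos by (simp add: F.norm_smul mult.left_commute)
  qed
qed

lemma multilinear_norm_le:
  assumes "multilinear_map n E F A"
    and "\<And>xs. length xs = n \<Longrightarrow> set xs \<subseteq> unit_ball E \<Longrightarrow> vnorm F (A xs) \<le> K"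
    and "length xs = n" "set xs \<subseteq> vecs E"
  shows "vnorm F (A xs) \<le> K * prod_list (map (vnorm E) xs)"
  using multilinear_norm_le_aux[OF assms(1,2), of "[]" xs] assms(3,4) by simp

lemma prod_list_norm_le:
  assumes "set xs \<subseteq> vecs E" "\<And>x. x \<in> set xs \<Longrightarrow> vnorm E x \<le> R"
  shows "prod_list (map (vnorm E) xs) \<le> R ^ length xs" "0 \<le> prod_list (map (vnorm E) xs)"
proof -
  have "0 \<le> prod_list (map (vnorm E) xs) \<and> prod_list (map (vnorm E) xs) \<le> R ^ length xs"
    using assms
  proof (induction xs)
    case (Cons x xs)
    then have "0 \<le> vnorm E x" "vnorm E x \<le> R" by auto
    then have "0 \<le> R" by linarith
    with Cons \<open>0 \<le> vnorm E x\<close> \<open>vnorm E x \<le> R\<close> show ?case by (auto intro!: mult_mono)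
  qed simp
  then show "prod_list (map (vnorm E) xs) \<le> R ^ length xs" "0 \<le> prod_list (map (vnorm E) xs)" by auto
qed

text \<open>Telescoping over the m slots: one \<open>x\<close> at a time becomes \<open>y\<close>
  and joins the prefix, at cost K * R ^ (n - 1) * \<parallel>x - y\<parallel> each.\<close>

lemma multilinear_replicate_diff_le:
  assumes A: "multilinear_map n E F A" and "0 \<le> K"
    and K: "\<And>xs. length xs = n \<Longrightarrow> set xs \<subseteq> vecs E \<Longrightarrow> vnorm F (A xs) \<le> K * prod_list (map (vnorm E) xs)"
    and xy: "x \<in> vecs E" "y \<in> vecs E" "vnorm E x \<le> R" "vnorm E y \<le> R"
  shows "length us + m = n \<Longrightarrow> set us \<subseteq> vecs E \<Longrightarrow> (\<forall>u\<in>set us. vnorm E u \<le> R) \<Longrightarrow>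
    vnorm F (A (us @ replicate m x) - A (us @ replicate m y)) \<le> real m * K * R ^ (n - 1) * vnorm E (x - y)"
proof (induction m arbitrary: us)
  case (Suc m)
  have mem: "A (us @ x # replicate m x) \<in> vecs F" "A (us @ y # replicate m x) \<in> vecs F"
    "A (us @ y # replicate m y) \<in> vecs F" "A (us @ (x - y) # replicate m x) \<in> vecs F"
    using Suc.prems xy by (auto intro!: multilinear_mem[OF A])
  have sub: "set (us @ replicate m x) \<subseteq> vecs E" using Suc.prems xy by auto
  have bd: "vnorm E v \<le> R" if "v \<in> set (us @ replicate m x)" for v using that Suc.prems xy by auto
  have "length (us @ replicate m x) = n - 1" using Suc.prems by auto
  with prod_list_norm_le[OF sub bd] have "prod_list (map (vnorm E) (us @ replicate m x)) \<le> R ^ (n - 1)"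
    "0 \<le> prod_list (map (vnorm E) (us @ replicate m x))" by metis+
  then have "prod_list (map (vnorm E) (us @ replicate m x)) * vnorm E (x - y) \<le> R ^ (n - 1) * vnorm E (x - y)"
    using xy by (intro mult_right_mono) auto
  then have p: "prod_list (map (vnorm E) (us @ (x - y) # replicate m x)) \<le> R ^ (n - 1) * vnorm E (x - y)"
    by (simp add: ac_simps)
  have "vnorm F (A (us @ (x - y) # replicate m x)) \<le> K * prod_list (map (vnorm E) (us @ (x - y) # replicate m x))"
    using Suc.prems xy by (intro K) auto
  also have "\<dots> \<le> K * (R ^ (n - 1) * vnorm E (x - y))" using p \<open>0 \<le> K\<close> by (rule mult_left_mono)
  finally have 1: "vnorm F (A (us @ (x - y) # replicate m x)) \<le> K * (R ^ (n - 1) * vnorm E (x - y))" .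
  have 2: "vnorm F (A ((us @ [y]) @ replicate m x) - A ((us @ [y]) @ replicate m y))
      \<le> real m * K * R ^ (n - 1) * vnorm E (x - y)"
    using Suc.prems xy by (intro Suc.IH) auto
  have "A (us @ (x - y) # replicate m x) = A (us @ x # replicate m x) - A (us @ y # replicate m x)"
    using Suc.prems xy by (intro multilinear_diff[OF A]) auto
  then have eq: "A (us @ replicate (Suc m) x) - A (us @ replicate (Suc m) y)
      = A (us @ (x - y) # replicate m x) + (A (us @ y # replicate m x) - A (us @ y # replicate m y))"
    by simp
  have "vnorm F (A (us @ replicate (Suc m) x) - A (us @ replicate (Suc m) y))
      \<le> vnorm F (A (us @ (x - y) # replicate m x)) + vnorm F (A (us @ y # replicate m x) - A (us @ y # replicate m y))"
    unfolding eq using mem by (intro F.norm_add_le) auto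
  also have "\<dots> \<le> K * (R ^ (n - 1) * vnorm E (x - y)) + real m * K * R ^ (n - 1) * vnorm E (x - y)"
    using 1 2 by simp
  finally show ?case by (simp add: algebra_simps)
qed simp

text \<open>There are 2 ^ n subsets, and a sum of at most n vectors of the unit ball has norm at
  most n. The bound is crude; it serves to show that the symmetric form is bounded at all.\<close>

lemma polar_norm_le:
  assumes P: "\<And>x. x \<in> vecs E \<Longrightarrow> P x \<in> vecs F"
    and C: "\<And>x. x \<in> vecs E \<Longrightarrow> vnorm F (P x) \<le> C * vnorm E x ^ n" and "0 \<le> C"
    and xs: "length xs = n" "set xs \<subseteq> unit_ball E"
  shows "vnorm F (polar n P xs) \<le> 2 ^ n * (C * real n ^ n)"
proof -
  have mem: "xs ! i \<in> unit_ball E" if "i < n" for i using xs that nth_mem by blast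
  have *: "vnorm F (smul F ((- 1) ^ card T) (P (\<Sum>i\<in>T. xs ! i))) \<le> C * real n ^ n"
    and **: "smul F ((- 1) ^ card T) (P (\<Sum>i\<in>T. xs ! i)) \<in> vecs F"
    if T: "T \<in> Pow {..<n}" for T
  proof -
    have m: "xs ! i \<in> vecs E" "vnorm E (xs ! i) \<le> 1" if "i \<in> T" for i
      using mem[of i] T that by (auto simp: unit_ball_def)
    have s: "(\<Sum>i\<in>T. xs ! i) \<in> vecs E" using m by (intro E.sum_mem)
    show "smul F ((- 1) ^ card T) (P (\<Sum>i\<in>T. xs ! i)) \<in> vecs F" using P[OF s] by simp
    have "vnorm E (\<Sum>i\<in>T. xs ! i) \<le> (\<Sum>i\<in>T. vnorm E (xs ! i))" using m by (intro E.norm_sum_le)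
    also have "\<dots> \<le> (\<Sum>i\<in>T. 1)" using m by (intro sum_mono)
    also have "\<dots> \<le> real n" using card_mono[of "{..<n}" T] T by simp
    finally have "vnorm E (\<Sum>i\<in>T. xs ! i) ^ n \<le> real n ^ n" using s by (intro power_mono) auto
    then have "C * vnorm E (\<Sum>i\<in>T. xs ! i) ^ n \<le> C * real n ^ n" using \<open>0 \<le> C\<close> by (rule mult_left_mono)
    with C[OF s] have "vnorm F (P (\<Sum>i\<in>T. xs ! i)) \<le> C * real n ^ n" by linarith
    then show "vnorm F (smul F ((- 1) ^ card T) (P (\<Sum>i\<in>T. xs ! i))) \<le> C * real n ^ n"
      using P[OF s] by (simp add: F.norm_smul norm_power)
  qed
  let ?S = "\<Sum>T\<in>Pow {..<n}. smul F ((- 1) ^ card T) (P (\<Sum>i\<in>T. xs ! i))"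
  have "?S \<in> vecs F" using ** by (rule F.sum_mem)
  have "vnorm F ?S \<le> (\<Sum>T\<in>Pow {..<n}. vnorm F (smul F ((- 1) ^ card T) (P (\<Sum>i\<in>T. xs ! i))))"
    using ** by (rule F.norm_sum_le)
  also have "\<dots> \<le> (\<Sum>T\<in>Pow {..<n}. C * real n ^ n)" using * by (rule sum_mono)
  finally show ?thesis
    unfolding polar_def using \<open>?S \<in> vecs F\<close> by (simp add: F.norm_smul norm_power card_Pow)
qed

lemma symmetric_multilinear_bounded:
  assumes A: "multilinear_map n E F A" "symmetric_map n E A"
    and P: "\<And>x. x \<in> vecs E \<Longrightarrow> P x = A (replicate n x)"
    and C: "\<And>x. x \<in> vecs E \<Longrightarrow> vnorm F (P x) \<le> C * vnorm E x ^ n" and "0 \<le> C"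
  obtains K where "0 \<le> K"
    "\<And>xs. length xs = n \<Longrightarrow> set xs \<subseteq> vecs E \<Longrightarrow> vnorm F (A xs) \<le> K * prod_list (map (vnorm E) xs)"
proof
  let ?c = "inverse (of_nat (fact n)) :: 'k"
  let ?K = "norm ?c * (2 ^ n * (C * real n ^ n))"
  show "0 \<le> ?K" using \<open>0 \<le> C\<close> by simp
  have PF: "P x \<in> vecs F" if "x \<in> vecs E" for x
    using P[OF that] multilinear_replicate_mem[OF A(1) that] by simp
  have "vnorm F (A xs) \<le> ?K" if xs: "length xs = n" "set xs \<subseteq> unit_ball E" for xs
  proof -
    have sub: "set xs \<subseteq> vecs E" using xs(2) by (auto simp: unit_ball_def)
    have eq: "A xs = smul F ?c (polar n P xs)"
      by (rule symmetric_multilinear_polar[OF A _ xs(1) sub]) (rule P)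
    have "smul F (of_nat (fact n)) (A xs) = polar n P xs" by (simp add: eq)
    then have "polar n P xs \<in> vecs F" using F.smul_mem[OF multilinear_mem[OF A(1) xs(1) sub]] by metis
    moreover have "vnorm F (polar n P xs) \<le> 2 ^ n * (C * real n ^ n)"
      by (rule polar_norm_le[OF PF C \<open>0 \<le> C\<close> xs])
    ultimately show ?thesis by (simp only: eq F.norm_smul) (intro mult_left_mono, auto)
  qed
  then show "vnorm F (A xs) \<le> ?K * prod_list (map (vnorm E) xs)"
    if "length xs = n" "set xs \<subseteq> vecs E" for xs
    using multilinear_norm_le[OF A(1) _ that] by blast
qed

lemma multilinear_replicate_continuous:
  assumes A: "multilinear_map n E F A" and "0 \<le> K"
    and K: "\<And>xs. length xs = n \<Longrightarrow> set xs \<subseteq> vecs E \<Longrightarrow> vnorm F (A xs) \<le> K * prod_list (map (vnorm E) xs)"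
    and P: "\<And>x. x \<in> vecs E \<Longrightarrow> P x = A (replicate n x)"
  shows "continuous_map (norm_topology E) (norm_topology F) P"
  unfolding E.norm_topology_eq F.norm_topology_eq E.M.metric_continuous_map[OF F.M.Metric_space_axioms]
proof (intro conjI ballI allI impI)
  have PF: "P x \<in> vecs F" if "x \<in> vecs E" for x
    using P[OF that] multilinear_replicate_mem[OF A that] by simp
  then show "P ` vecs E \<subseteq> vecs F" by blast
  fix a and \<epsilon> :: real assume a: "a \<in> vecs E" and "\<epsilon> > 0"
  define R where "R = vnorm E a + 1"
  define L where "L = real n * K * R ^ (n - 1) + 1"
  have R: "R \<ge> 0" using a by (simp add: R_def)
  then have L: "L > 0" using \<open>0 \<le> K\<close> by (simp add: L_def add_nonneg_pos)
  show "\<exists>\<delta>>0. \<forall>x. x \<in> vecs E \<and> vdist E a x < \<delta> \<longrightarrow> vdist F (P a) (P x) < \<epsilon>"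
  proof (intro exI[of _ "min 1 (\<epsilon> / L)"] conjI allI impI)
    show "0 < min 1 (\<epsilon> / L)" using L \<open>\<epsilon> > 0\<close> by simp
    fix x assume x: "x \<in> vecs E \<and> vdist E a x < min 1 (\<epsilon> / L)"
    then have d: "vnorm E (a - x) < 1" "vnorm E (a - x) < \<epsilon> / L" "x \<in> vecs E"
      using a by (auto simp: vdist_def)
    have "vnorm E x \<le> vnorm E a + vnorm E (a - x)"
      using E.norm_diff_le[OF a E.diff_mem[OF a d(3)]] by simp
    then have xR: "vnorm E x \<le> R" "vnorm E a \<le> R" using d by (auto simp: R_def)
    have "vnorm F (A ([] @ replicate n a) - A ([] @ replicate n x)) \<le> real n * K * R ^ (n - 1) * vnorm E (a - x)"
      by (rule multilinear_replicate_diff_le[OF A \<open>0 \<le> K\<close> K a d(3) xR(2,1)]) auto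
    also have "\<dots> \<le> L * vnorm E (a - x)" using a d(3) by (intro mult_right_mono) (auto simp: L_def)
    also have "\<dots> < \<epsilon>" using d(2) L by (simp add: field_simps)
    finally show "vdist F (P a) (P x) < \<epsilon>"
      using a d(3) PF by (simp add: vdist_def P)
  qed
qed

text \<open>Continuity of a homogeneous polynomial is boundedness. One direction rescales continuity
  at 0. In the other the given \<open>A\<close> may be unbounded off the diagonal, so it is replaced
  by its symmetrization, which polarization bounds in terms of P.\<close>

lemma poly_space_iff:
  "P \<in> vecs (poly_space n E F) \<longleftrightarrow>
    (\<forall>x. x \<notin> vecs E \<longrightarrow> P x = 0) \<and>
    (\<exists>A. multilinear_map n E F A \<and> (\<forall>x\<in>vecs E. P x = A (replicate n x))) \<and>
    (\<exists>C\<ge>0. \<forall>x\<in>vecs E. vnorm F (P x) \<le> C * vnorm E x ^ n)"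
proof -
  have "continuous_map (norm_topology E) (norm_topology F) P \<longleftrightarrow>
      (\<exists>C\<ge>0. \<forall>x\<in>vecs E. vnorm F (P x) \<le> C * vnorm E x ^ n)"
    if A: "multilinear_map n E F A" and P: "\<forall>x\<in>vecs E. P x = A (replicate n x)" for A
  proof
    assume c: "continuous_map (norm_topology E) (norm_topology F) P"
    have PF: "P x \<in> vecs F" if "x \<in> vecs E" for x
      using P that multilinear_replicate_mem[OF A that] by simp
    from c obtain \<delta> where "\<delta> > 0" and \<delta>: "\<And>x. x \<in> vecs E \<Longrightarrow> vdist E 0 x < \<delta> \<Longrightarrow> vdist F (P 0) (P x) < 1"
      unfolding E.norm_topology_eq F.norm_topology_eq E.M.metric_continuous_map[OF F.M.Metric_space_axioms]
      using E.zero_mem zero_less_one by meson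
    define D where "D = vnorm F (P 0) + 1"
    have "D \<ge> 1" using PF[of 0] by (simp add: D_def)
    have small: "vnorm F (P x) \<le> D" if x: "x \<in> vecs E" "vnorm E x < \<delta>" for x
    proof -
      have "vnorm F (P 0 - P x) < 1" using \<delta>[of x] x PF by (simp add: vdist_def E.norm_minus)
      then show ?thesis
        using F.norm_diff_le[of "P 0" "P 0 - P x"] PF x by (simp add: D_def)
    qed
    have hom: "P (smul E c x) = smul F (c ^ n) (P x)" if "x \<in> vecs E" for c x
      using multilinear_replicate_smul[OF A that, of "[]" n c] P that by simp
    have "vnorm F (P x) \<le> (D * (2 / \<delta>) ^ n) * vnorm E x ^ n" if x: "x \<in> vecs E" for x
    proof (cases "x = 0")
      case True
      show ?thesis
      \<comment> \<open>In degree 0 the polynomial is constant and P 0 need not vanish.\<close>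
      proof (cases "n = 0")
        case True
        then show ?thesis using small[of 0] \<open>x = 0\<close> \<open>\<delta> > 0\<close> by simp
      next
        case False
        then have "P 0 = 0" using hom[of 0 0] by (simp add: power_0_left)
        then show ?thesis using \<open>x = 0\<close> False by (simp add: power_0_left)
      qed
    next
      case False
      then have pos: "vnorm E x > 0" using E.norm_eq_0[OF x] E.norm_nonneg[OF x] by linarith
      \<comment> \<open>Moves \<open>x\<close> to norm \<delta> / 2, strictly inside the ball on
        which \<open>small\<close> applies.\<close>
      let ?t = "\<delta> / (2 * vnorm E x)"
      have t: "?t > 0" using pos \<open>\<delta> > 0\<close> by simp
      have "vnorm E (smul E (of_real ?t) x) = \<delta> / 2"
        using pos \<open>\<delta> > 0\<close> by (simp add: E.norm_smul[OF x] norm_divide norm_mult)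
      then have "vnorm F (P (smul E (of_real ?t) x)) \<le> D" using x \<open>\<delta> > 0\<close> by (intro small) auto
      also have "P (smul E (of_real ?t) x) = smul F (of_real (?t ^ n)) (P x)"
        using hom[OF x] by (simp only: of_real_power)
      also have "vnorm F \<dots> = ?t ^ n * vnorm F (P x)"
        using t by (simp only: F.norm_smul[OF PF[OF x]] norm_of_real abs_of_nonneg zero_le_power less_imp_le)
      finally have "vnorm F (P x) * ?t ^ n \<le> D" by (simp only: mult.commute)
      then have "vnorm F (P x) \<le> D / ?t ^ n"
        using zero_less_power[OF t] by (simp only: pos_le_divide_eq)
      also have "\<dots> = (D * (2 / \<delta>) ^ n) * vnorm E x ^ n"
        using pos \<open>\<delta> > 0\<close> by (simp add: power_divide power_mult_distrib)
      finally show ?thesis .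
    qed
    moreover have "0 \<le> D * (2 / \<delta>) ^ n" using \<open>D \<ge> 1\<close> \<open>\<delta> > 0\<close> by simp
    ultimately show "\<exists>C\<ge>0. \<forall>x\<in>vecs E. vnorm F (P x) \<le> C * vnorm E x ^ n" by blast
  next
    assume "\<exists>C\<ge>0. \<forall>x\<in>vecs E. vnorm F (P x) \<le> C * vnorm E x ^ n"
    then obtain C where C: "C \<ge> 0" "\<And>x. x \<in> vecs E \<Longrightarrow> vnorm F (P x) \<le> C * vnorm E x ^ n" by blast
    let ?S = "symmetrization n A"
    have S: "multilinear_map n E F ?S" "symmetric_map n E ?S"
      by (rule multilinear_symmetrization[OF A]) (rule symmetric_symmetrization)
    have PS: "P x = ?S (replicate n x)" if "x \<in> vecs E" for x
      using P that by (simp add: symmetrization_replicate)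
    obtain K where "0 \<le> K"
      "\<And>xs. length xs = n \<Longrightarrow> set xs \<subseteq> vecs E \<Longrightarrow> vnorm F (?S xs) \<le> K * prod_list (map (vnorm E) xs)"
      using symmetric_multilinear_bounded[OF S PS C(2,1)] by blast
    then show "continuous_map (norm_topology E) (norm_topology F) P"
      by (rule multilinear_replicate_continuous[OF S(1) _ _ PS])
  qed
  then show ?thesis unfolding poly_space_def by auto
qed

section \<open>The normed space of polynomials\<close>

lemma poly_outside: "P \<in> vecs (poly_space n E F) \<Longrightarrow> x \<notin> vecs E \<Longrightarrow> P x = 0"
  by (simp add: poly_space_def)

lemma poly_mem: "P \<in> vecs (poly_space n E F) \<Longrightarrow> x \<in> vecs E \<Longrightarrow> P x \<in> vecs F"
  unfolding poly_space_def using multilinear_replicate_mem[of n _ x] by auto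

lemma poly_hom:
  "P \<in> vecs (poly_space n E F) \<Longrightarrow> x \<in> vecs E \<Longrightarrow> P (smul E c x) = smul F (c ^ n) (P x)"
  unfolding poly_space_def using multilinear_replicate_smul[of n _ x "[]" n c] by auto

lemma poly_bdd_above:
  assumes P: "P \<in> vecs (poly_space n E F)"
  shows "bdd_above ((\<lambda>x. vnorm F (P x)) ` unit_ball E)"
proof -
  obtain C where C: "C \<ge> 0" "\<And>x. x \<in> vecs E \<Longrightarrow> vnorm F (P x) \<le> C * vnorm E x ^ n"
    using P unfolding poly_space_iff by blast
  have "vnorm F (P x) \<le> C" if x: "x \<in> unit_ball E" for x
  proof -
    have "vnorm F (P x) \<le> C * vnorm E x ^ n" using C(2) x by (simp add: unit_ball_def)
    also have "\<dots> \<le> C * 1" using x C(1) by (intro mult_left_mono power_le_one) (auto simp: unit_ball_def)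
    finally show ?thesis by simp
  qed
  then show ?thesis by (intro bdd_aboveI2)
qed

lemma poly_norm_ball:
  "P \<in> vecs (poly_space n E F) \<Longrightarrow> x \<in> unit_ball E \<Longrightarrow> vnorm F (P x) \<le> vnorm (poly_space n E F) P"
  using cSUP_upper[OF _ poly_bdd_above, of x P n] by (simp add: poly_space_def)

lemma poly_norm_leI:
  assumes "\<And>x. x \<in> unit_ball E \<Longrightarrow> vnorm F (P x) \<le> C"
  shows "vnorm (poly_space n E F) P \<le> C"
  unfolding poly_space_def using assms by (auto intro!: cSUP_least intro: E.zero_mem_unit_ball)

lemma poly_norm_nonneg: "P \<in> vecs (poly_space n E F) \<Longrightarrow> 0 \<le> vnorm (poly_space n E F) P"
  using poly_norm_ball[of P n 0] F.norm_nonneg[OF poly_mem[of P n 0]] by simp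

lemma smul_poly_space [simp]: "smul (poly_space n E F) = (\<lambda>c P x. smul F c (P x))"
  by (simp add: poly_space_def)

lemma poly_norm_le:
  assumes "n \<ge> 1" and P: "P \<in> vecs (poly_space n E F)" and x: "x \<in> vecs E"
  shows "vnorm F (P x) \<le> vnorm (poly_space n E F) P * vnorm E x ^ n"
proof (cases "x = 0")
  case True
  then have "P x = 0" using poly_hom[OF P E.zero_mem, of 0] assms(1) by (simp add: power_0_left)
  then show ?thesis using True assms(1) by (simp add: power_0_left)
next
  case False
  then have pos: "vnorm E x > 0" using E.norm_eq_0[OF x] E.norm_nonneg[OF x] by linarith
  let ?u = "smul E (of_real (1 / vnorm E x)) x"
  have "?u \<in> unit_ball E" using E.norm_normalize[OF x False] x by (simp add: unit_ball_def)
  from poly_norm_ball[OF P this]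
  have "vnorm F (smul F (of_real (1 / vnorm E x) ^ n) (P x)) \<le> vnorm (poly_space n E F) P"
    unfolding poly_hom[OF P x] .
  also have "vnorm F (smul F (of_real (1 / vnorm E x) ^ n) (P x)) = vnorm F (P x) / vnorm E x ^ n"
    using pos by (simp add: F.norm_smul[OF poly_mem[OF P x]] norm_power norm_divide power_divide)
  finally show ?thesis using pos by (simp add: field_simps)
qed

theorem normed_poly_space:
  assumes "n \<ge> 1"
  shows "is_normed_space (poly_space n E F)"
proof -
  let ?X = "poly_space n E F"
  have vs: "vector_space (smul ?X)"
    by standard (auto simp: fun_eq_iff F.V.scale_right_distrib F.V.scale_left_distrib)
  interpret X: vector_space "smul ?X" by (rule vs)
  have zero: "0 \<in> vecs ?X"
    unfolding poly_space_iff
    by (auto simp: multilinear_map_def intro!: exI[of _ "\<lambda>_. 0"] exI[of _ 0])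
  have add: "P + Q \<in> vecs ?X" if P: "P \<in> vecs ?X" and Q: "Q \<in> vecs ?X" for P Q
    unfolding poly_space_iff
  proof (intro conjI)
    obtain A where A: "multilinear_map n E F A" "\<forall>x\<in>vecs E. P x = A (replicate n x)"
      using P unfolding poly_space_iff by blast
    obtain B where B: "multilinear_map n E F B" "\<forall>x\<in>vecs E. Q x = B (replicate n x)"
      using Q unfolding poly_space_iff by blast
    have "multilinear_map n E F (\<lambda>xs. A xs + B xs)"
      using multilinear_mem[OF A(1)] multilinear_mem[OF B(1)]
      by (intro multilinear_mapI)
         (auto simp: multilinear_add[OF A(1)] multilinear_add[OF B(1)] multilinear_smul[OF A(1)]
           multilinear_smul[OF B(1)] F.V.scale_right_distrib)
    then show "\<exists>A. multilinear_map n E F A \<and> (\<forall>x\<in>vecs E. (P + Q) x = A (replicate n x))"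
      using A(2) B(2) by (intro exI[of _ "\<lambda>xs. A xs + B xs"]) simp
    have "vnorm F ((P + Q) x) \<le> (vnorm ?X P + vnorm ?X Q) * vnorm E x ^ n" if x: "x \<in> vecs E" for x
      using F.norm_add_le[OF poly_mem[OF P x] poly_mem[OF Q x]]
        poly_norm_le[OF assms P x] poly_norm_le[OF assms Q x] by (simp add: distrib_right)
    then show "\<exists>C\<ge>0. \<forall>x\<in>vecs E. vnorm F ((P + Q) x) \<le> C * vnorm E x ^ n"
      using poly_norm_nonneg[OF P] poly_norm_nonneg[OF Q]
      by (intro exI[of _ "vnorm ?X P + vnorm ?X Q"]) simp
  qed (simp add: poly_outside[OF P] poly_outside[OF Q])
  have sc: "smul ?X c P \<in> vecs ?X" if P: "P \<in> vecs ?X" for c P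
    unfolding poly_space_iff
  proof (intro conjI)
    obtain A where A: "multilinear_map n E F A" "\<forall>x\<in>vecs E. P x = A (replicate n x)"
      using P unfolding poly_space_iff by blast
    have "multilinear_map n E F (\<lambda>xs. smul F c (A xs))"
      using multilinear_mem[OF A(1)]
      by (intro multilinear_mapI)
         (auto simp: multilinear_add[OF A(1)] multilinear_smul[OF A(1)] F.V.scale_right_distrib mult.commute)
    then show "\<exists>A. multilinear_map n E F A \<and> (\<forall>x\<in>vecs E. smul ?X c P x = A (replicate n x))"
      using A(2) by (intro exI[of _ "\<lambda>xs. smul F c (A xs)"]) simp
    have "vnorm F (smul ?X c P x) \<le> (norm c * vnorm ?X P) * vnorm E x ^ n" if x: "x \<in> vecs E" for x
      using F.norm_smul[OF poly_mem[OF P x], of c] poly_norm_le[OF assms P x]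
      by (simp add: mult.assoc mult_left_mono)
    then show "\<exists>C\<ge>0. \<forall>x\<in>vecs E. vnorm F (smul ?X c P x) \<le> C * vnorm E x ^ n"
      using poly_norm_nonneg[OF P]
      by (intro exI[of _ "norm c * vnorm ?X P"]) simp
  qed (simp add: poly_outside[OF P])
  have le: "vnorm ?X (smul ?X c P) \<le> norm c * vnorm ?X P" if P: "P \<in> vecs ?X" for c P
  proof (rule poly_norm_leI)
    fix x assume x: "x \<in> unit_ball E"
    then have "x \<in> vecs E" by (simp add: unit_ball_def)
    then show "vnorm F (smul ?X c P x) \<le> norm c * vnorm ?X P"
      using poly_norm_ball[OF P x] by (simp add: F.norm_smul[OF poly_mem[OF P]] mult_left_mono)
  qed
  have eq: "vnorm ?X (smul ?X c P) = norm c * vnorm ?X P" if P: "P \<in> vecs ?X" for c P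
  proof (cases "c = 0")
    case True
    then show ?thesis using le[OF P, of c] poly_norm_nonneg[OF sc[OF P, of c]] by simp
  next
    case False
    then have "smul ?X (inverse c) (smul ?X c P) = P" by (simp add: fun_eq_iff)
    then have "vnorm ?X P \<le> norm (inverse c) * vnorm ?X (smul ?X c P)"
      using le[OF sc[OF P, of c], of "inverse c"] by simp
    with False have "norm c * vnorm ?X P \<le> vnorm ?X (smul ?X c P)"
      by (simp add: norm_inverse norm_divide field_simps)
    with le[OF P, of c] show ?thesis by simp
  qed
  have tri: "vnorm ?X (P + Q) \<le> vnorm ?X P + vnorm ?X Q" if P: "P \<in> vecs ?X" and Q: "Q \<in> vecs ?X" for P Q
  proof (rule poly_norm_leI)
    fix x assume x: "x \<in> unit_ball E"
    then have "x \<in> vecs E" by (simp add: unit_ball_def)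
    then show "vnorm F ((P + Q) x) \<le> vnorm ?X P + vnorm ?X Q"
      using F.norm_add_le[OF poly_mem[OF P] poly_mem[OF Q], of x x] poly_norm_ball[OF P x] poly_norm_ball[OF Q x]
      by simp
  qed
  have nz: "vnorm ?X P = 0 \<longleftrightarrow> P = 0" if P: "P \<in> vecs ?X" for P
  proof
    assume "vnorm ?X P = 0"
    have "P x = 0" for x
    proof (cases "x \<in> vecs E")
      case True
      then have "vnorm F (P x) = 0"
        using poly_norm_le[OF assms P, of x] F.norm_nonneg[OF poly_mem[OF P, of x]] \<open>vnorm ?X P = 0\<close> by simp
      then show ?thesis using F.norm_eq_0[OF poly_mem[OF P True]] by simp
    qed (rule poly_outside[OF P])
    then show "P = 0" by auto
  next
    assume "P = 0"
    then show "vnorm ?X P = 0"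
      using poly_norm_leI[of P 0 n] poly_norm_nonneg[OF P] by auto
  qed
  have "X.subspace (vecs ?X)" by (rule X.subspaceI) (use zero add sc in auto)
  then show ?thesis
    unfolding is_normed_space_def using vs nz poly_norm_nonneg eq tri by blast
qed

section \<open>The symmetric form of a polynomial\<close>

lemma symmetric_form_props:
  assumes P: "P \<in> vecs (poly_space n E F)"
  shows "multilinear_map n E F (symmetric_form n E F P)" "symmetric_map n E (symmetric_form n E F P)"
    "\<And>x. x \<in> vecs E \<Longrightarrow> P x = symmetric_form n E F P (replicate n x)"
proof -
  obtain A where A: "multilinear_map n E F A" "\<forall>x\<in>vecs E. P x = A (replicate n x)"
    using P unfolding poly_space_iff by blast
  have "\<exists>A. multilinear_map n E F A \<and> symmetric_map n E A \<and> (\<forall>x\<in>vecs E. P x = A (replicate n x))"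
    using A(2) multilinear_symmetrization[OF A(1)] symmetric_symmetrization[of n A]
    by (intro exI[of _ "symmetrization n A"]) (simp add: symmetrization_replicate)
  from someI_ex[OF this] show "multilinear_map n E F (symmetric_form n E F P)"
    "symmetric_map n E (symmetric_form n E F P)"
    "\<And>x. x \<in> vecs E \<Longrightarrow> P x = symmetric_form n E F P (replicate n x)"
    unfolding symmetric_form_def by auto
qed

lemma symmetric_form_polar:
  assumes "P \<in> vecs (poly_space n E F)" "length xs = n" "set xs \<subseteq> vecs E"
  shows "symmetric_form n E F P xs = smul F (inverse (of_nat (fact n))) (polar n P xs)"
  by (rule symmetric_multilinear_polar[OF symmetric_form_props(1,2)[OF assms(1)] _ assms(2,3)])
     (rule symmetric_form_props(3)[OF assms(1)])

lemma symmetric_form_bounded: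
  assumes "P \<in> vecs (poly_space n E F)"
  obtains K where "0 \<le> K" "\<And>xs. length xs = n \<Longrightarrow> set xs \<subseteq> vecs E \<Longrightarrow>
    vnorm F (symmetric_form n E F P xs) \<le> K * prod_list (map (vnorm E) xs)"
proof -
  obtain C where C: "C \<ge> 0" "\<And>x. x \<in> vecs E \<Longrightarrow> vnorm F (P x) \<le> C * vnorm E x ^ n"
    using assms unfolding poly_space_iff by blast
  show ?thesis
    using symmetric_multilinear_bounded[OF symmetric_form_props[OF assms] C(2,1)] that by blast
qed

text \<open>The form is chosen separately for each polynomial; that the choices fit together
  linearly follows from the polarization formula.\<close>

lemma symmetric_form_linear:
  assumes "n \<ge> 1" and P: "P \<in> vecs (poly_space n E F)" and Q: "Q \<in> vecs (poly_space n E F)"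
    and xs: "length xs = n" "set xs \<subseteq> vecs E"
  shows "symmetric_form n E F (P + Q) xs = symmetric_form n E F P xs + symmetric_form n E F Q xs"
    and "symmetric_form n E F (smul (poly_space n E F) c P) xs = smul F c (symmetric_form n E F P xs)"
proof -
  interpret X: normed_sp "poly_space n E F" by (rule normed_sp.intro[OF normed_poly_space[OF assms(1)]])
  show "symmetric_form n E F (P + Q) xs = symmetric_form n E F P xs + symmetric_form n E F Q xs"
    unfolding symmetric_form_polar[OF P xs] symmetric_form_polar[OF Q xs] symmetric_form_polar[OF X.add_mem[OF P Q] xs]
    by (simp add: polar_def F.V.scale_right_distrib sum.distrib)
  show "symmetric_form n E F (smul (poly_space n E F) c P) xs = smul F c (symmetric_form n E F P xs)"
    unfolding symmetric_form_polar[OF P xs] symmetric_form_polar[OF X.smul_mem[OF P] xs]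
    by (simp add: polar_def F.V.scale_sum_right mult.commute mult.left_commute)
qed

end

section \<open>Iterated weak-star limits of multilinear forms\<close>

text \<open>Lets scalar forms be treated as multilinear maps into a normed space.\<close>

definition scalars :: "('k::real_or_complex, 'k) nspace" where
  "scalars = \<lparr>vecs = UNIV, smul = (*), vnorm = norm\<rparr>"

lemma scalars_simps [simp]: "vecs scalars = UNIV" "smul scalars = (*)" "vnorm scalars = norm"
  by (simp_all add: scalars_def)

lemma normed_scalars: "normed_sp (scalars :: ('k::real_or_complex, 'k) nspace)"
proof
  have "vector_space ((*) :: 'k \<Rightarrow> 'k \<Rightarrow> 'k)"
    by standard (simp_all add: algebra_simps)
  moreover have "module ((*) :: 'k \<Rightarrow> 'k \<Rightarrow> 'k)"
    by standard (simp_all add: algebra_simps)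
  ultimately show "is_normed_space (scalars :: ('k, 'k) nspace)"
    unfolding is_normed_space_def by (simp add: norm_mult norm_triangle_ineq module.subspace_UNIV)
qed

lemma Lim_cong:
  assumes "eventually (\<lambda>x. f x = g x) F"
  shows "Lim F f = Lim F g"
  unfolding t2_space_class.Lim_def using tendsto_cong[OF assms] by simp

context normed_sp
begin

lemma normed_pair_scalars: "normed_pair E (scalars :: ('k, 'k) nspace)"
  using normed_sp_axioms normed_scalars by (simp add: normed_pair_def)

definition bounded_form :: "nat \<Rightarrow> real \<Rightarrow> ('v list \<Rightarrow> 'k) \<Rightarrow> bool" where
  "bounded_form n K g \<longleftrightarrow> 0 \<le> K \<and> multilinear_map n E scalars g \<and>
     (\<forall>xs. length xs = n \<and> set xs \<subseteq> vecs E \<longrightarrow> norm (g xs) \<le> K * prod_list (map (vnorm E) xs))"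

lemma bounded_formD:
  assumes "bounded_form n K g"
  shows "0 \<le> K" "multilinear_map n E scalars g"
    "length xs = n \<Longrightarrow> set xs \<subseteq> vecs E \<Longrightarrow> norm (g xs) \<le> K * prod_list (map (vnorm E) xs)"
  using assms by (auto simp: bounded_form_def)

lemma bounded_form_Cons:
  assumes g: "bounded_form (Suc n) K g" and x: "x \<in> vecs E"
  shows "bounded_form n (K * vnorm E x) (\<lambda>xs. g (x # xs))"
proof -
  interpret S: normed_pair E "scalars :: ('k, 'k) nspace" by (rule normed_pair_scalars)
  note g' = bounded_formD[OF g]
  have "multilinear_map n E scalars (\<lambda>xs. g (x # xs))"
  proof (rule S.multilinear_mapI)
    fix us vs :: "'v list" and a b c
    assume *: "Suc (length us + length vs) = n" "set us \<subseteq> vecs E" "set vs \<subseteq> vecs E" "a \<in> vecs E"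
    show "b \<in> vecs E \<Longrightarrow> g (x # us @ (a + b) # vs) = g (x # us @ a # vs) + g (x # us @ b # vs)"
      using S.multilinear_add[OF g'(2), of "x # us" vs a b] * x by simp
    show "g (x # us @ smul E c a # vs) = smul scalars c (g (x # us @ a # vs))"
      using S.multilinear_smul[OF g'(2), of "x # us" vs a c] * x by simp
  qed simp
  moreover have "norm (g (x # xs)) \<le> K * vnorm E x * prod_list (map (vnorm E) xs)"
    if "length xs = n" "set xs \<subseteq> vecs E" for xs
    using g'(3)[of "x # xs"] that x by (simp add: mult.assoc)
  ultimately show ?thesis using g'(1) x by (simp add: bounded_form_def)
qed

lemma bounded_form_append:
  "bounded_form (length us + n) K g \<Longrightarrow> set us \<subseteq> vecs E \<Longrightarrow>
    \<exists>K'. bounded_form n K' (\<lambda>xs. g (us @ xs))"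
proof (induction us arbitrary: K g)
  case (Cons u us)
  then have "bounded_form (length us + n) (K * vnorm E u) (\<lambda>xs. g (u # xs))"
    by (intro bounded_form_Cons) auto
  from Cons.IH[OF this] Cons.prems show ?case by simp
qed auto

lemma bounded_form_add:
  assumes "bounded_form n K g" "bounded_form n L h"
  shows "bounded_form n (K + L) (\<lambda>xs. g xs + h xs)"
proof -
  interpret S: normed_pair E "scalars :: ('k, 'k) nspace" by (rule normed_pair_scalars)
  note g = bounded_formD[OF assms(1)] and h = bounded_formD[OF assms(2)]
  have "multilinear_map n E scalars (\<lambda>xs. g xs + h xs)"
    by (rule S.multilinear_mapI)
       (auto simp: S.multilinear_add[OF g(2)] S.multilinear_add[OF h(2)] S.multilinear_smul[OF g(2)]
         S.multilinear_smul[OF h(2)] distrib_left)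
  moreover have "norm (g xs + h xs) \<le> (K + L) * prod_list (map (vnorm E) xs)"
    if "length xs = n" "set xs \<subseteq> vecs E" for xs
    using g(3)[OF that] h(3)[OF that] norm_triangle_ineq[of "g xs" "h xs"] by (simp add: distrib_right)
  ultimately show ?thesis using g(1) h(1) by (simp add: bounded_form_def)
qed

lemma bounded_form_smul:
  assumes "bounded_form n K g"
  shows "bounded_form n (norm c * K) (\<lambda>xs. c * g xs)"
proof -
  interpret S: normed_pair E "scalars :: ('k, 'k) nspace" by (rule normed_pair_scalars)
  note g = bounded_formD[OF assms(1)]
  have "multilinear_map n E scalars (\<lambda>xs. c * g xs)"
    by (rule S.multilinear_mapI)
       (auto simp: S.multilinear_add[OF g(2)] S.multilinear_smul[OF g(2)] distrib_left)
  moreover have "norm (c * g xs) \<le> (norm c * K) * prod_list (map (vnorm E) xs)"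
    if "length xs = n" "set xs \<subseteq> vecs E" for xs
    using g(3)[OF that] by (simp add: norm_mult mult.assoc mult_left_mono)
  ultimately show ?thesis using g(1) by (simp add: bounded_form_def)
qed

lemma iterated_limit_cong:
  "(\<And>xs. length xs = length zs \<Longrightarrow> set xs \<subseteq> vecs E \<Longrightarrow> g xs = h xs) \<Longrightarrow>
    iterated_limit E g zs = iterated_limit E h zs"
proof (induction zs arbitrary: g h)
  case (Cons z zs)
  have "eventually (\<lambda>x. iterated_limit E (\<lambda>xs. g (x # xs)) zs = iterated_limit E (\<lambda>xs. h (x # xs)) zs)
      (weak_star_to E z)"
    using eventually_weak_star_mem
  proof eventually_elim
    case (elim x)
    then show ?case by (intro Cons.IH Cons.prems) auto
  qed
  then show ?case by (simp add: Lim_cong)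
qed simp

text \<open>The functional of the first argument that remains once the limits in the others are
  taken. The value 0 off \<open>vecs E\<close> is what membership in \<open>dual_space E\<close>
  requires.\<close>

definition slice :: "('v list \<Rightarrow> 'k) \<Rightarrow> (('v \<Rightarrow> 'k) \<Rightarrow> 'k) list \<Rightarrow> 'v \<Rightarrow> 'k" where
  "slice g zs x = (if x \<in> vecs E then iterated_limit E (\<lambda>xs. g (x # xs)) zs else 0)"

text \<open>Bound, additivity and homogeneity in the form \<open>g\<close> are packaged because the
  induction needs them together: a slice is linear in its argument because the inner limit is linear
  in the form.\<close>

definition iterated_limit_linear :: "(('v \<Rightarrow> 'k) \<Rightarrow> 'k) list \<Rightarrow> bool" where
  "iterated_limit_linear zs \<longleftrightarrow> (\<forall>g K. bounded_form (length zs) K g \<longrightarrow>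
      norm (iterated_limit E g zs) \<le> K * prod_list (map (vnorm (bidual_space E)) zs) \<and>
      (\<forall>h L. bounded_form (length zs) L h \<longrightarrow>
        iterated_limit E (\<lambda>xs. g xs + h xs) zs = iterated_limit E g zs + iterated_limit E h zs) \<and>
      (\<forall>c. iterated_limit E (\<lambda>xs. c * g xs) zs = c * iterated_limit E g zs))"

lemma iterated_limit_linearD:
  assumes "iterated_limit_linear zs" "bounded_form (length zs) K g"
  shows "norm (iterated_limit E g zs) \<le> K * prod_list (map (vnorm (bidual_space E)) zs)"
    and "bounded_form (length zs) L h \<Longrightarrow>
      iterated_limit E (\<lambda>xs. g xs + h xs) zs = iterated_limit E g zs + iterated_limit E h zs"
    and "iterated_limit E (\<lambda>xs. c * g xs) zs = c * iterated_limit E g zs"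
  using assms unfolding iterated_limit_linear_def by blast+

text \<open>Once the slice is known to be a bounded functional, weak-star convergence to
  \<open>z\<close> says that its values tend to \<open>z (slice g zs)\<close>. So the outer
  \<open>Lim\<close> exists, and the iterated limit amounts to applying the bidual elements one
  after another.\<close>

lemma slice_aux:
  assumes lin: "iterated_limit_linear zs" and zs: "set zs \<subseteq> vecs (bidual_space E)"
    and g: "bounded_form (Suc (length zs)) K g" and z: "z \<in> vecs (bidual_space E)"
  shows "slice g zs \<in> vecs (dual_space E)"
    and "vnorm (dual_space E) (slice g zs) \<le> K * prod_list (map (vnorm (bidual_space E)) zs)"
    and "((\<lambda>x. iterated_limit E (\<lambda>xs. g (x # xs)) zs) \<longlongrightarrow> z (slice g zs)) (weak_star_to E z)"
    and "iterated_limit E g (z # zs) = z (slice g zs)"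
proof -
  interpret S: normed_pair E "scalars :: ('k, 'k) nspace" by (rule normed_pair_scalars)
  interpret D: normed_sp "dual_space E" by (rule normed_sp_dual) (rule normed_sp_axioms)
  interpret DD: normed_sp "bidual_space E" by (rule normed_sp_dual) (rule D.normed_sp_axioms)
  let ?p = "prod_list (map (vnorm (bidual_space E)) zs)"
  have gx: "bounded_form (length zs) (K * vnorm E x) (\<lambda>xs. g (x # xs))" if "x \<in> vecs E" for x
    by (rule bounded_form_Cons[OF g that])
  have bd: "norm (slice g zs x) \<le> K * ?p * vnorm E x" if x: "x \<in> vecs E" for x
    using iterated_limit_linearD(1)[OF lin gx[OF x]] x
    by (simp add: slice_def mult_ac)
  have p: "0 \<le> K * ?p"
  proof -
    have "0 \<le> ?p" using zs by (induction zs) (auto intro!: mult_nonneg_nonneg DD.norm_nonneg)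
    then show ?thesis using bounded_formD(1)[OF g] by simp
  qed
  show s: "slice g zs \<in> vecs (dual_space E)"
  proof (rule dual_memI[where C = "K * ?p"])
    fix x y assume xy: "x \<in> vecs E" "y \<in> vecs E"
    have "iterated_limit E (\<lambda>xs. g ((x + y) # xs)) zs = iterated_limit E (\<lambda>xs. g (x # xs) + g (y # xs)) zs"
      using S.multilinear_add[OF bounded_formD(2)[OF g], of "[]" _ x y] xy
      by (intro iterated_limit_cong) simp
    also have "\<dots> = iterated_limit E (\<lambda>xs. g (x # xs)) zs + iterated_limit E (\<lambda>xs. g (y # xs)) zs"
      by (rule iterated_limit_linearD(2)[OF lin gx[OF xy(1)] gx[OF xy(2)]])
    finally show "slice g zs (x + y) = slice g zs x + slice g zs y" using xy by (simp add: slice_def)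
  next
    fix x c assume x: "x \<in> vecs E"
    have "iterated_limit E (\<lambda>xs. g (smul E c x # xs)) zs = iterated_limit E (\<lambda>xs. c * g (x # xs)) zs"
      using S.multilinear_smul[OF bounded_formD(2)[OF g], of "[]" _ x c] x
      by (intro iterated_limit_cong) simp
    also have "\<dots> = c * iterated_limit E (\<lambda>xs. g (x # xs)) zs"
      by (rule iterated_limit_linearD(3)[OF lin gx[OF x]])
    finally show "slice g zs (smul E c x) = c * slice g zs x" using x by (simp add: slice_def)
  qed (use bd in \<open>simp_all add: slice_def\<close>)
  show "vnorm (dual_space E) (slice g zs) \<le> K * ?p"
  proof (rule dual_norm_leI)
    fix x assume "x \<in> unit_ball E"
    then have x: "x \<in> vecs E" "vnorm E x \<le> 1" by (auto simp: unit_ball_def)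
    have "norm (slice g zs x) \<le> K * ?p * vnorm E x" by (rule bd[OF x(1)])
    also have "\<dots> \<le> K * ?p * 1" using x(2) p by (rule mult_left_mono)
    finally show "norm (slice g zs x) \<le> K * ?p" by simp
  qed
  have ev: "eventually (\<lambda>x. slice g zs x = iterated_limit E (\<lambda>xs. g (x # xs)) zs) (weak_star_to E z)"
    using eventually_weak_star_mem by eventually_elim (simp add: slice_def)
  show lim: "((\<lambda>x. iterated_limit E (\<lambda>xs. g (x # xs)) zs) \<longlongrightarrow> z (slice g zs)) (weak_star_to E z)"
    using tendsto_weak_star_to[OF s] by (rule Lim_transform_eventually[OF _ ev])
  then show "iterated_limit E g (z # zs) = z (slice g zs)"
    using tendsto_Lim[OF weak_star_to_nontrivial[OF z]] by simp
qed

lemma iterated_limit_linear: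
  "set zs \<subseteq> vecs (bidual_space E) \<Longrightarrow> iterated_limit_linear zs"
proof (induction zs)
  case Nil
  show ?case
    unfolding iterated_limit_linear_def
  proof (intro allI impI conjI)
    fix g K assume "bounded_form (length ([] :: (('v \<Rightarrow> 'k) \<Rightarrow> 'k) list)) K g"
    from bounded_formD(3)[OF this, of "[]"]
    show "norm (iterated_limit E g []) \<le> K * prod_list (map (vnorm (bidual_space E)) [])" by simp
  qed simp_all
next
  case (Cons z zs)
  interpret D: normed_sp "dual_space E" by (rule normed_sp_dual) (rule normed_sp_axioms)
  have z: "z \<in> vecs (bidual_space E)" and zs: "set zs \<subseteq> vecs (bidual_space E)"
    using Cons.prems by auto
  note IH = Cons.IH[OF zs]
  note sl = slice_aux[OF IH zs _ z]
  show ?case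
    unfolding iterated_limit_linear_def
  proof (intro allI impI conjI)
    fix g K assume "bounded_form (length (z # zs)) K g"
    then have g: "bounded_form (Suc (length zs)) K g" by simp
    have "norm (z (slice g zs)) \<le> vnorm (bidual_space E) z * vnorm (dual_space E) (slice g zs)"
      by (rule D.dual_norm_le[OF z sl(1)[OF g]])
    also have "\<dots> \<le> vnorm (bidual_space E) z * (K * prod_list (map (vnorm (bidual_space E)) zs))"
      by (intro mult_left_mono sl(2)[OF g] D.dual_norm_nonneg z)
    finally show "norm (iterated_limit E g (z # zs)) \<le> K * prod_list (map (vnorm (bidual_space E)) (z # zs))"
      unfolding sl(4)[OF g] by (simp add: mult_ac)
    {
      fix h L assume "bounded_form (length (z # zs)) L h"
      then have h: "bounded_form (Suc (length zs)) L h" by simp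
      have "slice (\<lambda>xs. g xs + h xs) zs = slice g zs + slice h zs"
      proof
        fix x show "slice (\<lambda>xs. g xs + h xs) zs x = (slice g zs + slice h zs) x"
          using iterated_limit_linearD(2)[OF IH bounded_form_Cons[OF g] bounded_form_Cons[OF h], of x x]
          by (simp add: slice_def)
      qed
      then show "iterated_limit E (\<lambda>xs. g xs + h xs) (z # zs) = iterated_limit E g (z # zs) + iterated_limit E h (z # zs)"
        unfolding sl(4)[OF g] sl(4)[OF h] sl(4)[OF bounded_form_add[OF g h]]
        by (simp add: D.dual_add[OF z sl(1)[OF g] sl(1)[OF h]])
    }
    fix c
    have "slice (\<lambda>xs. c * g xs) zs = smul (dual_space E) c (slice g zs)"
    proof
      fix x show "slice (\<lambda>xs. c * g xs) zs x = smul (dual_space E) c (slice g zs) x"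
        using iterated_limit_linearD(3)[OF IH bounded_form_Cons[OF g], of x] by (simp add: slice_def)
    qed
    then show "iterated_limit E (\<lambda>xs. c * g xs) (z # zs) = c * iterated_limit E g (z # zs)"
      unfolding sl(4)[OF g] sl(4)[OF bounded_form_smul[OF g]]
      by (simp only: D.dual_smul[OF z sl(1)[OF g]])
  qed
qed

lemmas slice_props = slice_aux[OF iterated_limit_linear]
lemmas iterated_limit_norm_le = iterated_limit_linearD(1)[OF iterated_limit_linear]
lemmas iterated_limit_add = iterated_limit_linearD(2)[OF iterated_limit_linear]
lemmas iterated_limit_smul = iterated_limit_linearD(3)[OF iterated_limit_linear]

text \<open>In the outermost slot the limit is \<open>z (slice g vs)\<close>, linear in
  \<open>z\<close> because vector operations in the bidual are pointwise. Deeper slots reduce to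
  this one by passing to slices.\<close>

lemma iterated_limit_slot:
  assumes "set us \<subseteq> vecs (bidual_space E)" "set vs \<subseteq> vecs (bidual_space E)"
    "z \<in> vecs (bidual_space E)" "w \<in> vecs (bidual_space E)"
    "bounded_form (Suc (length us + length vs)) K g"
  shows "iterated_limit E g (us @ (z + w) # vs) = iterated_limit E g (us @ z # vs) + iterated_limit E g (us @ w # vs)"
    and "iterated_limit E g (us @ smul (bidual_space E) c z # vs) = c * iterated_limit E g (us @ z # vs)"
proof -
  interpret D: normed_sp "dual_space E" by (rule normed_sp_dual) (rule normed_sp_axioms)
  interpret DD: normed_sp "bidual_space E" by (rule normed_sp_dual) (rule D.normed_sp_axioms)
  have zw: "z + w \<in> vecs (bidual_space E)" "smul (bidual_space E) c z \<in> vecs (bidual_space E)"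
    using DD.add_mem DD.smul_mem assms(3,4) by blast+
  have "iterated_limit E g (us @ (z + w) # vs) = iterated_limit E g (us @ z # vs) + iterated_limit E g (us @ w # vs)
    \<and> iterated_limit E g (us @ smul (bidual_space E) c z # vs) = c * iterated_limit E g (us @ z # vs)"
    using assms(1,5)
  proof (induction us arbitrary: g K)
    case Nil
    then have g: "bounded_form (Suc (length vs)) K g" by simp
    note sl = slice_props[OF assms(2) assms(2) g]
    show ?case
      unfolding append_Nil sl(4)[OF zw(1)] sl(4)[OF zw(2)] sl(4)[OF assms(3)] sl(4)[OF assms(4)] by simp
  next
    case (Cons u us)
    have u: "u \<in> vecs (bidual_space E)" and us: "set us \<subseteq> vecs (bidual_space E)"
      using Cons.prems by auto
    have g: "bounded_form (Suc (length (us @ y # vs))) K g" for y using Cons.prems by simp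
    have sub: "set (us @ y # vs) \<subseteq> vecs (bidual_space E)" if "y \<in> vecs (bidual_space E)" for y
      using us assms(2) that by simp
    note sl = slice_props[OF sub sub g u]
    have IH: "iterated_limit E (\<lambda>xs. g (x # xs)) (us @ (z + w) # vs)
        = iterated_limit E (\<lambda>xs. g (x # xs)) (us @ z # vs) + iterated_limit E (\<lambda>xs. g (x # xs)) (us @ w # vs)
      \<and> iterated_limit E (\<lambda>xs. g (x # xs)) (us @ smul (bidual_space E) c z # vs)
        = c * iterated_limit E (\<lambda>xs. g (x # xs)) (us @ z # vs)" if "x \<in> vecs E" for x
    proof (rule Cons.IH[OF us])
      have "bounded_form (Suc (Suc (length us + length vs))) K g" using Cons.prems by simp
      then show "bounded_form (Suc (length us + length vs)) (K * vnorm E x) (\<lambda>xs. g (x # xs))"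
        by (rule bounded_form_Cons[OF _ that])
    qed
    have 1: "slice g (us @ (z + w) # vs) = slice g (us @ z # vs) + slice g (us @ w # vs)"
    proof
      show "slice g (us @ (z + w) # vs) x = (slice g (us @ z # vs) + slice g (us @ w # vs)) x" for x
        using IH[of x] by (simp add: slice_def)
    qed
    have 2: "slice g (us @ smul (bidual_space E) c z # vs) = smul (dual_space E) c (slice g (us @ z # vs))"
    proof
      show "slice g (us @ smul (bidual_space E) c z # vs) x = smul (dual_space E) c (slice g (us @ z # vs)) x" for x
        using IH[of x] by (simp add: slice_def)
    qed
    show ?case
      unfolding append_Cons sl(4)[OF zw(1) zw(1)] sl(4)[OF zw(2) zw(2)] sl(4)[OF assms(3) assms(3)] sl(4)[OF assms(4) assms(4)] 1 2
      using D.dual_add[OF u sl(1)[OF assms(3) assms(3)] sl(1)[OF assms(4) assms(4)]]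
        D.dual_smul[OF u sl(1)[OF assms(3) assms(3)]] by blast
  qed
  then show "iterated_limit E g (us @ (z + w) # vs) = iterated_limit E g (us @ z # vs) + iterated_limit E g (us @ w # vs)"
    and "iterated_limit E g (us @ smul (bidual_space E) c z # vs) = c * iterated_limit E g (us @ z # vs)"
    by blast+
qed

end

section \<open>The Davie--Gamelin theorem\<close>

text \<open>There are N (N - 1) ... (N - n + 1) \<ge> (N - n) ^ n lists without repetition, and
  Bernoulli's inequality bounds (1 - n / N) ^ n below by 1 - n ^ 2 / N.\<close>

lemma card_nondistinct_lists_le:
  assumes "N \<ge> n" "N \<ge> 1"
  shows "real (card {fs. set fs \<subseteq> {..<N} \<and> length fs = n \<and> \<not> distinct fs}) \<le> real (n\<^sup>2) / real N * real N ^ n"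
proof -
  let ?L = "{fs :: nat list. set fs \<subseteq> {..<N} \<and> length fs = n}"
  let ?D = "{fs :: nat list. length fs = n \<and> distinct fs \<and> set fs \<subseteq> {..<N}}"
  have finL: "finite ?L" and cardL: "card ?L = N ^ n"
    by (rule finite_lists_length_eq, simp) (subst card_lists_length_eq, simp_all)
  have "{fs. set fs \<subseteq> {..<N} \<and> length fs = n \<and> \<not> distinct fs} = ?L - ?D" by auto
  moreover have "?D \<subseteq> ?L" by auto
  ultimately have c: "real (card {fs. set fs \<subseteq> {..<N} \<and> length fs = n \<and> \<not> distinct fs}) = real N ^ n - real (card ?D)"
    using finL by (simp add: card_Diff_subset finite_subset cardL of_nat_diff card_mono flip: cardL of_nat_power)
  have "(1 - real n / real N) ^ n * real N ^ n \<le> real (card ?D)"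
  proof -
    have "card ?D = \<Prod>{N - n + 1..N}"
      using card_lists_distinct_length_eq[of "{..<N}" n] assms by simp
    moreover have "(\<Prod>i\<in>{N - n + 1..N}. real (N - n)) \<le> (\<Prod>i\<in>{N - n + 1..N}. real i)"
      by (rule prod_mono) auto
    ultimately have "real (N - n) ^ n \<le> real (card ?D)"
      using assms by simp
    moreover have "(1 - real n / real N) ^ n * real N ^ n = real (N - n) ^ n"
      using assms by (simp add: power_mult_distrib[symmetric] left_diff_distrib of_nat_diff)
    ultimately show ?thesis by simp
  qed
  moreover have "1 + real n * (- (real n / real N)) \<le> (1 + - (real n / real N)) ^ n"
    using assms by (intro Bernoulli_inequality) simp
  then have "(1 - real (n\<^sup>2) / real N) * real N ^ n \<le> (1 - real n / real N) ^ n * real N ^ n"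
    by (intro mult_right_mono) (simp_all add: power2_eq_square)
  ultimately show ?thesis unfolding c by (simp add: left_diff_distrib)
qed

context normed_sp
begin

text \<open>Interpolates between the iterated limit, at the empty list, and \<open>g\<close> itself,
  at lists of length \<open>n\<close>.\<close>

definition partial_limit :: "nat \<Rightarrow> ('v list \<Rightarrow> 'k) \<Rightarrow> (('v \<Rightarrow> 'k) \<Rightarrow> 'k) \<Rightarrow> 'v list \<Rightarrow> 'k" where
  "partial_limit n g z us = iterated_limit E (\<lambda>xs. g (us @ xs)) (replicate (n - length us) z)"

lemma tendsto_partial_limit:
  assumes g: "bounded_form n K g" and z: "z \<in> vecs (bidual_space E)"
    and us: "set us \<subseteq> vecs E" "length us < n"
  shows "((\<lambda>y. partial_limit n g z (us @ [y])) \<longlongrightarrow> partial_limit n g z us) (weak_star_to E z)"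
proof -
  define m where "m = n - Suc (length us)"
  have n: "n = length us + Suc m" using us by (simp add: m_def)
  have "bounded_form (length us + Suc m) K g" using g n by simp
  then obtain K' where "bounded_form (Suc m) K' (\<lambda>xs. g (us @ xs))"
    using bounded_form_append us(1) by blast
  then have g': "bounded_form (Suc (length (replicate m z))) K' (\<lambda>xs. g (us @ xs))" by simp
  have sub: "set (replicate m z) \<subseteq> vecs (bidual_space E)" using z by auto
  have "((\<lambda>x. iterated_limit E (\<lambda>xs. g (us @ x # xs)) (replicate m z))
      \<longlongrightarrow> iterated_limit E (\<lambda>xs. g (us @ xs)) (z # replicate m z)) (weak_star_to E z)"
    unfolding slice_props(4)[OF sub sub g' z] by (rule slice_props(3)[OF sub sub g' z])
  moreover have "n - length us = Suc m" "\<And>y. n - length (us @ [y]) = m" using n by simp_all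
  ultimately show ?thesis by (simp add: partial_limit_def)
qed

text \<open>Vectors are chosen one after another. As \<open>y\<close> tends to \<open>z\<close>,
  \<open>partial_limit\<close> at \<open>us @ [y]\<close> tends to its value at \<open>us\<close>,
  so a new vector can serve all of the finitely many lists of earlier ones, with error \<delta> per
  entry. Only increasing index lists are controlled: a vector must be chosen after those that
  precede it in the list.\<close>

lemma weak_star_selection:
  fixes N :: nat
  assumes g: "bounded_form n K g" and z: "z \<in> vecs (bidual_space E)" "vnorm (bidual_space E) z \<le> 1"
    and \<Phi>: "finite \<Phi>" "\<Phi> \<subseteq> vecs (dual_space E)" and "\<epsilon> > 0" "\<delta> > 0"
  shows "\<exists>x. (\<forall>i<N. x i \<in> unit_ball E \<and> (\<forall>\<phi>\<in>\<Phi>. norm (\<phi> (x i) - z \<phi>) < \<epsilon>)) \<and>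
    (\<forall>js. sorted_wrt (<) js \<and> set js \<subseteq> {..<N} \<and> length js \<le> n \<longrightarrow>
      norm (partial_limit n g z (map x js) - partial_limit n g z []) \<le> real (length js) * \<delta>)"
proof (induction N)
  case 0
  show ?case by auto
next
  case (Suc N)
  then obtain x where x: "\<And>i. i < N \<Longrightarrow> x i \<in> unit_ball E \<and> (\<forall>\<phi>\<in>\<Phi>. norm (\<phi> (x i) - z \<phi>) < \<epsilon>)"
    and xj: "\<And>js. sorted_wrt (<) js \<Longrightarrow> set js \<subseteq> {..<N} \<Longrightarrow> length js \<le> n \<Longrightarrow>
      norm (partial_limit n g z (map x js) - partial_limit n g z []) \<le> real (length js) * \<delta>"
    by blast
  let ?J = "{js. set js \<subseteq> {..<N} \<and> length js \<le> n}"
  let ?C = "\<lambda>y. \<forall>js\<in>?J. length js < n \<longrightarrow>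
      norm (partial_limit n g z (map x js @ [y]) - partial_limit n g z (map x js)) < \<delta>"
  have "eventually ?C (weak_star_to E z)"
  proof (rule eventually_ball_finite)
    show "finite ?J" by (rule finite_lists_length_le) simp
    show "\<forall>js\<in>?J. eventually (\<lambda>y. length js < n \<longrightarrow>
      norm (partial_limit n g z (map x js @ [y]) - partial_limit n g z (map x js)) < \<delta>) (weak_star_to E z)"
    proof
      fix js assume "js \<in> ?J"
      then have "set (map x js) \<subseteq> vecs E" using x by (auto simp: unit_ball_def)
      then show "eventually (\<lambda>y. length js < n \<longrightarrow>
        norm (partial_limit n g z (map x js @ [y]) - partial_limit n g z (map x js)) < \<delta>) (weak_star_to E z)"
        using tendstoD[OF tendsto_partial_limit[OF g z(1), of "map x js"] \<open>\<delta> > 0\<close>]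
        by (cases "length js < n") (simp_all add: dist_norm)
    qed
  qed
  moreover have "eventually (\<lambda>y. \<forall>\<phi>\<in>\<Phi>. norm (\<phi> y - z \<phi>) < \<epsilon>) (weak_star_to E z)"
    unfolding eventually_weak_star_to using \<Phi> \<open>\<epsilon> > 0\<close> by blast
  ultimately have "eventually (\<lambda>y. ?C y \<and> (\<forall>\<phi>\<in>\<Phi>. norm (\<phi> y - z \<phi>) < \<epsilon>)) (weak_star_to E z)"
    by (rule eventually_conj)
  then have "eventually (\<lambda>y. ?C y \<and> (\<forall>\<phi>\<in>\<Phi>. norm (\<phi> y - z \<phi>) < \<epsilon>))
      (inf (weak_star_to E z) (principal {x \<in> vecs E. vnorm E x \<le> 1}))"
    by (rule filter_leD[OF inf_le1])
  moreover have "eventually (\<lambda>y. y \<in> unit_ball E)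
      (inf (weak_star_to E z) (principal {x \<in> vecs E. vnorm E x \<le> 1}))"
    unfolding unit_ball_def by (rule filter_leD[OF inf_le2]) (simp add: eventually_principal)
  ultimately have "eventually (\<lambda>y. (?C y \<and> (\<forall>\<phi>\<in>\<Phi>. norm (\<phi> y - z \<phi>) < \<epsilon>)) \<and> y \<in> unit_ball E)
      (inf (weak_star_to E z) (principal {x \<in> vecs E. vnorm E x \<le> 1}))"
    by (rule eventually_conj)
  from eventually_happens'[OF weak_star_to_ball_nontrivial[OF zero_less_one z] this]
  obtain y where y: "?C y" "\<forall>\<phi>\<in>\<Phi>. norm (\<phi> y - z \<phi>) < \<epsilon>" "y \<in> unit_ball E" by blast
  define x' where "x' = x(N := y)"
  have same: "map x' js = map x js" if "set js \<subseteq> {..<N}" for js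
    using that by (auto simp: x'_def)
  have "norm (partial_limit n g z (map x' js) - partial_limit n g z []) \<le> real (length js) * \<delta>"
    if js: "sorted_wrt (<) js" "set js \<subseteq> {..<Suc N}" "length js \<le> n" for js
  proof (cases "N \<in> set js")
    case False
    then have "set js \<subseteq> {..<N}" using js(2) by (auto simp: less_Suc_eq)
    then show ?thesis using xj[of js] js by (simp add: same)
  next
    case True
    then obtain as bs where ab: "js = as @ N # bs" by (meson split_list)
    \<comment> \<open>\<open>N\<close> is the largest index and \<open>js\<close> increases, so
      \<open>N\<close> can only be the last entry.\<close>
    have "bs = []"
    proof (rule ccontr)
      assume "bs \<noteq> []"
      then obtain b where "b \<in> set bs" by (meson last_in_set)
      then have "N < b" "b < Suc N" using js(1,2) by (auto simp: ab sorted_wrt_append)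
      then show False by simp
    qed
    have as: "set as \<subseteq> {..<N}" "sorted_wrt (<) as"
      using js(1) by (auto simp: ab sorted_wrt_append)
    have len: "length as < n" using js(3) by (simp add: ab)
    have map: "map x' js = map x as @ [y]" using same[OF as(1)] by (simp add: ab \<open>bs = []\<close> x'_def)
    have "norm (partial_limit n g z (map x as @ [y]) - partial_limit n g z (map x as)) < \<delta>"
      using y(1) as(1) len by simp
    moreover have "norm (partial_limit n g z (map x as) - partial_limit n g z []) \<le> real (length as) * \<delta>"
      using xj[OF as(2,1)] len by simp
    ultimately have "norm (partial_limit n g z (map x as @ [y]) - partial_limit n g z []) \<le> \<delta> + real (length as) * \<delta>"
      using norm_triangle_ineq[of "partial_limit n g z (map x as @ [y]) - partial_limit n g z (map x as)"
        "partial_limit n g z (map x as) - partial_limit n g z []"] by simp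
    then show ?thesis unfolding map by (simp add: ab \<open>bs = []\<close> distrib_right)
  qed
  moreover have "x' i \<in> unit_ball E \<and> (\<forall>\<phi>\<in>\<Phi>. norm (\<phi> (x' i) - z \<phi>) < \<epsilon>)" if "i < Suc N" for i
    using that x[of i] y by (cases "i = N") (auto simp: x'_def)
  ultimately show ?case by (intro exI[of _ x']) blast
qed

text \<open>Averaging \<open>N\<close> vectors chosen along the iterated limit gives a vector \<open>u\<close> of the unit ball whose
  value \<open>g(u, \<dots>, u)\<close> is an average over \<open>N\<^sup>n\<close> index lists; by symmetry the lists without
  repetitions contribute nearly the iterated limit, and the others are negligible.\<close>

theorem Davie_Gamelin:
  assumes g: "bounded_form n K g" and sym: "symmetric_map n E g"
    and z: "z \<in> vecs (bidual_space E)" "vnorm (bidual_space E) z \<le> 1"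
    and \<Phi>: "finite \<Phi>" "\<Phi> \<subseteq> vecs (dual_space E)" and "\<epsilon> > 0"
  obtains u where "u \<in> unit_ball E" "\<And>\<phi>. \<phi> \<in> \<Phi> \<Longrightarrow> norm (\<phi> u - z \<phi>) < \<epsilon>"
    "norm (g (replicate n u) - iterated_limit E g (replicate n z)) < \<epsilon>"
proof -
  interpret S: normed_pair E "scalars :: ('k, 'k) nspace" by (rule normed_pair_scalars)
  interpret D: normed_sp "dual_space E" by (rule normed_sp_dual) (rule normed_sp_axioms)
  note gD = bounded_formD[OF g]
  define b where "b = iterated_limit E g (replicate n z)"
  \<comment> \<open>Chosen so that n steps of \<delta> cost at most \<epsilon> / 4.\<close>
  define \<delta> where "\<delta> = \<epsilon> / (4 * (real n + 1))"
  have "\<delta> > 0" and n\<delta>: "real n * \<delta> \<le> \<epsilon> / 4"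
    using \<open>\<epsilon> > 0\<close> by (auto simp: \<delta>_def field_simps)
  have bK: "norm b \<le> K"
  proof -
    have sub: "set (replicate n z) \<subseteq> vecs (bidual_space E)" using z by auto
    have "norm b \<le> K * vnorm (bidual_space E) z ^ n"
      unfolding b_def using iterated_limit_norm_le[OF sub, of K g] g by simp
    also have "\<dots> \<le> K * 1"
      using z gD(1) D.dual_norm_nonneg by (intro mult_left_mono power_le_one) auto
    finally show ?thesis by simp
  qed
  \<comment> \<open>Index lists with repetitions form a fraction of at most n ^ 2 / N, each with
    error up to 2 * K beyond \<epsilon> / 4; this size of \<open>N\<close> keeps their share below
    \<epsilon> / 4.\<close>
  obtain N0 :: nat where N0: "8 * K * real (n\<^sup>2) / \<epsilon> < real N0" using reals_Archimedean2 by blast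
  define N where "N = N0 + n + 1"
  have N: "N \<ge> n" "N \<ge> 1" by (auto simp: N_def)
  have "8 * K * real (n\<^sup>2) / \<epsilon> < real N" using N0 by (simp add: N_def)
  then have small: "2 * K * (real (n\<^sup>2) / real N) < \<epsilon> / 4"
    using N(2) \<open>\<epsilon> > 0\<close> by (simp add: field_simps)
  obtain x where x: "\<And>i. i < N \<Longrightarrow> x i \<in> unit_ball E" "\<And>i \<phi>. i < N \<Longrightarrow> \<phi> \<in> \<Phi> \<Longrightarrow> norm (\<phi> (x i) - z \<phi>) < \<epsilon>"
    and xj: "\<And>js. sorted_wrt (<) js \<Longrightarrow> set js \<subseteq> {..<N} \<Longrightarrow> length js \<le> n \<Longrightarrow>
      norm (partial_limit n g z (map x js) - partial_limit n g z []) \<le> real (length js) * \<delta>"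
    using weak_star_selection[OF g z \<Phi> \<open>\<epsilon> > 0\<close> \<open>\<delta> > 0\<close>, of N] by blast
  have xE: "x i \<in> vecs E" "vnorm E (x i) \<le> 1" if "i < N" for i using x(1)[OF that] by (auto simp: unit_ball_def)
  define s where "s = (\<Sum>i<N. x i)"
  have sE: "s \<in> vecs E" unfolding s_def using xE by (intro sum_mem) auto
  define u where "u = smul E (of_real (1 / real N)) s"
  have u: "u \<in> vecs E" using sE by (simp add: u_def)
  show ?thesis
  proof (rule that[of u])
    have "vnorm E s \<le> (\<Sum>i<N. vnorm E (x i))" unfolding s_def using xE by (intro norm_sum_le) auto
    also have "\<dots> \<le> (\<Sum>i<N. 1)" using xE by (intro sum_mono) auto
    finally have "vnorm E s \<le> real N" by simp
    then show "u \<in> unit_ball E"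
      using N(2) u sE by (simp add: unit_ball_def u_def norm_smul norm_divide)
  next
    fix \<phi> assume \<phi>: "\<phi> \<in> \<Phi>"
    then have \<phi>D: "\<phi> \<in> vecs (dual_space E)" using \<Phi> by blast
    have "\<phi> s = (\<Sum>i<N. \<phi> (x i))" unfolding s_def using xE by (intro dual_sum \<phi>D) auto
    then have "\<phi> u - z \<phi> = of_real (1 / real N) * (\<Sum>i<N. \<phi> (x i) - z \<phi>)"
      using N(2) sE by (simp add: u_def dual_smul[OF \<phi>D] sum_subtractf field_simps)
    then have "norm (\<phi> u - z \<phi>) = 1 / real N * norm (\<Sum>i<N. \<phi> (x i) - z \<phi>)"
      by (simp add: norm_mult norm_divide)
    also have "\<dots> \<le> 1 / real N * (\<Sum>i<N. norm (\<phi> (x i) - z \<phi>))"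
      by (intro mult_left_mono norm_sum) simp
    also have "\<dots> < 1 / real N * (\<Sum>i<N. \<epsilon>)"
      using N(2) x(2) \<phi> by (intro mult_strict_left_mono sum_strict_mono) (auto simp: lessThan_empty_iff)
    finally show "norm (\<phi> u - z \<phi>) < \<epsilon>" using N(2) by simp
  next
    let ?L = "{fs. set fs \<subseteq> {..<N} \<and> length fs = n}"
    let ?D = "{fs. set fs \<subseteq> {..<N} \<and> length fs = n \<and> \<not> distinct fs}"
    have finL: "finite ?L" and cardL: "card ?L = N ^ n"
      by (rule finite_lists_length_eq, simp) (subst card_lists_length_eq, simp_all)
    have "g (replicate n u) = of_real (1 / real N) ^ n * g (replicate n s)"
      using S.multilinear_replicate_smul[OF gD(2) sE, of "[]" n] by (simp add: u_def)
    also have "g (replicate n s) = (\<Sum>fs\<in>?L. g (map x fs))"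
      using S.multilinear_expand[OF gD(2), of "{..<N}" x "[]" n] xE by (simp add: s_def)
    finally have eq: "g (replicate n u) - b = of_real (1 / real N) ^ n * (\<Sum>fs\<in>?L. g (map x fs) - b)"
      using N(2) by (simp add: sum_subtractf cardL right_diff_distrib power_one_over)
    have bound: "norm (g (map x fs) - b) \<le> \<epsilon> / 4 + (if distinct fs then 0 else 2 * K)" if fs: "fs \<in> ?L" for fs
    proof (cases "distinct fs")
      case True
      \<comment> \<open>\<open>weak_star_selection\<close> covers increasing lists only; symmetry of
        \<open>g\<close> permits sorting a list without repetitions.\<close>
      define js where "js = sort fs"
      have js: "sorted_wrt (<) js" "set js \<subseteq> {..<N}" "length js = n"
        using True fs by (auto simp: js_def strict_sorted_iff)
      have sub: "set (map x fs) \<subseteq> vecs E" "length (map x fs) = n" using fs xE by auto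
      have "mset (map x fs) = mset (map x js)" by (simp add: js_def)
      then have "g (map x fs) = g (map x js)" using sym sub unfolding symmetric_map_def by blast
      moreover have "partial_limit n g z (map x js) = g (map x js)" "partial_limit n g z [] = b"
        using js(3) by (simp_all add: partial_limit_def b_def)
      ultimately have "norm (g (map x fs) - b) \<le> real n * \<delta>" using xj[OF js(1,2)] js(3) by simp
      then show ?thesis using True n\<delta> by simp
    next
      case False
      have sub: "set (map x fs) \<subseteq> vecs E" "length (map x fs) = n" using fs xE by auto
      have "prod_list (map (vnorm E) (map x fs)) \<le> 1 ^ length (map x fs)"
        using fs xE by (intro S.prod_list_norm_le(1) sub) auto
      then have "K * prod_list (map (vnorm E) (map x fs)) \<le> K * 1" using gD(1) by (intro mult_left_mono) auto
      then have "norm (g (map x fs)) \<le> K" using gD(3)[OF sub(2,1)] by simp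
      then show ?thesis using False bK norm_triangle_ineq4[of "g (map x fs)" b] \<open>\<epsilon> > 0\<close> by simp
    qed
    have "norm (g (replicate n u) - b) = (1 / real N) ^ n * norm (\<Sum>fs\<in>?L. g (map x fs) - b)"
      unfolding eq by (simp add: norm_mult norm_power norm_divide)
    also have "\<dots> \<le> (1 / real N) ^ n * (\<Sum>fs\<in>?L. \<epsilon> / 4 + (if distinct fs then 0 else 2 * K))"
      using bound by (intro mult_left_mono order_trans[OF norm_sum] sum_mono) auto
    also have "(\<Sum>fs\<in>?L. \<epsilon> / 4 + (if distinct fs then 0 else 2 * K)) = real N ^ n * (\<epsilon> / 4) + real (card ?D) * (2 * K)"
    proof -
      have "(\<Sum>fs\<in>?L. if distinct fs then 0 else 2 * K) = (\<Sum>fs\<in>?D. 2 * K)"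
        by (rule sum.mono_neutral_cong_right[OF finL]) auto
      then show ?thesis by (simp add: sum.distrib cardL)
    qed
    also have "(1 / real N) ^ n * \<dots> \<le> (1 / real N) ^ n * (real N ^ n * (\<epsilon> / 4) + (real (n\<^sup>2) / real N * real N ^ n) * (2 * K))"
      using card_nondistinct_lists_le[OF N] gD(1) by (intro mult_left_mono add_left_mono mult_right_mono) auto
    also have "\<dots> = \<epsilon> / 4 + 2 * K * (real (n\<^sup>2) / real N)"
    proof -
      have "(1 / real N) ^ n * real N ^ n = 1" using N(2) by (simp flip: power_mult_distrib)
      then have "(1 / real N) ^ n * (real N ^ n * c) = c" for c by (simp only: mult.assoc[symmetric] mult_1)
      from this[of "\<epsilon> / 4"] this[of "real (n\<^sup>2) / real N * (2 * K)"] show ?thesis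
        by (simp only: distrib_left mult.commute mult.left_commute)
    qed
    also have "\<dots> < \<epsilon>" using small \<open>\<epsilon> > 0\<close> by simp
    finally show "norm (g (replicate n u) - iterated_limit E g (replicate n z)) < \<epsilon>" by (simp add: b_def)
  qed
qed

end

section \<open>The Aron--Berner extension\<close>

context normed_pair
begin

section \<open>Extension of vector-valued maps to the biduals\<close>

lemma dual_comp_bounded_form:
  assumes A: "multilinear_map n E F A" "0 \<le> K"
    and K: "\<And>xs. length xs = n \<Longrightarrow> set xs \<subseteq> vecs E \<Longrightarrow> vnorm F (A xs) \<le> K * prod_list (map (vnorm E) xs)"
    and \<psi>: "\<psi> \<in> vecs (dual_space F)"
  shows "E.bounded_form n (vnorm (dual_space F) \<psi> * K) (\<lambda>xs. \<psi> (A xs))"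
proof -
  interpret S: normed_pair E "scalars :: ('k, 'k) nspace" by (rule E.normed_pair_scalars)
  have "multilinear_map n E scalars (\<lambda>xs. \<psi> (A xs))"
  proof (rule S.multilinear_mapI)
    fix us vs x y
    assume *: "Suc (length us + length vs) = n" "set us \<subseteq> vecs E" "set vs \<subseteq> vecs E" "x \<in> vecs E" "y \<in> vecs E"
    then have "A (us @ x # vs) \<in> vecs F" "A (us @ y # vs) \<in> vecs F" by (auto intro!: multilinear_mem[OF A(1)])
    then show "\<psi> (A (us @ (x + y) # vs)) = \<psi> (A (us @ x # vs)) + \<psi> (A (us @ y # vs))"
      using * by (simp add: multilinear_add[OF A(1)] F.dual_add[OF \<psi>])
  next
    fix us vs x c
    assume *: "Suc (length us + length vs) = n" "set us \<subseteq> vecs E" "set vs \<subseteq> vecs E" "x \<in> vecs E"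
    then have "A (us @ x # vs) \<in> vecs F" by (auto intro!: multilinear_mem[OF A(1)])
    then show "\<psi> (A (us @ smul E c x # vs)) = smul scalars c (\<psi> (A (us @ x # vs)))"
      using * by (simp add: multilinear_smul[OF A(1)] F.dual_smul[OF \<psi>])
  qed simp
  moreover have "norm (\<psi> (A xs)) \<le> vnorm (dual_space F) \<psi> * K * prod_list (map (vnorm E) xs)"
    if "length xs = n" "set xs \<subseteq> vecs E" for xs
  proof -
    have "norm (\<psi> (A xs)) \<le> vnorm (dual_space F) \<psi> * vnorm F (A xs)"
      by (rule F.dual_norm_le[OF \<psi> multilinear_mem[OF A(1) that]])
    also have "\<dots> \<le> vnorm (dual_space F) \<psi> * (K * prod_list (map (vnorm E) xs))"
      by (intro mult_left_mono K that F.dual_norm_nonneg \<psi>)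
    finally show ?thesis by (simp add: mult.assoc)
  qed
  ultimately show ?thesis
    using A(2) F.dual_norm_nonneg[OF \<psi>] by (simp add: E.bounded_form_def)
qed

lemma normed_pair_bidual: "normed_pair (bidual_space E) (bidual_space F)"
  by (simp add: normed_pair_def normed_sp_dual E.normed_sp_axioms F.normed_sp_axioms)

definition bidual_extension :: "('e list \<Rightarrow> 'f) \<Rightarrow> (('e \<Rightarrow> 'k) \<Rightarrow> 'k) list \<Rightarrow> ('f \<Rightarrow> 'k) \<Rightarrow> 'k" where
  "bidual_extension A zs \<psi> =
     (if \<psi> \<in> vecs (dual_space F) then iterated_limit E (\<lambda>xs. \<psi> (A xs)) zs else 0)"

lemma bidual_extension:
  assumes A: "multilinear_map n E F A" "0 \<le> K"
    and K: "\<And>xs. length xs = n \<Longrightarrow> set xs \<subseteq> vecs E \<Longrightarrow> vnorm F (A xs) \<le> K * prod_list (map (vnorm E) xs)"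
    and zs: "length zs = n" "set zs \<subseteq> vecs (bidual_space E)"
  shows "bidual_extension A zs \<in> vecs (bidual_space F)"
    and "vnorm (bidual_space F) (bidual_extension A zs) \<le> K * prod_list (map (vnorm (bidual_space E)) zs)"
proof -
  interpret B: normed_pair "bidual_space E" "bidual_space F" by (rule normed_pair_bidual)
  interpret D: normed_sp "dual_space F" by (rule normed_sp_dual) (rule F.normed_sp_axioms)
  let ?p = "prod_list (map (vnorm (bidual_space E)) zs)"
  have bf: "E.bounded_form (length zs) (vnorm (dual_space F) \<psi> * K) (\<lambda>xs. \<psi> (A xs))"
    if "\<psi> \<in> vecs (dual_space F)" for \<psi>
    unfolding zs(1) by (rule dual_comp_bounded_form[OF A K that])
  have le: "norm (bidual_extension A zs \<psi>) \<le> K * ?p * vnorm (dual_space F) \<psi>"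
    if "\<psi> \<in> vecs (dual_space F)" for \<psi>
    using E.iterated_limit_norm_le[OF zs(2) bf[OF that]] that
    by (simp add: bidual_extension_def mult_ac)
  \<comment> \<open>Only nonnegativity of the product is wanted; the maximum is merely some bound on
    the norms of the entries.\<close>
  have "0 \<le> ?p" by (rule B.prod_list_norm_le(2)[OF zs(2), of "Max (vnorm (bidual_space E) ` set zs)"]) simp
  show "bidual_extension A zs \<in> vecs (bidual_space F)"
  proof (rule D.dual_memI[where C = "K * ?p"])
    fix \<psi> \<psi>' assume *: "\<psi> \<in> vecs (dual_space F)" "\<psi>' \<in> vecs (dual_space F)"
    show "bidual_extension A zs (\<psi> + \<psi>') = bidual_extension A zs \<psi> + bidual_extension A zs \<psi>'"
      using E.iterated_limit_add[OF zs(2) bf[OF *(1)] bf[OF *(2)]] *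
      by (simp add: bidual_extension_def)
  next
    fix \<psi> c assume *: "\<psi> \<in> vecs (dual_space F)"
    then show "bidual_extension A zs (smul (dual_space F) c \<psi>) = c * bidual_extension A zs \<psi>"
      using E.iterated_limit_smul[OF zs(2) bf[OF *], of c] D.smul_mem[OF *, of c]
      by (simp add: bidual_extension_def)
  qed (use le in \<open>auto simp: bidual_extension_def\<close>)
  show "vnorm (bidual_space F) (bidual_extension A zs) \<le> K * ?p"
  proof (rule D.dual_norm_leI)
    fix \<psi> assume "\<psi> \<in> unit_ball (dual_space F)"
    then have *: "\<psi> \<in> vecs (dual_space F)" "vnorm (dual_space F) \<psi> \<le> 1" by (auto simp: unit_ball_def)
    have "norm (bidual_extension A zs \<psi>) \<le> K * ?p * vnorm (dual_space F) \<psi>" by (rule le[OF *(1)])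
    also have "\<dots> \<le> K * ?p * 1" using *(2) \<open>0 \<le> ?p\<close> A(2) by (intro mult_left_mono) auto
    finally show "norm (bidual_extension A zs \<psi>) \<le> K * ?p" by simp
  qed
qed

lemma multilinear_bidual_extension:
  assumes A: "multilinear_map n E F A" "0 \<le> K"
    and K: "\<And>xs. length xs = n \<Longrightarrow> set xs \<subseteq> vecs E \<Longrightarrow> vnorm F (A xs) \<le> K * prod_list (map (vnorm E) xs)"
  shows "multilinear_map n (bidual_space E) (bidual_space F) (bidual_extension A)"
proof -
  interpret B: normed_pair "bidual_space E" "bidual_space F" by (rule normed_pair_bidual)
  show ?thesis
  proof (rule B.multilinear_mapI)
    fix us vs x y
    assume *: "Suc (length us + length vs) = n" "set us \<subseteq> vecs (bidual_space E)"
      "set vs \<subseteq> vecs (bidual_space E)" "x \<in> vecs (bidual_space E)" "y \<in> vecs (bidual_space E)"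
    show "bidual_extension A (us @ (x + y) # vs) = bidual_extension A (us @ x # vs) + bidual_extension A (us @ y # vs)"
    proof
      fix \<psi>
      show "bidual_extension A (us @ (x + y) # vs) \<psi> = (bidual_extension A (us @ x # vs) + bidual_extension A (us @ y # vs)) \<psi>"
        using E.iterated_limit_slot(1)[OF *(2,3,4,5) dual_comp_bounded_form[OF A K, of \<psi>, folded *(1)]]
        by (simp add: bidual_extension_def)
    qed
  next
    fix us vs x c
    assume *: "Suc (length us + length vs) = n" "set us \<subseteq> vecs (bidual_space E)"
      "set vs \<subseteq> vecs (bidual_space E)" "x \<in> vecs (bidual_space E)"
    show "bidual_extension A (us @ smul (bidual_space E) c x # vs) = smul (bidual_space F) c (bidual_extension A (us @ x # vs))"
    proof
      fix \<psi>
      show "bidual_extension A (us @ smul (bidual_space E) c x # vs) \<psi> = smul (bidual_space F) c (bidual_extension A (us @ x # vs)) \<psi>"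
        using E.iterated_limit_slot(2)[OF *(2,3,4,4) dual_comp_bounded_form[OF A K, of \<psi>, folded *(1)], of c]
        by (simp add: bidual_extension_def)
    qed
  qed (rule bidual_extension(1)[OF A K])
qed

theorem aron_berner_poly:
  assumes P: "P \<in> vecs (poly_space n E F)"
  shows "aron_berner n E F P \<in> vecs (poly_space n (bidual_space E) (bidual_space F))"
proof -
  interpret B: normed_pair "bidual_space E" "bidual_space F" by (rule normed_pair_bidual)
  let ?A = "symmetric_form n E F P"
  obtain K where K: "0 \<le> K"
    "\<And>xs. length xs = n \<Longrightarrow> set xs \<subseteq> vecs E \<Longrightarrow> vnorm F (?A xs) \<le> K * prod_list (map (vnorm E) xs)"
    using symmetric_form_bounded[OF P] by blast
  note A = symmetric_form_props(1)[OF P]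
  have eq: "aron_berner n E F P z = bidual_extension ?A (replicate n z)" if "z \<in> vecs (bidual_space E)" for z
    using that by (auto simp: aron_berner_def bidual_extension_def fun_eq_iff)
  show ?thesis
    unfolding B.poly_space_iff
  proof (intro conjI allI impI)
    show "aron_berner n E F P z = 0" if "z \<notin> vecs (bidual_space E)" for z
      using that by (auto simp: aron_berner_def fun_eq_iff)
    show "\<exists>A. multilinear_map n (bidual_space E) (bidual_space F) A \<and>
        (\<forall>z\<in>vecs (bidual_space E). aron_berner n E F P z = A (replicate n z))"
      using multilinear_bidual_extension[OF A K] eq by blast
    have "vnorm (bidual_space F) (aron_berner n E F P z) \<le> K * vnorm (bidual_space E) z ^ n"
      if z: "z \<in> vecs (bidual_space E)" for z
      using bidual_extension(2)[OF A K, of "replicate n z"] z by (simp add: eq set_replicate_conv_if)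
    then show "\<exists>C\<ge>0. \<forall>z\<in>vecs (bidual_space E). vnorm (bidual_space F) (aron_berner n E F P z)
        \<le> C * vnorm (bidual_space E) z ^ n"
      using K(1) by blast
  qed
qed

text \<open>\<open>Davie_Gamelin\<close> for \<open>\<psi>\<close> composed with the symmetric form.
  The family \<open>\<Phi>\<close> keeps \<open>u\<close> weak-star close to \<open>z\<close>, which
  \<open>weakly_continuous_limit\<close> exploits.\<close>

lemma aron_berner_approx:
  assumes P: "P \<in> vecs (poly_space n E F)"
    and z: "z \<in> unit_ball (bidual_space E)" and \<psi>: "\<psi> \<in> vecs (dual_space F)"
    and \<Phi>: "finite \<Phi>" "\<Phi> \<subseteq> vecs (dual_space E)" and "\<epsilon> > 0"
  obtains u where "u \<in> unit_ball E" "\<And>\<phi>. \<phi> \<in> \<Phi> \<Longrightarrow> norm (\<phi> u - z \<phi>) < \<epsilon>"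
    "norm (\<psi> (P u) - aron_berner n E F P z \<psi>) < \<epsilon>"
proof -
  let ?A = "symmetric_form n E F P"
  obtain K where K: "0 \<le> K"
    "\<And>xs. length xs = n \<Longrightarrow> set xs \<subseteq> vecs E \<Longrightarrow> vnorm F (?A xs) \<le> K * prod_list (map (vnorm E) xs)"
    using symmetric_form_bounded[OF P] by blast
  note A = symmetric_form_props[OF P]
  have zb: "z \<in> vecs (bidual_space E)" "vnorm (bidual_space E) z \<le> 1" using z by (auto simp: unit_ball_def)
  have sym: "symmetric_map n E (\<lambda>xs. \<psi> (?A xs))"
    using A(2) unfolding symmetric_map_def by metis
  from E.Davie_Gamelin[OF dual_comp_bounded_form[OF A(1) K \<psi>] sym zb \<Phi> \<open>\<epsilon> > 0\<close>]
  obtain u where u: "u \<in> unit_ball E" "\<And>\<phi>. \<phi> \<in> \<Phi> \<Longrightarrow> norm (\<phi> u - z \<phi>) < \<epsilon>"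
    "norm (\<psi> (?A (replicate n u)) - iterated_limit E (\<lambda>xs. \<psi> (?A xs)) (replicate n z)) < \<epsilon>" by blast
  have "P u = ?A (replicate n u)" using u(1) A(3) by (simp add: unit_ball_def)
  then show ?thesis using that[of u] u zb(1) \<psi> by (simp add: aron_berner_def)
qed

text \<open>The value is approximated by \<psi> (P u) with \<open>u\<close> in the unit ball, so the
  norm of P itself appears and not that of its symmetric form.\<close>

lemma aron_berner_norm_le:
  assumes P: "P \<in> vecs (poly_space n E F)"
    and z: "z \<in> unit_ball (bidual_space E)" and \<psi>: "\<psi> \<in> vecs (dual_space F)"
  shows "norm (aron_berner n E F P z \<psi>) \<le> vnorm (dual_space F) \<psi> * vnorm (poly_space n E F) P"
proof (rule field_le_epsilon)
  fix \<epsilon> :: real assume "\<epsilon> > 0"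
  obtain u where u: "u \<in> unit_ball E" "norm (\<psi> (P u) - aron_berner n E F P z \<psi>) < \<epsilon>"
    using aron_berner_approx[OF P z \<psi>, of "{}" \<epsilon>] \<open>\<epsilon> > 0\<close> by auto
  have "P u \<in> vecs F" using u(1) by (intro poly_mem[OF P]) (simp add: unit_ball_def)
  then have "norm (\<psi> (P u)) \<le> vnorm (dual_space F) \<psi> * vnorm F (P u)" by (rule F.dual_norm_le[OF \<psi>])
  also have "\<dots> \<le> vnorm (dual_space F) \<psi> * vnorm (poly_space n E F) P"
    by (intro mult_left_mono poly_norm_ball[OF P u(1)] F.dual_norm_nonneg \<psi>)
  finally have "norm (\<psi> (P u)) \<le> vnorm (dual_space F) \<psi> * vnorm (poly_space n E F) P" .
  then show "norm (aron_berner n E F P z \<psi>) \<le> vnorm (dual_space F) \<psi> * vnorm (poly_space n E F) P + \<epsilon>"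
    using u(2) norm_triangle_sub[of "aron_berner n E F P z \<psi>" "\<psi> (P u)"]
    by (simp add: norm_minus_commute)
qed

lemma aron_berner_linear:
  assumes "n \<ge> 1" and P: "P \<in> vecs (poly_space n E F)" and Q: "Q \<in> vecs (poly_space n E F)"
    and z: "z \<in> vecs (bidual_space E)" and \<psi>: "\<psi> \<in> vecs (dual_space F)"
  shows "aron_berner n E F (P + Q) z \<psi> = aron_berner n E F P z \<psi> + aron_berner n E F Q z \<psi>"
    and "aron_berner n E F (smul (poly_space n E F) c P) z \<psi> = c * aron_berner n E F P z \<psi>"
proof -
  have bf: "\<exists>K. E.bounded_form (length (replicate n z)) K (\<lambda>xs. \<psi> (symmetric_form n E F R xs))"
    if R: "R \<in> vecs (poly_space n E F)" for R
  proof -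
    obtain K where K: "0 \<le> K" "\<And>xs. length xs = n \<Longrightarrow> set xs \<subseteq> vecs E \<Longrightarrow>
        vnorm F (symmetric_form n E F R xs) \<le> K * prod_list (map (vnorm E) xs)"
      using symmetric_form_bounded[OF R] by blast
    show ?thesis using dual_comp_bounded_form[OF symmetric_form_props(1)[OF R] K \<psi>] by auto
  qed
  obtain K L where K: "E.bounded_form (length (replicate n z)) K (\<lambda>xs. \<psi> (symmetric_form n E F P xs))"
    and L: "E.bounded_form (length (replicate n z)) L (\<lambda>xs. \<psi> (symmetric_form n E F Q xs))"
    using bf[OF P] bf[OF Q] by blast
  have sub: "set (replicate n z) \<subseteq> vecs (bidual_space E)" using z by auto
  have mem: "symmetric_form n E F R xs \<in> vecs F"
    if "R \<in> vecs (poly_space n E F)" "length xs = n" "set xs \<subseteq> vecs E" for R xs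
    by (rule multilinear_mem[OF symmetric_form_props(1)[OF that(1)] that(2,3)])
  have "iterated_limit E (\<lambda>xs. \<psi> (symmetric_form n E F (P + Q) xs)) (replicate n z)
      = iterated_limit E (\<lambda>xs. \<psi> (symmetric_form n E F P xs) + \<psi> (symmetric_form n E F Q xs)) (replicate n z)"
    by (rule E.iterated_limit_cong)
       (simp add: symmetric_form_linear(1)[OF assms(1) P Q] F.dual_add[OF \<psi>] mem[OF P] mem[OF Q])
  then show "aron_berner n E F (P + Q) z \<psi> = aron_berner n E F P z \<psi> + aron_berner n E F Q z \<psi>"
    using E.iterated_limit_add[OF sub K L] z \<psi> by (simp add: aron_berner_def)
  have "iterated_limit E (\<lambda>xs. \<psi> (symmetric_form n E F (smul (poly_space n E F) c P) xs)) (replicate n z)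
      = iterated_limit E (\<lambda>xs. c * \<psi> (symmetric_form n E F P xs)) (replicate n z)"
    by (rule E.iterated_limit_cong)
       (simp add: symmetric_form_linear(2)[OF assms(1) P Q, simplified] F.dual_smul[OF \<psi>] mem[OF P])
  then show "aron_berner n E F (smul (poly_space n E F) c P) z \<psi> = c * aron_berner n E F P z \<psi>"
    using E.iterated_limit_smul[OF sub K, of c] z \<psi> by (simp add: aron_berner_def)
qed

end

section \<open>Weak continuity on bounded sets\<close>

context normed_pair
begin

text \<open>The condition in \<open>weakly_continuous_polys\<close>, stated for arbitrary maps
  because the differences f x - f (x - b) of a homogeneous polynomial are in general not
  homogeneous.\<close>

definition weakly_continuous :: "('e \<Rightarrow> 'f) \<Rightarrow> bool" where
  "weakly_continuous f \<longleftrightarrow> (\<forall>x\<in>vecs E. \<forall>\<F> r.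
     (\<forall>\<^sub>F y in \<F>. y \<in> vecs E \<and> vnorm E y \<le> r) \<and> (\<forall>\<phi>\<in>vecs (dual_space E). (\<phi> \<longlongrightarrow> \<phi> x) \<F>) \<longrightarrow>
     ((\<lambda>y. vnorm F (f y - f x)) \<longlongrightarrow> 0) \<F>)"

lemma weakly_continuousD:
  assumes "weakly_continuous f" "x \<in> vecs E" "\<forall>\<^sub>F y in \<F>. y \<in> vecs E \<and> vnorm E y \<le> r"
    and "\<And>\<phi>. \<phi> \<in> vecs (dual_space E) \<Longrightarrow> (\<phi> \<longlongrightarrow> \<phi> x) \<F>"
  shows "((\<lambda>y. vnorm F (f y - f x)) \<longlongrightarrow> 0) \<F>"
  using assms unfolding weakly_continuous_def by blast

text \<open>Polynomials of degree at most \<open>d\<close> in the sense of Frechet.  Unlike homogeneous polynomials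
  they are closed under translation, which drives the induction in \<open>weakly_continuous_Cauchy\<close>.\<close>

fun frechet_degree :: "nat \<Rightarrow> ('e \<Rightarrow> 'f) \<Rightarrow> bool" where
  "frechet_degree 0 f \<longleftrightarrow> (\<forall>x\<in>vecs E. f x = f 0)"
| "frechet_degree (Suc d) f \<longleftrightarrow> (\<forall>b\<in>vecs E. frechet_degree d (\<lambda>x. f x - f (x - b)))"

lemma frechet_degree_cong:
  "frechet_degree d f \<Longrightarrow> (\<And>x. x \<in> vecs E \<Longrightarrow> f x = g x) \<Longrightarrow> frechet_degree d g"
proof (induction d arbitrary: f g)
  case 0
  show ?case
    unfolding frechet_degree.simps
  proof
    fix x assume "x \<in> vecs E"
    then show "g x = g 0" using 0(1) 0(2)[of x] 0(2)[of 0] by simp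
  qed
next
  case (Suc d)
  show ?case
    unfolding frechet_degree.simps
  proof
    fix b assume b: "b \<in> vecs E"
    then have "frechet_degree d (\<lambda>x. f x - f (x - b))" using Suc.prems(1) by simp
    then show "frechet_degree d (\<lambda>x. g x - g (x - b))"
    proof (rule Suc.IH)
      fix x assume "x \<in> vecs E"
      then show "f x - f (x - b) = g x - g (x - b)"
        using Suc.prems(2)[of x] Suc.prems(2)[of "x - b"] b by simp
    qed
  qed
qed

lemma frechet_degree_add:
  "frechet_degree d f \<Longrightarrow> frechet_degree d g \<Longrightarrow> frechet_degree d (\<lambda>x. f x + g x)"
proof (induction d arbitrary: f g)
  case 0
  show ?case
    unfolding frechet_degree.simps
  proof
    fix x assume "x \<in> vecs E"
    with 0 have "f x = f 0" "g x = g 0"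
      unfolding frechet_degree.simps by (blast dest: bspec)+
    then show "f x + g x = f 0 + g 0" by simp
  qed
next
  case (Suc d)
  show ?case
    unfolding frechet_degree.simps
  proof
    fix b assume b: "b \<in> vecs E"
    note diffs = Suc.prems[unfolded frechet_degree.simps, THEN bspec, OF b]
    from Suc.IH[OF diffs] show "frechet_degree d (\<lambda>x. f x + g x - (f (x - b) + g (x - b)))"
      by (rule frechet_degree_cong) (simp only: add_diff_add)
  qed
qed

lemma frechet_degree_zero: "frechet_degree d (\<lambda>x. 0)"
  by (induction d) auto

text \<open>Translating by b a bounded filter that converges weakly to x gives a bounded filter that
  converges weakly to x - b, so both terms of the difference converge.\<close>

lemma weakly_continuous_diff_translate:
  assumes f: "weakly_continuous f" "\<And>x. x \<in> vecs E \<Longrightarrow> f x \<in> vecs F" and b: "b \<in> vecs E"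
  shows "weakly_continuous (\<lambda>x. f x - f (x - b))"
  unfolding weakly_continuous_def
proof (intro ballI allI impI, elim conjE)
  fix x \<F> r
  assume x: "x \<in> vecs E" and bd: "\<forall>\<^sub>F y in \<F>. y \<in> vecs E \<and> vnorm E y \<le> r"
    and lim: "\<forall>\<phi>\<in>vecs (dual_space E). (\<phi> \<longlongrightarrow> \<phi> x) \<F>"
  have 1: "((\<lambda>y. vnorm F (f y - f x)) \<longlongrightarrow> 0) \<F>"
    using f(1) x bd lim unfolding weakly_continuous_def by blast
  have "((\<lambda>y. vnorm F (f y - f (x - b))) \<longlongrightarrow> 0) (filtermap (\<lambda>y. y - b) \<F>)"
  proof (rule weakly_continuousD[OF f(1)])
    show "x - b \<in> vecs E" using x b by simp
    show "\<forall>\<^sub>F y in filtermap (\<lambda>y. y - b) \<F>. y \<in> vecs E \<and> vnorm E y \<le> r + vnorm E b"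
      unfolding eventually_filtermap using bd
    proof eventually_elim
      case (elim y)
      then show ?case using E.norm_diff_le[of y b] b by auto
    qed
    fix \<phi> assume \<phi>: "\<phi> \<in> vecs (dual_space E)"
    have "((\<lambda>y. \<phi> y - \<phi> b) \<longlongrightarrow> \<phi> x - \<phi> b) \<F>"
      using lim \<phi> by (intro tendsto_diff) auto
    then have "((\<lambda>y. \<phi> (y - b)) \<longlongrightarrow> \<phi> (x - b)) \<F>"
      unfolding E.dual_diff[OF \<phi> x b]
    proof (rule Lim_transform_eventually)
      show "\<forall>\<^sub>F y in \<F>. \<phi> y - \<phi> b = \<phi> (y - b)"
        using bd by eventually_elim (simp add: E.dual_diff[OF \<phi> _ b])
    qed
    then show "(\<phi> \<longlongrightarrow> \<phi> (x - b)) (filtermap (\<lambda>y. y - b) \<F>)"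
      by (simp add: filterlim_filtermap)
  qed
  then have 2: "((\<lambda>y. vnorm F (f (y - b) - f (x - b))) \<longlongrightarrow> 0) \<F>"
    by (simp add: filterlim_filtermap)
  have 3: "((\<lambda>y. vnorm F (f y - f x) + vnorm F (f (y - b) - f (x - b))) \<longlongrightarrow> 0) \<F>"
    using tendsto_add[OF 1 2] by simp
  show "((\<lambda>y. vnorm F (f y - f (y - b) - (f x - f (x - b)))) \<longlongrightarrow> 0) \<F>"
  proof (rule tendsto_sandwich[OF _ _ tendsto_const])
    show "\<forall>\<^sub>F y in \<F>. 0 \<le> vnorm F (f y - f (y - b) - (f x - f (x - b)))"
      using bd by eventually_elim (use f(2) x b in \<open>auto intro!: F.norm_nonneg\<close>)
    show "\<forall>\<^sub>F y in \<F>. vnorm F (f y - f (y - b) - (f x - f (x - b)))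
        \<le> vnorm F (f y - f x) + vnorm F (f (y - b) - f (x - b))"
      using bd
    proof eventually_elim
      case (elim y)
      have eq: "f y - f (y - b) - (f x - f (x - b)) = (f y - f x) - (f (y - b) - f (x - b))"
        by (simp add: algebra_simps)
      show ?case
        unfolding eq using elim x b f(2) by (intro F.norm_diff_le) auto
    qed
  qed (rule 3)
qed

text \<open>With \<open>b\<close> far out in the filter, \<open>f x\<close> differs from \<open>f x - f (x - b)\<close>, which has smaller degree,
  by \<open>f (x - b)\<close>, which is close to \<open>f 0\<close> by weak continuity at 0.\<close>

lemma weakly_continuous_Cauchy:
  assumes "\<F> \<noteq> bot" and bd: "\<forall>\<^sub>F y in \<F>. y \<in> vecs E \<and> vnorm E y \<le> r"
    and lim: "\<And>\<phi>. \<phi> \<in> vecs (dual_space E) \<Longrightarrow> (\<phi> \<longlongrightarrow> z \<phi>) \<F>"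
  shows "frechet_degree d f \<Longrightarrow> weakly_continuous f \<Longrightarrow> (\<And>x. x \<in> vecs E \<Longrightarrow> f x \<in> vecs F) \<Longrightarrow> \<epsilon> > 0 \<Longrightarrow>
    \<exists>S. eventually S \<F> \<and> (\<forall>x y. S x \<and> S y \<longrightarrow> x \<in> vecs E \<and> y \<in> vecs E \<and> vnorm F (f x - f y) < \<epsilon>)"
proof (induction d arbitrary: f \<epsilon>)
  case 0
  have "eventually (\<lambda>x. x \<in> vecs E) \<F>" using bd by eventually_elim simp
  moreover have "vnorm F (f x - f y) < \<epsilon>" if "x \<in> vecs E" "y \<in> vecs E" for x y
  proof -
    have "f x = f 0" "f y = f 0"
      using 0(1) that unfolding frechet_degree.simps by (blast dest: bspec)+
    then show ?thesis using \<open>\<epsilon> > 0\<close> by simp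
  qed
  ultimately show ?case by (intro exI[of _ "\<lambda>x. x \<in> vecs E"]) simp
next
  case (Suc d)
  \<comment> \<open>The filter of differences of two independent points of \<open>\<F>\<close>. It
    is bounded by r + r and converges weakly to 0, a point of E, because the limits
    \<open>z \<phi>\<close> cancel; so weak continuity of \<open>f\<close> applies although
    \<open>z\<close> may lie outside E.\<close>
  let ?D = "filtermap (\<lambda>p. fst p - snd p) (\<F> \<times>\<^sub>F \<F>)"
  have bd2: "\<forall>\<^sub>F p in \<F> \<times>\<^sub>F \<F>. (fst p \<in> vecs E \<and> vnorm E (fst p) \<le> r) \<and> (snd p \<in> vecs E \<and> vnorm E (snd p) \<le> r)"
    by (rule eventually_prodI[OF bd bd])
  have "((\<lambda>y. vnorm F (f y - f 0)) \<longlongrightarrow> 0) ?D"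
  proof (rule weakly_continuousD[OF Suc.prems(2)])
    show "\<forall>\<^sub>F y in ?D. y \<in> vecs E \<and> vnorm E y \<le> r + r"
      unfolding eventually_filtermap using bd2
    proof eventually_elim
      case (elim p)
      then show ?case using E.norm_diff_le[of "fst p" "snd p"] by auto
    qed
    fix \<phi> assume \<phi>: "\<phi> \<in> vecs (dual_space E)"
    have "((\<lambda>p. \<phi> (fst p) - \<phi> (snd p)) \<longlongrightarrow> z \<phi> - z \<phi>) (\<F> \<times>\<^sub>F \<F>)"
      by (intro tendsto_diff filterlim_compose[OF lim[OF \<phi>] filterlim_fst]
          filterlim_compose[OF lim[OF \<phi>] filterlim_snd])
    then have "((\<lambda>p. \<phi> (fst p) - \<phi> (snd p)) \<longlongrightarrow> \<phi> 0) (\<F> \<times>\<^sub>F \<F>)" by (simp add: E.dual_0[OF \<phi>])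
    then have "((\<lambda>p. \<phi> (fst p - snd p)) \<longlongrightarrow> \<phi> 0) (\<F> \<times>\<^sub>F \<F>)"
    proof (rule Lim_transform_eventually)
      show "\<forall>\<^sub>F p in \<F> \<times>\<^sub>F \<F>. \<phi> (fst p) - \<phi> (snd p) = \<phi> (fst p - snd p)"
        using bd2 by eventually_elim (simp add: E.dual_diff[OF \<phi>])
    qed
    then show "(\<phi> \<longlongrightarrow> \<phi> 0) ?D" by (simp add: filterlim_filtermap)
  qed simp
  then have "((\<lambda>p. vnorm F (f (fst p - snd p) - f 0)) \<longlongrightarrow> 0) (\<F> \<times>\<^sub>F \<F>)"
    by (simp add: filterlim_filtermap)
  from order_tendstoD(2)[OF this, of "\<epsilon> / 3"]
  have "\<forall>\<^sub>F p in \<F> \<times>\<^sub>F \<F>. vnorm F (f (fst p - snd p) - f 0) < \<epsilon> / 3" using \<open>\<epsilon> > 0\<close> by simp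
  then obtain U V where U: "eventually U \<F>" and V: "eventually V \<F>"
    and UV: "\<And>x b. U x \<Longrightarrow> V b \<Longrightarrow> vnorm F (f (x - b) - f 0) < \<epsilon> / 3"
    unfolding eventually_prod_filter by auto
  have "eventually (\<lambda>y. V y \<and> y \<in> vecs E) \<F>" using V bd by eventually_elim simp
  from eventually_happens'[OF assms(1) this] obtain b where b: "V b" "b \<in> vecs E" by blast
  define g where "g x = f x - f (x - b)" for x
  have gF: "g x \<in> vecs F" if "x \<in> vecs E" for x using that b Suc.prems(3) by (simp add: g_def)
  have "\<exists>S. eventually S \<F> \<and> (\<forall>x y. S x \<and> S y \<longrightarrow> x \<in> vecs E \<and> y \<in> vecs E \<and> vnorm F (g x - g y) < \<epsilon> / 3)"
  proof (rule Suc.IH)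
    show "frechet_degree d g" using Suc.prems(1) b(2) by (simp add: g_def[abs_def])
    show "weakly_continuous g"
      unfolding g_def[abs_def] by (rule weakly_continuous_diff_translate[OF Suc.prems(2,3) b(2)])
  qed (use gF \<open>\<epsilon> > 0\<close> in auto)
  then obtain S where S: "eventually S \<F>"
    and Sg: "\<And>x y. S x \<Longrightarrow> S y \<Longrightarrow> x \<in> vecs E \<and> y \<in> vecs E \<and> vnorm F (g x - g y) < \<epsilon> / 3" by blast
  have "vnorm F (f x - f y) < \<epsilon>" if xy: "S x" "U x" "S y" "U y" for x y
  proof -
    have m: "x \<in> vecs E" "y \<in> vecs E" using Sg[OF xy(1,3)] by auto
    have fF: "f (x - b) - f 0 \<in> vecs F" "f (y - b) - f 0 \<in> vecs F" "g x - g y \<in> vecs F"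
      using m b gF Suc.prems(3) by simp_all
    \<comment> \<open>One third of \<epsilon> comes from the induction hypothesis for
      \<open>g\<close>, the other two from \<open>U\<close> and \<open>V\<close> with the fixed
      \<open>b\<close>.\<close>
    have "f x - f y = (g x - g y) + ((f (x - b) - f 0) - (f (y - b) - f 0))" by (simp add: g_def)
    then have "vnorm F (f x - f y) \<le> vnorm F (g x - g y) + (vnorm F (f (x - b) - f 0) + vnorm F (f (y - b) - f 0))"
      using F.norm_add_le[OF fF(3) F.diff_mem[OF fF(1,2)]] F.norm_diff_le[OF fF(1,2)] by simp
    then show ?thesis using Sg[OF xy(1,3)] UV[OF xy(2) b(1)] UV[OF xy(4) b(1)] by simp
  qed
  moreover have "eventually (\<lambda>x. S x \<and> U x) \<F>" using S U by (rule eventually_conj)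
  ultimately show ?case using Sg by (intro exI[of _ "\<lambda>x. S x \<and> U x"]) blast
qed

text \<open>A slot \<open>(True, c)\<close> of an argument list stands for the variable entry \<open>x + c\<close>, and
  \<open>(False, c)\<close> for the constant entry \<open>c\<close>.\<close>

definition slots :: "(bool \<times> 'e) list \<Rightarrow> 'e \<Rightarrow> 'e list" where
  "slots L x = map (\<lambda>(s, c). if s then x + c else c) L"

definition shift_slots :: "'e \<Rightarrow> (bool \<times> 'e) list \<Rightarrow> (bool \<times> 'e) list" where
  "shift_slots b L = map (\<lambda>(s, c). (s, if s then c - b else c)) L"

lemma slots_simps [simp]:
  "slots [] x = []" "slots ((s, c) # L) x = (if s then x + c else c) # slots L x"
  "slots (L @ M) x = slots L x @ slots M x" "length (slots L x) = length L"
  "shift_slots b [] = []" "shift_slots b ((s, c) # L) = (s, if s then c - b else c) # shift_slots b L"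
  "length (shift_slots b L) = length L" "length (filter fst (shift_slots b L)) = length (filter fst L)"
proof -
  show "length (filter fst (shift_slots b L)) = length (filter fst L)"
    unfolding shift_slots_def by (induction L) auto
qed (auto simp: slots_def shift_slots_def)

lemma slots_translate: "slots L (x - b) = slots (shift_slots b L) x"
  by (induction L) (auto simp: algebra_simps)

lemma slots_mem:
  "snd ` set L \<subseteq> vecs E \<Longrightarrow> x \<in> vecs E \<Longrightarrow> set (slots L x) \<subseteq> vecs E"
  by (induction L) auto

lemma shift_slots_mem:
  assumes "snd ` set L \<subseteq> vecs E" "b \<in> vecs E"
  shows "snd ` set (shift_slots b L) \<subseteq> vecs E"
proof
  fix v assume "v \<in> snd ` set (shift_slots b L)"
  then obtain s c where "(s, c) \<in> set L" "v = (if s then c - b else c)"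
    by (auto simp: shift_slots_def)
  moreover from this(1) have "c \<in> vecs E" using assms(1) by force
  ultimately show "v \<in> vecs E" using assms(2) by simp
qed

text \<open>The difference of the values at x and at x - b telescopes over the slots. In a variable
  slot it leaves the entry (x + c) - (x + (c - b)) = b, a constant, so each term has one variable
  slot fewer.\<close>

lemma frechet_degree_slots:
  assumes A: "multilinear_map n E F A"
  shows "length L = n \<Longrightarrow> snd ` set L \<subseteq> vecs E \<Longrightarrow> length (filter fst L) \<le> d \<Longrightarrow>
    frechet_degree d (\<lambda>x. A (slots L x))"
proof (induction d arbitrary: L)
  case 0
  then have "slots L x = slots L 0" for x
    unfolding slots_def by (auto simp: filter_empty_conv)
  from this[THEN arg_cong[where f = A]] show ?case
    unfolding frechet_degree.simps by (rule ballI)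
next
  case (Suc d)
  have step: "frechet_degree d (\<lambda>x. A (slots (L1 @ L2) x) - A (slots (L1 @ shift_slots b L2) x))"
    if b: "b \<in> vecs E" and "length L1 + length L2 = n" "snd ` set L1 \<subseteq> vecs E" "snd ` set L2 \<subseteq> vecs E"
      "length (filter fst L1) + length (filter fst L2) \<le> Suc d" for L1 L2 b
    using that(2-)
  proof (induction L2 arbitrary: L1)
    case Nil
    then show ?case by (simp add: frechet_degree_zero)
  next
    case (Cons p L2)
    obtain s c where p: "p = (s, c)" by force
    let ?M = "shift_slots b L2"
    have c: "c \<in> vecs E" and L2: "snd ` set L2 \<subseteq> vecs E" using Cons.prems by (auto simp: p)
    have M: "snd ` set ?M \<subseteq> vecs E" by (rule shift_slots_mem[OF L2 b])
    have first: "frechet_degree d (\<lambda>x. A (slots ((L1 @ [p]) @ L2) x) - A (slots ((L1 @ [p]) @ ?M) x))"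
      using Cons.prems by (intro Cons.IH) auto
    show ?case
    proof (cases s)
      case False
      then show ?thesis using first by (simp add: p)
    next
      case True
      have "frechet_degree d (\<lambda>x. A (slots (L1 @ (False, b) # ?M) x))"
        using Cons.prems b M True by (intro Suc.IH) (auto simp: p)
      from frechet_degree_add[OF first this] show ?thesis
      proof (rule frechet_degree_cong)
        fix x assume x: "x \<in> vecs E"
        have "A (slots L1 x @ (x + c - (x + (c - b))) # slots ?M x)
            = A (slots L1 x @ (x + c) # slots ?M x) - A (slots L1 x @ (x + (c - b)) # slots ?M x)"
          using Cons.prems slots_mem[OF Cons.prems(2) x] slots_mem[OF M x] x b c
          by (intro multilinear_diff[OF A]) auto
        then show "A (slots ((L1 @ [p]) @ L2) x) - A (slots ((L1 @ [p]) @ ?M) x) + A (slots (L1 @ (False, b) # ?M) x)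
            = A (slots (L1 @ p # L2) x) - A (slots (L1 @ shift_slots b (p # L2)) x)"
          using True by (simp add: p)
      qed
    qed
  qed
  show ?case
    unfolding frechet_degree.simps
  proof
    fix b assume "b \<in> vecs E"
    from step[OF this, of "[]" L] Suc.prems
    show "frechet_degree d (\<lambda>x. A (slots L x) - A (slots L (x - b)))"
      by (simp add: slots_translate)
  qed
qed

lemma frechet_degree_poly:
  assumes P: "P \<in> vecs (poly_space n E F)"
  shows "frechet_degree n P"
proof -
  obtain A where A: "multilinear_map n E F A" "\<forall>x\<in>vecs E. P x = A (replicate n x)"
    using P unfolding poly_space_iff by blast
  have "frechet_degree n (\<lambda>x. A (slots (replicate n (True, 0)) x))"
    by (rule frechet_degree_slots[OF A(1)]) (auto simp: set_replicate_conv_if)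
  then show ?thesis
    by (rule frechet_degree_cong) (use A(2) in \<open>simp add: slots_def\<close>)
qed

text \<open>An auxiliary \<open>u\<close> splits the error in three. Eventually
  \<open>P (x k)\<close> is near \<open>P u\<close> in norm, which suffices although
  \<open>\<psi> k\<close> moves with k; at the fixed vector \<open>P u\<close> the functionals
  converge; and \<open>\<psi>0 (P u)\<close> is near the extension by
  \<open>aron_berner_approx\<close>.\<close>

theorem weakly_continuous_limit:
  fixes x :: "'a \<Rightarrow> 'e" and \<psi> :: "'a \<Rightarrow> 'f \<Rightarrow> 'k"
  assumes P: "P \<in> weakly_continuous_polys n E F"
    and x: "\<And>k. x k \<in> unit_ball E" and \<psi>: "\<And>k. \<psi> k \<in> unit_ball (dual_space F)"
    and z: "z \<in> unit_ball (bidual_space E)" and \<psi>0: "\<psi>0 \<in> vecs (dual_space F)"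
    and xz: "\<And>\<phi>. \<phi> \<in> vecs (dual_space E) \<Longrightarrow> ((\<lambda>k. \<phi> (x k)) \<longlongrightarrow> z \<phi>) \<G>"
    and \<psi>\<psi>0: "\<And>f. f \<in> vecs F \<Longrightarrow> ((\<lambda>k. \<psi> k f) \<longlongrightarrow> \<psi>0 f) \<G>"
  shows "((\<lambda>k. \<psi> k (P (x k))) \<longlongrightarrow> aron_berner n E F P z \<psi>0) \<G>"
proof (rule tendstoI)
  fix \<epsilon> :: real assume "\<epsilon> > 0"
  have PX: "P \<in> vecs (poly_space n E F)" and wc: "weakly_continuous P"
    using P unfolding weakly_continuous_polys_def weakly_continuous_def by auto
  have zb: "z \<in> vecs (bidual_space E)" "vnorm (bidual_space E) z \<le> 1" using z by (auto simp: unit_ball_def)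
  define \<H> where "\<H> = inf (weak_star_to E z) (principal {x \<in> vecs E. vnorm E x \<le> 1})"
  have "\<H> \<noteq> bot" unfolding \<H>_def by (rule E.weak_star_to_ball_nontrivial[OF zero_less_one zb])
  moreover have "\<forall>\<^sub>F y in \<H>. y \<in> vecs E \<and> vnorm E y \<le> 1"
    unfolding \<H>_def by (rule filter_leD[OF inf_le2]) (simp add: eventually_principal)
  moreover have "(\<phi> \<longlongrightarrow> z \<phi>) \<H>" if "\<phi> \<in> vecs (dual_space E)" for \<phi>
    unfolding \<H>_def by (rule tendsto_mono[OF inf_le1 E.tendsto_weak_star_to[OF that]])
  ultimately have "\<exists>S. eventually S \<H> \<and>
      (\<forall>x y. S x \<and> S y \<longrightarrow> x \<in> vecs E \<and> y \<in> vecs E \<and> vnorm F (P x - P y) < \<epsilon> / 3)"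
    using \<open>\<epsilon> > 0\<close> by (intro weakly_continuous_Cauchy[where d = n] frechet_degree_poly[OF PX] wc poly_mem[OF PX]) auto
  then obtain S where S: "eventually S \<H>"
    and PS: "\<And>x y. S x \<Longrightarrow> S y \<Longrightarrow> vnorm F (P x - P y) < \<epsilon> / 3" by blast
  from S have "eventually (\<lambda>y. y \<in> {x \<in> vecs E. vnorm E x \<le> 1} \<longrightarrow> S y) (weak_star_to E z)"
    unfolding \<H>_def eventually_inf_principal .
  then obtain \<Phi> \<delta> where \<Phi>: "finite \<Phi>" "\<Phi> \<subseteq> vecs (dual_space E)" "\<delta> > 0"
    and \<Phi>S: "\<forall>y\<in>vecs E. (\<forall>\<phi>\<in>\<Phi>. norm (\<phi> y - z \<phi>) < \<delta>) \<longrightarrow> y \<in> {x \<in> vecs E. vnorm E x \<le> 1} \<longrightarrow> S y"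
    unfolding E.eventually_weak_star_to by (elim exE conjE)
  have inS: "S y" if "y \<in> unit_ball E" "\<forall>\<phi>\<in>\<Phi>. norm (\<phi> y - z \<phi>) < \<delta>" for y
    using \<Phi>S that by (simp add: unit_ball_def)
  \<comment> \<open>One tolerance for both demands on \<open>u\<close>: \<delta> places it in
    \<open>S\<close>, and \<epsilon> / 3 brings it close to the value of the extension.\<close>
  have "min \<delta> (\<epsilon> / 3) > 0" using \<Phi>(3) \<open>\<epsilon> > 0\<close> by simp
  from aron_berner_approx[OF PX z \<psi>0 \<Phi>(1,2) this]
  obtain u where u: "u \<in> unit_ball E" "\<And>\<phi>. \<phi> \<in> \<Phi> \<Longrightarrow> norm (\<phi> u - z \<phi>) < min \<delta> (\<epsilon> / 3)"
    "norm (\<psi>0 (P u) - aron_berner n E F P z \<psi>0) < min \<delta> (\<epsilon> / 3)" by blast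
  have "S u" using u by (intro inS) auto
  have PuF: "P u \<in> vecs F" using u(1) by (intro poly_mem[OF PX]) (simp add: unit_ball_def)
  have "\<forall>\<^sub>F k in \<G>. norm (\<phi> (x k) - z \<phi>) < \<delta>" if "\<phi> \<in> \<Phi>" for \<phi>
    using tendstoD[OF xz \<Phi>(3), of \<phi>] that \<Phi>(2) by (auto simp: dist_norm)
  then have "\<forall>\<^sub>F k in \<G>. \<forall>\<phi>\<in>\<Phi>. norm (\<phi> (x k) - z \<phi>) < \<delta>"
    using \<Phi>(1) by (simp add: eventually_ball_finite)
  moreover have "\<forall>\<^sub>F k in \<G>. dist (\<psi> k (P u)) (\<psi>0 (P u)) < \<epsilon> / 3"
    using tendstoD[OF \<psi>\<psi>0[OF PuF], of "\<epsilon> / 3"] \<open>\<epsilon> > 0\<close> by simp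
  ultimately show "\<forall>\<^sub>F k in \<G>. dist (\<psi> k (P (x k))) (aron_berner n E F P z \<psi>0) < \<epsilon>"
  proof eventually_elim
    case (elim k)
    have PxF: "P (x k) \<in> vecs F" using x[of k] by (intro poly_mem[OF PX]) (simp add: unit_ball_def)
    have \<psi>k: "\<psi> k \<in> vecs (dual_space F)" "vnorm (dual_space F) (\<psi> k) \<le> 1"
      using \<psi>[of k] by (auto simp: unit_ball_def)
    have "norm (\<psi> k (P (x k)) - \<psi> k (P u)) \<le> vnorm (dual_space F) (\<psi> k) * vnorm F (P (x k) - P u)"
      using F.dual_norm_le[OF \<psi>k(1) F.diff_mem[OF PxF PuF]] by (simp add: F.dual_diff[OF \<psi>k(1) PxF PuF])
    also have "\<dots> \<le> 1 * vnorm F (P (x k) - P u)"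
      using \<psi>k(2) PxF PuF by (intro mult_right_mono) auto
    also have "\<dots> < \<epsilon> / 3" using PS[OF inS[OF x elim(1)] \<open>S u\<close>] by simp
    finally have "dist (\<psi> k (P (x k))) (\<psi> k (P u)) < \<epsilon> / 3" by (simp add: dist_norm)
    moreover have "dist (\<psi>0 (P u)) (aron_berner n E F P z \<psi>0) < \<epsilon> / 3" using u(3) by (simp add: dist_norm)
    ultimately show ?case
      using elim(2) dist_triangle[of "\<psi> k (P (x k))" "aron_berner n E F P z \<psi>0" "\<psi> k (P u)"]
        dist_triangle[of "\<psi> k (P u)" "aron_berner n E F P z \<psi>0" "\<psi>0 (P u)"] by linarith
  qed
qed

end

section \<open>Farthest points and norm attainment\<close>

text \<open>The closedness half of weak-star compactness of the dual ball;
  \<open>refine_filter_bounded_family\<close> supplies the limits.\<close>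

lemma (in normed_sp) limit_in_dual_unit_ball:
  assumes "\<G> \<noteq> bot" and h: "\<And>k. h k \<in> unit_ball (dual_space E)"
    and lim: "\<And>x. ((\<lambda>k. h k x) \<longlongrightarrow> l x) \<G>"
  shows "l \<in> unit_ball (dual_space E)"
proof -
  have hD: "h k \<in> vecs (dual_space E)" "vnorm (dual_space E) (h k) \<le> 1" for k
    using h[of k] by (auto simp: unit_ball_def)
  show ?thesis
  proof (rule dual_unit_ballI)
    fix x assume "x \<notin> vecs E"
    then have "(\<lambda>k. h k x) = (\<lambda>k. 0)" using dual_outside[OF hD(1)] by auto
    then show "l x = 0" using lim[of x] tendsto_unique[OF assms(1) _ tendsto_const] by metis
  next
    fix x y assume xy: "x \<in> vecs E" "y \<in> vecs E"
    have "((\<lambda>k. h k (x + y)) \<longlongrightarrow> l x + l y) \<G>"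
      unfolding dual_add[OF hD(1) xy] by (intro tendsto_add lim)
    then show "l (x + y) = l x + l y" by (rule tendsto_unique[OF assms(1) lim])
  next
    fix x c assume x: "x \<in> vecs E"
    have "((\<lambda>k. h k (smul E c x)) \<longlongrightarrow> c * l x) \<G>"
      unfolding dual_smul[OF hD(1) x] by (intro tendsto_mult_left lim)
    then show "l (smul E c x) = c * l x" by (rule tendsto_unique[OF assms(1) lim])
  next
    fix x assume x: "x \<in> vecs E"
    have "norm (h k x) \<le> vnorm E x" for k
    proof -
      have "norm (h k x) \<le> vnorm (dual_space E) (h k) * vnorm E x" by (rule dual_norm_le[OF hD(1) x])
      also have "\<dots> \<le> 1 * vnorm E x" using hD(2) x by (intro mult_right_mono) auto
      finally show ?thesis by simp
    qed
    then show "norm (l x) \<le> vnorm E x"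
      by (intro tendsto_upperbound[OF tendsto_norm[OF lim] _ assms(1)] always_eventually allI)
  qed
qed

text \<open>A functional \<open>f\<close> of norm at most 1 that has modulus 1 at \<open>Q\<close> is fixed by the projection \<open>\<pi>\<close>:
  since \<open>f - \<pi> f\<close> vanishes at \<open>Q\<close>, the functional \<open>\<pi> f\<close> already exhausts the norm of \<open>f\<close>.\<close>

lemma M_ideal_unique_extension:
  assumes "normed_sp X" and M: "is_M_ideal J X"
    and \<phi>: "\<phi> \<in> unit_ball (dual_space X)" and e: "e \<in> unit_ball (dual_space X)"
    and agree: "\<And>y. y \<in> J \<Longrightarrow> \<phi> y = e y"
    and Q: "Q \<in> J" "vnorm X Q \<le> 1" "norm (e Q) = 1"
  shows "\<phi> = e"
proof -
  interpret X: normed_sp X by fact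
  interpret D: normed_sp "dual_space X" by (rule normed_sp_dual) fact
  have JX: "J \<subseteq> vecs X" using M unfolding is_M_ideal_def by blast
  from M obtain \<pi> where \<pi>: "\<forall>\<phi>\<in>vecs (dual_space X). \<pi> \<phi> \<in> vecs (dual_space X) \<and> \<pi> (\<pi> \<phi>) = \<pi> \<phi>"
    and \<pi>add: "\<forall>\<phi>\<in>vecs (dual_space X). \<forall>\<psi>\<in>vecs (dual_space X). \<pi> (\<phi> + \<psi>) = \<pi> \<phi> + \<pi> \<psi>"
    and ker: "{\<phi> \<in> vecs (dual_space X). \<pi> \<phi> = 0} = annihilator X J"
    and L: "\<forall>\<phi>\<in>vecs (dual_space X). vnorm (dual_space X) \<phi> =
      vnorm (dual_space X) (\<pi> \<phi>) + vnorm (dual_space X) (\<phi> - \<pi> \<phi>)"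
    unfolding is_M_ideal_def by (elim conjE exE)
  have \<phi>D: "\<phi> \<in> vecs (dual_space X)" "vnorm (dual_space X) \<phi> \<le> 1"
    and eD: "e \<in> vecs (dual_space X)" "vnorm (dual_space X) e \<le> 1"
    using \<phi> e by (auto simp: unit_ball_def)
  have fixed: "f = \<pi> f"
    if f: "f \<in> vecs (dual_space X)" "vnorm (dual_space X) f \<le> 1" "norm (f Q) = 1" for f
  proof -
    have \<pi>f: "\<pi> f \<in> vecs (dual_space X)" using \<pi> f(1) by blast
    have d: "f - \<pi> f \<in> vecs (dual_space X)" by (rule D.diff_mem[OF f(1) \<pi>f])
    have "\<pi> (f - \<pi> f + \<pi> f) = \<pi> (f - \<pi> f) + \<pi> (\<pi> f)" using \<pi>add d \<pi>f by blast
    then have "\<pi> (f - \<pi> f) = 0" using \<pi> f(1) by simp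
    then have "f - \<pi> f \<in> annihilator X J" using d ker by blast
    then have "(f - \<pi> f) Q = 0" using Q(1) by (simp add: annihilator_def)
    then have "norm (\<pi> f Q) = 1" using f(3) by simp
    moreover have "norm (\<pi> f Q) \<le> vnorm (dual_space X) (\<pi> f)"
      using Q(1,2) JX by (intro X.dual_norm_ball \<pi>f) (auto simp: unit_ball_def)
    ultimately have "vnorm (dual_space X) (f - \<pi> f) \<le> 0" using L f(1,2) by force
    then have "f - \<pi> f = 0" using D.norm_nonneg[OF d] D.norm_eq_0[OF d] by simp
    then show ?thesis by simp
  qed
  have d: "\<phi> - e \<in> vecs (dual_space X)" by (rule D.diff_mem[OF \<phi>D(1) eD(1)])
  moreover have "\<forall>y\<in>J. (\<phi> - e) y = 0" using agree by simp
  \<comment> \<open>Functionals that agree on \<open>J\<close> differ by a member of the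
    annihilator, the kernel of the projection.\<close>
  ultimately have "\<pi> (\<phi> - e) = 0" using ker unfolding annihilator_def by blast
  moreover have "\<pi> (\<phi> - e + e) = \<pi> (\<phi> - e) + \<pi> e" using \<pi>add d eD(1) by blast
  ultimately have "\<pi> \<phi> = \<pi> e" by simp
  moreover have "norm (\<phi> Q) = 1" using agree[OF Q(1)] Q(3) by simp
  ultimately show ?thesis using fixed[OF \<phi>D] fixed[OF eD Q(3)] by simp
qed

context normed_pair
begin

text \<open>Supplies the competitors for the farthest distance. A weakly convergent filter in E acts
  on T only through the scalar \<open>\<gamma> y\<close>, so convergence in norm is
  immediate.\<close>

lemma finite_type_weakly_continuous:
  fixes n :: nat
  assumes \<gamma>: "\<gamma> \<in> vecs (dual_space E)" and f: "f \<in> vecs F"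
  defines "T \<equiv> \<lambda>x. if x \<in> vecs E then smul F (\<gamma> x ^ n) f else 0"
  shows "T \<in> weakly_continuous_polys n E F"
proof -
  have A: "multilinear_map n E F (\<lambda>xs. smul F (prod_list (map \<gamma> xs)) f)"
    using f by (intro multilinear_mapI)
      (auto simp: E.dual_add[OF \<gamma>] E.dual_smul[OF \<gamma>] distrib_left distrib_right
        F.V.scale_left_distrib mult_ac)
  have "vnorm F (T x) \<le> (vnorm (dual_space E) \<gamma> ^ n * vnorm F f) * vnorm E x ^ n" if x: "x \<in> vecs E" for x
  proof -
    have "norm (\<gamma> x) ^ n \<le> (vnorm (dual_space E) \<gamma> * vnorm E x) ^ n"
      by (intro power_mono E.dual_norm_le[OF \<gamma> x]) simp
    then have "norm (\<gamma> x) ^ n * vnorm F f \<le> (vnorm (dual_space E) \<gamma> * vnorm E x) ^ n * vnorm F f"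
      using f by (intro mult_right_mono) auto
    then show ?thesis using x f by (simp add: T_def F.norm_smul norm_power power_mult_distrib mult_ac)
  qed
  moreover have "0 \<le> vnorm (dual_space E) \<gamma> ^ n * vnorm F f"
    using f E.dual_norm_nonneg[OF \<gamma>] by simp
  moreover have "\<exists>A. multilinear_map n E F A \<and> (\<forall>x\<in>vecs E. T x = A (replicate n x))"
    using A by (intro exI conjI) (auto simp: T_def)
  ultimately have TX: "T \<in> vecs (poly_space n E F)"
    unfolding poly_space_iff by (auto simp: T_def)
  have "((\<lambda>y. vnorm F (T y - T x)) \<longlongrightarrow> 0) \<F>"
    if x: "x \<in> vecs E" and bd: "\<forall>\<^sub>F y in \<F>. y \<in> vecs E \<and> vnorm E y \<le> r"
      and lim: "\<forall>\<phi>\<in>vecs (dual_space E). (\<phi> \<longlongrightarrow> \<phi> x) \<F>" for x \<F> r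
  proof (rule Lim_transform_eventually)
    have "((\<lambda>y. norm (\<gamma> y ^ n - \<gamma> x ^ n) * vnorm F f) \<longlongrightarrow> norm (\<gamma> x ^ n - \<gamma> x ^ n) * vnorm F f) \<F>"
      using lim \<gamma> by (intro tendsto_intros) auto
    then show "((\<lambda>y. norm (\<gamma> y ^ n - \<gamma> x ^ n) * vnorm F f) \<longlongrightarrow> 0) \<F>" by simp
    show "\<forall>\<^sub>F y in \<F>. norm (\<gamma> y ^ n - \<gamma> x ^ n) * vnorm F f = vnorm F (T y - T x)"
      using bd by eventually_elim
        (use x f in \<open>simp add: T_def F.norm_smul flip: F.V.scale_left_diff_distrib\<close>)
  qed
  with TX show ?thesis unfolding weakly_continuous_polys_def by blast
qed

lemma norm_add_one_le_rho:
  assumes "n \<ge> 1" and P: "P \<in> vecs (poly_space n E F)" "vnorm (poly_space n E F) P \<noteq> 0"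
  shows "vnorm (poly_space n E F) P + 1 \<le>
    rho (poly_space n E F) P (weakly_continuous_polys n E F \<inter> unit_ball (poly_space n E F))"
proof -
  let ?X = "poly_space n E F"
  interpret X: normed_sp ?X by (rule normed_sp.intro[OF normed_poly_space[OF assms(1)]])
  let ?B = "weakly_continuous_polys n E F \<inter> unit_ball ?X"
  have bdd: "bdd_above ((\<lambda>y. vnorm ?X (P - y)) ` ?B)"
  proof (rule bdd_aboveI2)
    fix y assume "y \<in> ?B"
    then have "y \<in> vecs ?X" "vnorm ?X y \<le> 1" by (auto simp: unit_ball_def)
    then show "vnorm ?X (P - y) \<le> vnorm ?X P + 1" using X.norm_diff_le[OF P(1), of y] by simp
  qed
  have unit: "vnorm F (P x) + 1 \<le> rho ?X P ?B"
    if x: "x \<in> vecs E" "vnorm E x = 1" "P x \<noteq> 0" for x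
  proof -
    obtain \<gamma> where \<gamma>: "\<gamma> \<in> unit_ball (dual_space E)" "\<gamma> x = of_real (vnorm E x)"
      using E.norming_functional[OF x(1)] by blast
    have \<gamma>D: "\<gamma> \<in> vecs (dual_space E)" "vnorm (dual_space E) \<gamma> \<le> 1" using \<gamma>(1) by (auto simp: unit_ball_def)
    have PxF: "P x \<in> vecs F" by (rule poly_mem[OF P(1) x(1)])
    have pos: "vnorm F (P x) > 0" using F.norm_eq_0[OF PxF] F.norm_nonneg[OF PxF] x(3) by linarith
    \<comment> \<open>The minus sign makes P x and - T x point in the same direction, so their norms
      add.\<close>
    define f where "f = smul F (of_real (- (1 / vnorm F (P x)))) (P x)"
    have f: "f \<in> vecs F" using PxF by (simp add: f_def)
    have nf: "vnorm F f = 1"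
      using pos unfolding f_def F.norm_smul[OF PxF] norm_of_real by simp
    define T where "T = (\<lambda>x. if x \<in> vecs E then smul F (\<gamma> x ^ n) f else 0)"
    have TJ: "T \<in> weakly_continuous_polys n E F"
      unfolding T_def by (rule finite_type_weakly_continuous[OF \<gamma>D(1) f])
    then have TX: "T \<in> vecs ?X" by (simp add: weakly_continuous_polys_def)
    have "vnorm ?X T \<le> 1"
    proof (rule poly_norm_leI)
      fix v assume v: "v \<in> unit_ball E"
      then have "v \<in> vecs E" by (simp add: unit_ball_def)
      moreover have "norm (\<gamma> v) \<le> 1" using E.dual_norm_ball[OF \<gamma>D(1) v] \<gamma>D(2) by simp
      ultimately show "vnorm F (T v) \<le> 1" using f nf by (simp add: T_def F.norm_smul norm_power power_le_one)
    qed
    with TJ TX have TB: "T \<in> ?B" by (simp add: unit_ball_def)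
    have "P x - T x = smul F (of_real (1 + 1 / vnorm F (P x))) (P x)"
      using x \<gamma>(2) by (simp add: T_def f_def F.V.scale_left_distrib F.V.scale_minus_left)
    then have "vnorm F ((P - T) x) = \<bar>1 + 1 / vnorm F (P x)\<bar> * vnorm F (P x)"
      by (simp only: fun_diff_def F.norm_smul[OF PxF] norm_of_real)
    also have "\<dots> = vnorm F (P x) + 1" using pos by (simp add: field_simps)
    finally have "vnorm F (P x) + 1 = vnorm F ((P - T) x)" by simp
    also have "\<dots> \<le> vnorm ?X (P - T)"
      using x by (intro poly_norm_ball X.diff_mem P(1) TX) (simp add: unit_ball_def)
    also have "\<dots> \<le> rho ?X P ?B" unfolding rho_def by (rule cSUP_upper[OF TB bdd])
    finally show ?thesis .
  qed
  have ball: "vnorm F (P x) + 1 \<le> rho ?X P ?B" if x: "x \<in> unit_ball E" "P x \<noteq> 0" for x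
  proof -
    have xE: "x \<in> vecs E" "vnorm E x \<le> 1" using x(1) by (auto simp: unit_ball_def)
    have "x \<noteq> 0"
    proof
      assume "x = 0"
      then have "P x = 0" using poly_hom[OF P(1) E.zero_mem, of 0] assms(1) by (simp add: power_0_left)
      with x(2) show False by simp
    qed
    then have pos: "vnorm E x > 0" using E.norm_eq_0[OF xE(1)] E.norm_nonneg[OF xE(1)] by linarith
    let ?c = "1 / vnorm E x"
    let ?u = "smul E (of_real ?c) x"
    have PxF: "P x \<in> vecs F" by (rule poly_mem[OF P(1) xE(1)])
    have Pu: "P ?u = smul F (of_real ?c ^ n) (P x)" by (rule poly_hom[OF P(1) xE(1)])
    then have nPu: "vnorm F (P ?u) = ?c ^ n * vnorm F (P x)"
      using pos by (simp add: F.norm_smul[OF PxF] norm_power norm_divide)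
    \<comment> \<open>The competitor needs \<open>\<gamma> x = 1\<close>, hence a unit vector.
      Rescaling to the sphere loses nothing: the norm of the value of P is multiplied by
      \<open>?c ^ n\<close>, which is at least 1.\<close>
    have "1 \<le> ?c ^ n" using pos xE(2) by (intro one_le_power) simp
    then have "1 * vnorm F (P x) \<le> ?c ^ n * vnorm F (P x)" using PxF by (intro mult_right_mono) auto
    moreover have "P ?u \<noteq> 0" using Pu x(2) pos by simp
    ultimately show ?thesis
      using unit[OF E.smul_mem[OF xE(1)] E.norm_normalize[OF xE(1) \<open>x \<noteq> 0\<close>]] nPu by simp
  qed
  have "\<exists>x\<in>unit_ball E. P x \<noteq> 0"
  proof (rule ccontr)
    assume "\<not> ?thesis"
    then have "vnorm ?X P \<le> 0" by (intro poly_norm_leI) simp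
    then show False using poly_norm_nonneg[OF P(1)] P(2) by simp
  qed
  then obtain x0 where "x0 \<in> unit_ball E" "P x0 \<noteq> 0" by blast
  moreover have "0 \<le> vnorm F (P x0)"
    using calculation by (intro F.norm_nonneg poly_mem[OF P(1)]) (simp add: unit_ball_def)
  \<comment> \<open>Covers the points where P vanishes, at which no competitor is built.\<close>
  ultimately have "1 \<le> rho ?X P ?B" using ball[of x0] by simp
  then have "vnorm F (P x) \<le> rho ?X P ?B - 1" if "x \<in> unit_ball E" for x
    using ball[OF that] by (cases "P x = 0") auto
  then have "vnorm ?X P \<le> rho ?X P ?B - 1" by (rule poly_norm_leI)
  then show ?thesis by simp
qed

lemma evaluation_in_dual_unit_ball:
  assumes "n \<ge> 1" and \<psi>: "\<psi> \<in> unit_ball (dual_space F)" and x: "x \<in> unit_ball E"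
  shows "(\<lambda>R. if R \<in> vecs (poly_space n E F) then \<psi> (R x) else 0) \<in> unit_ball (dual_space (poly_space n E F))"
proof -
  let ?X = "poly_space n E F"
  interpret X: normed_sp ?X by (rule normed_sp.intro[OF normed_poly_space[OF assms(1)]])
  have \<psi>D: "\<psi> \<in> vecs (dual_space F)" "vnorm (dual_space F) \<psi> \<le> 1" and xE: "x \<in> vecs E"
    using \<psi> x by (auto simp: unit_ball_def)
  show ?thesis
  proof (rule X.dual_unit_ballI)
    fix R assume R: "R \<in> vecs ?X"
    have "norm (\<psi> (R x)) \<le> vnorm (dual_space F) \<psi> * vnorm F (R x)"
      by (rule F.dual_norm_le[OF \<psi>D(1) poly_mem[OF R xE]])
    also have "\<dots> \<le> 1 * vnorm ?X R"
      using \<psi>D(2) poly_mem[OF R xE] by (intro mult_mono poly_norm_ball[OF R x]) auto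
    finally show "norm (if R \<in> vecs ?X then \<psi> (R x) else 0) \<le> vnorm ?X R" using R by simp
  next
    fix R c assume R: "R \<in> vecs ?X"
    then show "(if smul ?X c R \<in> vecs ?X then \<psi> (smul ?X c R x) else 0) = c * (if R \<in> vecs ?X then \<psi> (R x) else 0)"
      using X.smul_mem[OF R, of c] F.dual_smul[OF \<psi>D(1) poly_mem[OF R xE]] by simp
  qed (simp_all add: F.dual_add[OF \<psi>D(1)] poly_mem[OF _ xE])
qed

lemma aron_berner_in_dual_unit_ball:
  assumes "n \<ge> 1" and \<psi>: "\<psi> \<in> unit_ball (dual_space F)" and z: "z \<in> unit_ball (bidual_space E)"
  shows "(\<lambda>R. if R \<in> vecs (poly_space n E F) then aron_berner n E F R z \<psi> else 0)
    \<in> unit_ball (dual_space (poly_space n E F))"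
proof -
  let ?X = "poly_space n E F"
  interpret X: normed_sp ?X by (rule normed_sp.intro[OF normed_poly_space[OF assms(1)]])
  have \<psi>D: "\<psi> \<in> vecs (dual_space F)" "vnorm (dual_space F) \<psi> \<le> 1" and zE: "z \<in> vecs (bidual_space E)"
    using \<psi> z by (auto simp: unit_ball_def)
  show ?thesis
  proof (rule X.dual_unit_ballI)
    fix R assume R: "R \<in> vecs ?X"
    have "norm (aron_berner n E F R z \<psi>) \<le> vnorm (dual_space F) \<psi> * vnorm ?X R"
      by (rule aron_berner_norm_le[OF R z \<psi>D(1)])
    also have "\<dots> \<le> 1 * vnorm ?X R" using \<psi>D(2) R by (intro mult_right_mono) auto
    finally show "norm (if R \<in> vecs ?X then aron_berner n E F R z \<psi> else 0) \<le> vnorm ?X R" using R by simp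
  next
    fix R c assume R: "R \<in> vecs ?X"
    then show "(if smul ?X c R \<in> vecs ?X then aron_berner n E F (smul ?X c R) z \<psi> else 0)
        = c * (if R \<in> vecs ?X then aron_berner n E F R z \<psi> else 0)"
      using X.smul_mem[OF R, of c] aron_berner_linear(2)[OF assms(1) R R zE \<psi>D(1), of c] by simp
  next
    fix R R' assume R: "R \<in> vecs ?X" "R' \<in> vecs ?X"
    then show "(if R + R' \<in> vecs ?X then aron_berner n E F (R + R') z \<psi> else 0)
        = (if R \<in> vecs ?X then aron_berner n E F R z \<psi> else 0)
          + (if R' \<in> vecs ?X then aron_berner n E F R' z \<psi> else 0)"
      using aron_berner_linear(1)[OF assms(1) R zE \<psi>D(1)] by simp
  qed simp
qed

theorem remotal_aron_berner_attains:
  assumes "n \<ge> 1"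
    and M: "is_M_ideal (weakly_continuous_polys n E F) (poly_space n E F)"
    and rem: "P \<in> remotal_points (poly_space n E F)
      (weakly_continuous_polys n E F \<inter> unit_ball (poly_space n E F))"
  obtains z \<psi> where "z \<in> unit_ball (bidual_space E)" "\<psi> \<in> unit_ball (dual_space F)"
    "norm (aron_berner n E F P z \<psi>) = vnorm (poly_space n E F) P"
proof -
  let ?X = "poly_space n E F" and ?J = "weakly_continuous_polys n E F"
  interpret X: normed_sp ?X by (rule normed_sp.intro[OF normed_poly_space[OF assms(1)]])
  interpret DE: normed_sp "dual_space E" by (rule normed_sp_dual) (rule E.normed_sp_axioms)
  interpret DF: normed_sp "dual_space F" by (rule normed_sp_dual) (rule F.normed_sp_axioms)
  interpret BE: normed_sp "bidual_space E" by (rule normed_sp_dual) (rule DE.normed_sp_axioms)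
  obtain Q where P: "P \<in> vecs ?X" and Q: "Q \<in> ?J" "Q \<in> vecs ?X" "vnorm ?X Q \<le> 1"
    and far: "vnorm ?X (P - Q) = rho ?X P (?J \<inter> unit_ball ?X)"
    using rem unfolding remotal_points_def unit_ball_def by blast
  show ?thesis
  proof (cases "vnorm ?X P = 0")
    \<comment> \<open>The zero polynomial is set apart: the lower bound on \<open>rho\<close> builds
      its competitor from a nonzero value of P.\<close>
    case True
    have "norm (aron_berner n E F P 0 0) \<le> vnorm (dual_space F) 0 * vnorm ?X P"
      by (rule aron_berner_norm_le[OF P]) simp_all
    then show ?thesis using True that[of 0 0] by simp
  next
    case False
    have big: "vnorm ?X P + 1 \<le> vnorm ?X (P - Q)"
      using norm_add_one_le_rho[OF assms(1) P False] far by simp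
    have PQ: "P - Q \<in> vecs ?X" by (rule X.diff_mem[OF P Q(2)])
    have "\<exists>x\<in>unit_ball E. vnorm ?X P + 1 - 1 / real (Suc k) < vnorm F ((P - Q) x)" for k
    proof (rule ccontr)
      assume "\<not> ?thesis"
      then have "vnorm ?X (P - Q) \<le> vnorm ?X P + 1 - 1 / real (Suc k)" by (intro poly_norm_leI) force
      moreover have "0 < 1 / real (Suc k)" by simp
      ultimately show False using big by linarith
    qed
    then obtain x where x: "\<And>k. x k \<in> unit_ball E"
      and xk: "\<And>k. vnorm ?X P + 1 - 1 / real (Suc k) < vnorm F ((P - Q) (x k))" by metis
    have xE: "x k \<in> vecs E" for k using x[of k] by (simp add: unit_ball_def)
    have "\<exists>\<psi>\<in>unit_ball (dual_space F). \<psi> ((P - Q) (x k)) = of_real (vnorm F ((P - Q) (x k)))" for k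
      using F.norming_functional[OF poly_mem[OF PQ xE]] by blast
    then obtain \<psi> where \<psi>: "\<And>k. \<psi> k \<in> unit_ball (dual_space F)"
      and \<psi>k: "\<And>k. \<psi> k ((P - Q) (x k)) = of_real (vnorm F ((P - Q) (x k)))" by metis
    have \<psi>D: "\<psi> k \<in> vecs (dual_space F)" for k using \<psi>[of k] by (simp add: unit_ball_def)

    \<comment> \<open>Evaluations, cut off to 0 outside the relevant space:
      \<open>refine_filter_bounded_family\<close> asks for boundedness at every index of the ambient
      type.\<close>
    define h1 where "h1 \<phi> k = (if \<phi> \<in> vecs (dual_space E) then \<phi> (x k) else 0)" for \<phi> and k :: nat
    define h3 where "h3 R k = (if R \<in> vecs ?X then \<psi> k (R (x k)) else 0)" for R and k :: nat
    have h1: "(\<lambda>\<phi>. h1 \<phi> k) \<in> unit_ball (bidual_space E)" for k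
    proof (rule DE.dual_unit_ballI)
      fix \<phi> assume "\<phi> \<in> vecs (dual_space E)"
      then show "norm (h1 \<phi> k) \<le> vnorm (dual_space E) \<phi>"
        using E.dual_norm_ball[OF _ x, of \<phi>] by (simp add: h1_def)
    next
      fix \<phi> c assume "\<phi> \<in> vecs (dual_space E)"
      then show "h1 (smul (dual_space E) c \<phi>) k = c * h1 \<phi> k"
        using DE.smul_mem[of \<phi> c] by (simp add: h1_def)
    qed (simp_all add: h1_def)
    have h3: "(\<lambda>R. h3 R k) \<in> unit_ball (dual_space ?X)" for k
      unfolding h3_def by (rule evaluation_in_dual_unit_ball[OF assms(1) \<psi> x])

    have bdd1: "\<exists>M. \<forall>k. norm (h1 \<phi> k) \<le> M" for \<phi>
      using E.dual_norm_ball[OF _ x] by (cases "\<phi> \<in> vecs (dual_space E)") (auto simp: h1_def)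
    \<comment> \<open>Three successive refinements follow; each filter is finer than the one before,
      so limits found earlier persist.\<close>
    obtain \<G>1 z where G1: "\<G>1 \<le> sequentially" "\<G>1 \<noteq> bot" and z: "\<And>\<phi>. (h1 \<phi> \<longlongrightarrow> z \<phi>) \<G>1"
      by (rule refine_filter_bounded_family[where f = h1, OF sequentially_bot bdd1]) (rule that)
    have bdd2: "\<exists>M. \<forall>k. norm (\<psi> k f) \<le> M" for f
    proof (cases "f \<in> vecs F")
      case True
      have "norm (\<psi> k f) \<le> vnorm F f" for k
      proof -
        have "norm (\<psi> k f) \<le> vnorm (dual_space F) (\<psi> k) * vnorm F f" by (rule F.dual_norm_le[OF \<psi>D True])
        also have "\<dots> \<le> 1 * vnorm F f"
          using \<psi>[of k] True by (intro mult_right_mono) (auto simp: unit_ball_def)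
        finally show ?thesis by simp
      qed
      then show ?thesis by blast
    qed (auto simp: F.dual_outside[OF \<psi>D])
    obtain \<G>2 \<psi>0 where G2: "\<G>2 \<le> \<G>1" "\<G>2 \<noteq> bot" and \<psi>0: "\<And>f. ((\<lambda>k. \<psi> k f) \<longlongrightarrow> \<psi>0 f) \<G>2"
      by (rule refine_filter_bounded_family[where f = "\<lambda>f k. \<psi> k f", OF G1(2) bdd2]) (rule that)
    have bdd3: "\<exists>M. \<forall>k. norm (h3 R k) \<le> M" for R
    proof (cases "R \<in> vecs ?X")
      case True
      have "norm (h3 R k) \<le> vnorm ?X R" for k
      proof -
        have "norm (h3 R k) \<le> vnorm (dual_space ?X) (\<lambda>R. h3 R k) * vnorm ?X R"
          using h3[of k] by (intro X.dual_norm_le[of "\<lambda>R. h3 R k"] True) (simp add: unit_ball_def)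
        also have "\<dots> \<le> 1 * vnorm ?X R"
          using h3[of k] True by (intro mult_right_mono) (auto simp: unit_ball_def)
        finally show ?thesis by simp
      qed
      then show ?thesis by blast
    qed (auto simp: h3_def)
    obtain \<G> \<phi> where G: "\<G> \<le> \<G>2" "\<G> \<noteq> bot" and \<phi>: "\<And>R. (h3 R \<longlongrightarrow> \<phi> R) \<G>"
      by (rule refine_filter_bounded_family[where f = h3, OF G2(2) bdd3]) (rule that)
    have \<psi>0: "((\<lambda>k. \<psi> k f) \<longlongrightarrow> \<psi>0 f) \<G>" for f by (rule tendsto_mono[OF G(1) \<psi>0])
    have z: "((\<lambda>k. h1 \<phi> k) \<longlongrightarrow> z \<phi>) \<G>" for \<phi> by (rule tendsto_mono[OF order_trans[OF G(1) G2(1)] z])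
    have Gseq: "\<G> \<le> sequentially" using G(1) G2(1) G1(1) by (meson order_trans)

    have zB: "z \<in> unit_ball (bidual_space E)"
      by (rule DE.limit_in_dual_unit_ball[OF G(2) h1 z])
    have \<psi>0B: "\<psi>0 \<in> unit_ball (dual_space F)"
      by (rule F.limit_in_dual_unit_ball[OF G(2) \<psi> \<psi>0])
    have \<phi>B: "\<phi> \<in> unit_ball (dual_space ?X)"
      by (rule X.limit_in_dual_unit_ball[OF G(2) h3 \<phi>])
    define e where "e R = (if R \<in> vecs ?X then aron_berner n E F R z \<psi>0 else 0)" for R
    have eB: "e \<in> unit_ball (dual_space ?X)"
      unfolding e_def[abs_def] by (rule aron_berner_in_dual_unit_ball[OF assms(1) \<psi>0B zB])
    have agree: "\<phi> R = e R" if R: "R \<in> ?J" for R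
    proof -
      have RX: "R \<in> vecs ?X" using R by (simp add: weakly_continuous_polys_def)
      have "((\<lambda>k. \<phi> (x k)) \<longlongrightarrow> z \<phi>) \<G>" if "\<phi> \<in> vecs (dual_space E)" for \<phi>
        using z[of \<phi>] that by (simp add: h1_def)
      then have "((\<lambda>k. \<psi> k (R (x k))) \<longlongrightarrow> aron_berner n E F R z \<psi>0) \<G>"
        using \<psi>0B by (intro weakly_continuous_limit[OF R x \<psi> zB _ _ \<psi>0]) (auto simp: unit_ball_def)
      then have "((\<lambda>k. h3 R k) \<longlongrightarrow> e R) \<G>" using RX by (simp add: h3_def e_def)
      then show ?thesis by (rule tendsto_unique[OF G(2) \<phi>])
    qed
    have \<phi>D: "\<phi> \<in> vecs (dual_space ?X)" "vnorm (dual_space ?X) \<phi> \<le> 1" using \<phi>B by (auto simp: unit_ball_def)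
    have bound: "norm (\<phi> R) \<le> vnorm ?X R" if "R \<in> vecs ?X" for R
    proof -
      have "norm (\<phi> R) \<le> vnorm (dual_space ?X) \<phi> * vnorm ?X R" by (rule X.dual_norm_le[OF \<phi>D(1) that])
      also have "\<dots> \<le> 1 * vnorm ?X R" using \<phi>D(2) that by (intro mult_right_mono) auto
      finally show ?thesis by simp
    qed
    \<comment> \<open>Here \<open>\<G>\<close> has to be finer than \<open>sequentially\<close>: the
      correction 1 / Suc k must vanish along it.\<close>
    have "vnorm ?X P + 1 \<le> norm (\<phi> (P - Q))"
    proof (rule tendsto_lowerbound)
      show "((\<lambda>k. norm (h3 (P - Q) k) + 1 / real (Suc k)) \<longlongrightarrow> norm (\<phi> (P - Q))) \<G>"
      proof -
        have "((\<lambda>k. 1 / real (Suc k)) \<longlongrightarrow> 0) \<G>"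
          by (rule tendsto_mono[OF Gseq]) (rule lim_inverse_n'[THEN LIMSEQ_Suc])
        from tendsto_add[OF tendsto_norm[OF \<phi>[of "P - Q"]] this] show ?thesis by simp
      qed
      have "vnorm ?X P + 1 \<le> norm (h3 (P - Q) k) + 1 / real (Suc k)" for k
      proof -
        have "0 \<le> vnorm F ((P - Q) (x k))" by (intro F.norm_nonneg poly_mem[OF PQ xE])
        then have "norm (h3 (P - Q) k) = vnorm F ((P - Q) (x k))"
          using PQ \<psi>k[of k] by (simp only: h3_def if_True norm_of_real abs_of_nonneg)
        then show ?thesis using xk[of k] by simp
      qed
      then show "\<forall>\<^sub>F k in \<G>. vnorm ?X P + 1 \<le> norm (h3 (P - Q) k) + 1 / real (Suc k)"
        by (intro always_eventually allI)
    qed (rule G(2))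
    also have "\<phi> (P - Q) = \<phi> P - \<phi> Q" by (rule X.dual_diff[OF \<phi>D(1) P Q(2)])
    also have "norm (\<phi> P - \<phi> Q) \<le> norm (\<phi> P) + norm (\<phi> Q)" by (rule norm_triangle_ineq4)
    finally have "norm (\<phi> P) = vnorm ?X P" "norm (\<phi> Q) = 1"
      using bound[OF P] bound[OF Q(2)] Q(3) by auto
    moreover have "\<phi> = e"
    proof (rule M_ideal_unique_extension[OF X.normed_sp_axioms M \<phi>B eB agree Q(1,3)])
      show "norm (e Q) = 1" using \<open>norm (\<phi> Q) = 1\<close> agree[OF Q(1)] by simp
    qed
    ultimately have "norm (aron_berner n E F P z \<psi>0) = vnorm ?X P" using P by (simp add: e_def)
    with zB \<psi>0B that show ?thesis by blast
  qed
qed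

end

theorem proposition1p13:
  fixes E :: "('k::real_or_complex, 'e::ab_group_add) nspace"
    and F :: "('k, 'f::ab_group_add) nspace"
    and n :: nat
    and P :: "'e \<Rightarrow> 'f"
  assumes "is_banach_space E" and "is_banach_space F" and "n \<ge> 1"
    and "is_M_ideal (weakly_continuous_polys n E F) (poly_space n E F)"
    and "P \<in> remotal_points (poly_space n E F)
               (weakly_continuous_polys n E F \<inter> unit_ball (poly_space n E F))"
  shows "aron_berner n E F P \<in> vecs (poly_space n (bidual_space E) (bidual_space F)) \<and>
         (\<exists>z\<in>unit_ball (bidual_space E).
            vnorm (bidual_space F) (aron_berner n E F P z) =
            vnorm (poly_space n (bidual_space E) (bidual_space F)) (aron_berner n E F P))"
proof -
  interpret normed_pair E F
    using assms(1,2) by (simp add: normed_pair_def normed_sp_def is_banach_space_def)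
  interpret B: normed_pair "bidual_space E" "bidual_space F" by (rule normed_pair_bidual)
  interpret DF: normed_sp "dual_space F" by (rule normed_sp_dual) (rule F.normed_sp_axioms)
  let ?X = "poly_space n E F"
  have P: "P \<in> vecs ?X" using assms(5) by (simp add: remotal_points_def)
  note PB = aron_berner_poly[OF P]
  \<comment> \<open>Together with the value \<open>vnorm ?X P\<close> found at \<open>z\<close>
    below, this shows that the extension has the norm of P and that \<open>z\<close> attains
    it.\<close>
  have le: "vnorm (bidual_space F) (aron_berner n E F P z) \<le> vnorm ?X P" if z: "z \<in> unit_ball (bidual_space E)" for z
  proof (rule DF.dual_norm_leI)
    fix \<psi> assume "\<psi> \<in> unit_ball (dual_space F)"
    then have \<psi>: "\<psi> \<in> vecs (dual_space F)" "vnorm (dual_space F) \<psi> \<le> 1" by (auto simp: unit_ball_def)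
    have "norm (aron_berner n E F P z \<psi>) \<le> vnorm (dual_space F) \<psi> * vnorm ?X P"
      by (rule aron_berner_norm_le[OF P z \<psi>(1)])
    also have "\<dots> \<le> 1 * vnorm ?X P" using \<psi>(2) poly_norm_nonneg[OF P] by (rule mult_right_mono)
    finally show "norm (aron_berner n E F P z \<psi>) \<le> vnorm ?X P" by simp
  qed
  obtain z \<psi> where z: "z \<in> unit_ball (bidual_space E)" and \<psi>: "\<psi> \<in> unit_ball (dual_space F)"
    and eq: "norm (aron_berner n E F P z \<psi>) = vnorm ?X P"
    using remotal_aron_berner_attains[OF assms(3-5)] by blast
  have "aron_berner n E F P z \<in> vecs (bidual_space F)"
    using z by (intro B.poly_mem[OF PB]) (simp add: unit_ball_def)
  from DF.dual_norm_ball[OF this \<psi>]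
  have "vnorm ?X P \<le> vnorm (bidual_space F) (aron_berner n E F P z)" by (simp add: eq)
  moreover have "vnorm (poly_space n (bidual_space E) (bidual_space F)) (aron_berner n E F P) \<le> vnorm ?X P"
    by (rule B.poly_norm_leI) (rule le)
  moreover note B.poly_norm_ball[OF PB z]
  ultimately have "vnorm (bidual_space F) (aron_berner n E F P z)
      = vnorm (poly_space n (bidual_space E) (bidual_space F)) (aron_berner n E F P)"
    by linarith
  with PB z show ?thesis by blast
qed

end
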